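(* Let $I$ be a finite set and $z:\mathcal P(I)\to\hat{\mathbb R}$ a submodular function. The polynomial $\chi(z):=\theta\circ\overline\phi(z)$ associated to $z$ is $$\chi(z)(k)=\sum_{P\in\mathrm{minPre}(z)}\mathrm{Ehr}^*_{\Pi(P)}(k).$$ Thus, for integers $k\ge 0$, the polynomial counts the lattice points (points of $\mathbb Z^I$) in the (relative) interiors of the maximal cones of the normal fan of the extended generalized permutahedron $\Pi(z)$ intersected with the box $[0,k+1]^{I}$; that is, $\chi(z)(k)$ is the sum, over the maximal cones $K$ of the normal fan, of the number of lattice points in the relative interior of $K\cap[0,k+1]^I$.
   Context: Submodular functions. $\hat{\mathbb R}=\mathbb R\cup\{\infty\}$. A function $z:\mathcal P(I)\to\hat{\mathbb R}$ with $z(\emptyset)=0$, $z(I)<\infty$ is submodular if $z(A\cup B)+z(A\cap B)\le z(A)+z(B)$ for all $A,B\subseteq I$, and modular if equality always holds. If $z(S)<\infty$, $z|_S$ is the restriction to $\mathcal P(S)$ and $z_{/S}(U)=z(S\cup U)-z(S)$ for $U\subseteq I\setminus S$. For down-sets $A\subseteq B$ (below) $z_{B/A}=(z|_B)_{/A}$. The product of $u$ on $S$ and $v$ on $T$ is the function on $S\sqcup T$ given by $(u\cdot v)(E)=u(E\cap S)+v(E\cap T)$. $z'$ on $C$ decomposes along $C=C_1\sqcup C_2$ if $z'(E)=z'(E\cap C_1)+z'(E\cap C_2)$ for all $E\subseteq C$. Preorders. A preorder is a reflexive transitive relation; its bubbles are the classes of $x\sim y\Leftrightarrow x\le y\le x$.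 A down-set contains everything below its elements; convex subsets are $C=B\setminus A$ with $A\subseteq B$ down-sets; $C=C_1\sqcup C_2$ is a disconnected union if no element of $C_1$ is comparable to one of $C_2$. $P\preceq Q$ means $x\le_Py\Rightarrow x\le_Qy$. $P$ is totally disconnected if it is an equivalence relation. $P$ is compatible with $z$ if $z(A)<\infty$ for all down-sets $A$, and for down-sets $A\subseteq B$ with $B\setminus A=C_1\sqcup C_2$ a disconnected union, $z_{B/A}$ decomposes along $C_1\sqcup C_2$; then $z_{B/A}$ depends only on $C=B\setminus A$ and is written $z_C$. $P$ conforms to $z$ if moreover for convex $C$, any decomposition of $z_C$ along $C=C_1\sqcup C_2$ implies that $C=C_1\sqcup C_2$ is a disconnected union in $P$. $\mathrm{Pre}(z)$ is the set of conforming preorders, $\mathrm{minPre}(z)$ the set of its $\preceq$-minimal elements. For $P$ compatible with $z$: $z_P=\prod_{C\text{ bubble of }P}z_C$, and $z^P(A)=z(A)$ if $A$ is a down-set of $P$, $z^P(A)=\infty$ otherwise ($z^P$ is modular). $\mathrm{pre}(z)$ is the preorder whose down-sets are the $A$ with $z(A)<\infty$. Polyhedra. $\Pi(z)=\{x\in\mathbb RI:\sum_{i\in I}x_i=z(I),\ \sum_{i\in A}x_i\le z(A)\text{ for all }A\text{ with }z(A)<\infty\}$. Its normal fan in $\mathbb R^I=(\mathbb RI)^*$ consists of the cones $k(F)$, $F$ a non-empty face, where $k(F)$ is the closure of the set of $y\in\mathbb R^I$ whose set of maximizers on $\Pi(z)$ is exactly $F$. For a preorder $P$ on $I$, $\Pi(P)=\{y\in[0,1]^I: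 y_i\ge y_j\text{ whenever }i\le_Pj\}$, a lattice polytope. $\mathrm{Ehr}_{\Pi(P)}(k)$ is its Ehrhart polynomial (number of points of $k\cdot\Pi(P)\cap\mathbb Z^I$), and $\mathrm{Ehr}^*_{\Pi(P)}(k)=(-1)^{\dim\Pi(P)}\mathrm{Ehr}_{\Pi(P)}(-k-1)$. Algebra. Let $\mathrm{SM}[I]$ (resp. $\mathrm{MOD}[I]$) be the real vector space with basis the submodular (resp. modular) functions on $I$. For $I=S\sqcup T$ there is a product $u\otimes v\mapsto u\cdot v$, and a coproduct $\Delta_{S,T}(z)=z|_S\otimes z_{/S}$ if $z(S)<\infty$ and $0$ otherwise; on $\mathrm{MOD}[I]$ there is $\delta(z)=\sum_{Q\in\mathrm{Pre}(z)}z_Q\otimes z^Q$ with counit $\varepsilon_{\mathrm{MOD}}(z)=1$ if $\mathrm{pre}(z)$ is totally disconnected, $0$ otherwise. The map $\phi:\mathrm{SM}\to\mathrm{MOD}$ is $\phi(z)=\sum_{P\in\mathrm{minPre}(z)}z^P$. Passing to isomorphism classes (the bosonic Fock functor, $\bigoplus_n \mathrm{SM}[\{1,\dots,n\}]_{S_n}$, with coproduct $\Delta=\sum_{S\sqcup T}\Delta_{S,T}$) gives Hopf algebras $(\mathrm{SM},\mu,\Delta)$, $(\mathrm{MOD},\mu,\Delta)$, a double bialgebra $(\mathrm{MOD},\mu,\Delta,\delta)$, and a map $\overline\phi:\mathrm{SM}\to\mathrm{MOD}$ induced by $\phi$. A double bialgebra $(B,\mu,\Delta,\delta)$ consists of two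 bialgebras $(B,\mu,\Delta)$, $(B,\mu,\delta)$ with the same product such that $(\mathrm{id}\otimes\Delta)\circ\delta=m_{13,2,4}\circ(\delta\otimes\delta)\circ\Delta$ (where $m_{13,2,4}(a\otimes b\otimes c\otimes d)=ac\otimes b\otimes d$) and $(\mathrm{id}\otimes\epsilon_\Delta)\circ\delta=\eta\circ\epsilon_\Delta$. The polynomial algebra $\mathbb R[x]$ is a double bialgebra with $\Delta(x)=1\otimes x+x\otimes1$, $\delta(x)=x\otimes x$. By a theorem of Foissy, for a double bialgebra $B$ with $(B,\mu,\Delta)$ a Hopf algebra there is a unique double bialgebra morphism from $B$ to the polynomial double bialgebra; $\theta:\mathrm{MOD}\to\mathbb R[x]$ denotes this unique morphism. $\theta\circ\overline\phi(z)$ means its value on the isomorphism class of $z$. *)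

theory Defs
  imports
    "HOL-Analysis.Analysis"
    "HOL-Analysis.Finite_Function_Topology"
    "HOL-Library.FuncSet"
    "HOL-Library.Poly_Mapping"
    "HOL-Computational_Algebra.Polynomial"
begin

section \<open>Submodular functions\<close>

text \<open>A function from the power set of \<open>I\<close> to \<open>\<real> \<union> {\<infinity>}\<close> is an extended-real function that avoids
  \<open>-\<infinity>\<close> and is \<open>undefined\<close> outside \<open>Pow I\<close>, so that equality of such functions is equality in HOL.\<close>

definition submodular :: "'a set \<Rightarrow> ('a set \<Rightarrow> ereal) \<Rightarrow> bool" where
  "submodular I z \<longleftrightarrow> z \<in> extensional (Pow I) \<and> (\<forall>A\<subseteq>I. z A \<noteq> -\<infinity>) \<and> z {} = 0 \<and> z I < \<infinity> \<and>
     (\<forall>A\<subseteq>I. \<forall>B\<subseteq>I. z (A \<union> B) + z (A \<inter> B) \<le> z A + z B)"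

text \<open>Equality is demanded where \<open>z A\<close> and \<open>z B\<close> are finite. Demanding it everywhere would, applied
  to \<open>A\<close> and \<open>I - A\<close>, force \<open>z\<close> to be finite, and then \<open>preorder_fun\<close> below would not be modular.\<close>

definition modular :: "'a set \<Rightarrow> ('a set \<Rightarrow> ereal) \<Rightarrow> bool" where
  "modular I z \<longleftrightarrow> submodular I z \<and>
     (\<forall>A\<subseteq>I. \<forall>B\<subseteq>I. z A < \<infinity> \<longrightarrow> z B < \<infinity> \<longrightarrow> z (A \<union> B) + z (A \<inter> B) = z A + z B)"

definition restriction :: "('a set \<Rightarrow> ereal) \<Rightarrow> 'a set \<Rightarrow> ('a set \<Rightarrow> ereal)" where
  "restriction z S = restrict z (Pow S)"

definition contraction :: "'a set \<Rightarrow> ('a set \<Rightarrow> ereal) \<Rightarrow> 'a set \<Rightarrow> ('a set \<Rightarrow> ereal)" where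
  "contraction I z S = (\<lambda>U\<in>Pow (I - S). z (S \<union> U) - z S)"

definition minor :: "('a set \<Rightarrow> ereal) \<Rightarrow> 'a set \<Rightarrow> 'a set \<Rightarrow> ('a set \<Rightarrow> ereal)" where
  "minor z A B = contraction B (restriction z B) A"

definition fun_product ::
  "'a set \<Rightarrow> 'a set \<Rightarrow> ('a set \<Rightarrow> ereal) \<Rightarrow> ('a set \<Rightarrow> ereal) \<Rightarrow> ('a set \<Rightarrow> ereal)" where
  "fun_product S T u v = (\<lambda>E\<in>Pow (S \<union> T). u (E \<inter> S) + v (E \<inter> T))"

definition decomposes :: "('a set \<Rightarrow> ereal) \<Rightarrow> 'a set \<Rightarrow> 'a set \<Rightarrow> bool" where
  "decomposes w C1 C2 \<longleftrightarrow> (\<forall>E\<subseteq>C1 \<union> C2. w E = w (E \<inter> C1) + w (E \<inter> C2))"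

section \<open>Preorders\<close>

text \<open>A preorder on \<open>I\<close> is a relation \<open>P\<close> with \<open>preorder_on I P\<close>, where \<open>(x, y) \<in> P\<close> means \<open>x \<le> y\<close>;
  then the relation written \<open>P \<preceq> Q\<close> is \<open>P \<subseteq> Q\<close>.\<close>

definition bubbles :: "'a set \<Rightarrow> 'a rel \<Rightarrow> 'a set set" where
  "bubbles I P = I // (P \<inter> P\<inverse>)"

definition down_set :: "'a set \<Rightarrow> 'a rel \<Rightarrow> 'a set \<Rightarrow> bool" where
  "down_set I P A \<longleftrightarrow> A \<subseteq> I \<and> (\<forall>x y. (x, y) \<in> P \<longrightarrow> y \<in> A \<longrightarrow> x \<in> A)"

definition convex_subset :: "'a set \<Rightarrow> 'a rel \<Rightarrow> 'a set \<Rightarrow> bool" where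
  "convex_subset I P C \<longleftrightarrow> (\<exists>A B. down_set I P A \<and> down_set I P B \<and> A \<subseteq> B \<and> C = B - A)"

definition disconnected_union :: "'a rel \<Rightarrow> 'a set \<Rightarrow> 'a set \<Rightarrow> bool" where
  "disconnected_union P C1 C2 \<longleftrightarrow> C1 \<inter> C2 = {} \<and> (\<forall>x\<in>C1. \<forall>y\<in>C2. (x, y) \<notin> P \<and> (y, x) \<notin> P)"

definition totally_disconnected :: "'a set \<Rightarrow> 'a rel \<Rightarrow> bool" where
  "totally_disconnected I P \<longleftrightarrow> equiv I P"

definition compatible :: "'a set \<Rightarrow> ('a set \<Rightarrow> ereal) \<Rightarrow> 'a rel \<Rightarrow> bool" where
  "compatible I z P \<longleftrightarrow> preorder_on I P \<and> (\<forall>A. down_set I P A \<longrightarrow> z A < \<infinity>) \<and>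
     (\<forall>A B C1 C2. down_set I P A \<longrightarrow> down_set I P B \<longrightarrow> A \<subseteq> B \<longrightarrow> B - A = C1 \<union> C2 \<longrightarrow>
        disconnected_union P C1 C2 \<longrightarrow> decomposes (minor z A B) C1 C2)"

text \<open>For compatible \<open>P\<close> and convex \<open>C\<close>, the common value \<open>z\<^sub>C\<close> of the minors with \<open>B - A = C\<close>.\<close>

definition convex_minor :: "'a set \<Rightarrow> ('a set \<Rightarrow> ereal) \<Rightarrow> 'a rel \<Rightarrow> 'a set \<Rightarrow> ('a set \<Rightarrow> ereal)" where
  "convex_minor I z P C =
     (THE w. \<exists>A B. down_set I P A \<and> down_set I P B \<and> A \<subseteq> B \<and> C = B - A \<and> w = minor z A B)"

definition Pre :: "'a set \<Rightarrow> ('a set \<Rightarrow> ereal) \<Rightarrow> 'a rel set" where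
  "Pre I z = {P. compatible I z P \<and>
     (\<forall>C C1 C2. convex_subset I P C \<longrightarrow> C = C1 \<union> C2 \<longrightarrow> C1 \<inter> C2 = {} \<longrightarrow>
        decomposes (convex_minor I z P C) C1 C2 \<longrightarrow> disconnected_union P C1 C2)}"

definition minPre :: "'a set \<Rightarrow> ('a set \<Rightarrow> ereal) \<Rightarrow> 'a rel set" where
  "minPre I z = {P \<in> Pre I z. \<forall>Q\<in>Pre I z. Q \<subseteq> P \<longrightarrow> Q = P}"

text \<open>The functions \<open>z\<^sub>P\<close> and \<open>z\<^sup>P\<close>, and the preorder \<open>pre(z)\<close>.\<close>

definition bubble_fun :: "'a set \<Rightarrow> ('a set \<Rightarrow> ereal) \<Rightarrow> 'a rel \<Rightarrow> ('a set \<Rightarrow> ereal)" where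
  "bubble_fun I z P = (\<lambda>E\<in>Pow I. \<Sum>C\<in>bubbles I P. convex_minor I z P C (E \<inter> C))"

definition preorder_fun :: "'a set \<Rightarrow> ('a set \<Rightarrow> ereal) \<Rightarrow> 'a rel \<Rightarrow> ('a set \<Rightarrow> ereal)" where
  "preorder_fun I z P = (\<lambda>A\<in>Pow I. if down_set I P A then z A else \<infinity>)"

definition pre :: "'a set \<Rightarrow> ('a set \<Rightarrow> ereal) \<Rightarrow> 'a rel" where
  "pre I z = (THE P. preorder_on I P \<and> (\<forall>A\<subseteq>I. down_set I P A \<longleftrightarrow> z A < \<infinity>))"

section \<open>Polyhedra\<close>

text \<open>For \<open>I\<close> a set of elements of a finite type \<open>'a\<close>, the space \<open>\<real>I\<close> and its dual are both the
  coordinate subspace of \<^typ>\<open>real ^ 'a\<close> of vectors vanishing outside \<open>I\<close>, paired by the inner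
  product. All notions used below are intrinsic to that subspace, and \<open>I = {}\<close> is included.\<close>

definition coord_space :: "'a set \<Rightarrow> (real ^ 'a) set" where
  "coord_space I = {x. \<forall>i. i \<notin> I \<longrightarrow> x $ i = 0}"

definition lattice :: "'a set \<Rightarrow> (real ^ 'a) set" where
  "lattice I = {x \<in> coord_space I. \<forall>i\<in>I. x $ i \<in> \<int>}"

definition box_cube :: "'a set \<Rightarrow> real \<Rightarrow> (real ^ 'a) set" where
  "box_cube I c = {x \<in> coord_space I. \<forall>i\<in>I. 0 \<le> x $ i \<and> x $ i \<le> c}"

definition gen_perm :: "'a::finite set \<Rightarrow> ('a set \<Rightarrow> ereal) \<Rightarrow> (real ^ 'a) set" where
  "gen_perm I z = {x \<in> coord_space I. ereal (\<Sum>i\<in>I. x $ i) = z I \<and>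
     (\<forall>A\<subseteq>I. z A < \<infinity> \<longrightarrow> ereal (\<Sum>i\<in>A. x $ i) \<le> z A)}"

definition normal_cone :: "'a::finite set \<Rightarrow> (real ^ 'a) set \<Rightarrow> (real ^ 'a) set \<Rightarrow> (real ^ 'a) set" where
  "normal_cone I Q F =
     closure {y \<in> coord_space I. {x \<in> Q. \<forall>x'\<in>Q. y \<bullet> x' \<le> y \<bullet> x} = F}"

definition normal_fan :: "'a::finite set \<Rightarrow> (real ^ 'a) set \<Rightarrow> (real ^ 'a) set set" where
  "normal_fan I Q = {normal_cone I Q F | F. F face_of Q \<and> F \<noteq> {}}"

definition maximal_cones :: "'a::finite set \<Rightarrow> (real ^ 'a) set \<Rightarrow> (real ^ 'a) set set" where
  "maximal_cones I Q = {K \<in> normal_fan I Q. \<forall>K'\<in>normal_fan I Q. K \<subseteq> K' \<longrightarrow> K' = K}"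

definition preorder_polytope :: "'a::finite set \<Rightarrow> 'a rel \<Rightarrow> (real ^ 'a) set" where
  "preorder_polytope I P = {y \<in> box_cube I 1. \<forall>(i, j)\<in>P. y $ i \<ge> y $ j}"

definition ehrhart :: "'a::finite set \<Rightarrow> (real ^ 'a) set \<Rightarrow> real poly" where
  "ehrhart I Q = (THE p. \<forall>k::nat. k \<ge> 1 \<longrightarrow>
     poly p (real k) = real (card ((\<lambda>x. real k *\<^sub>R x) ` Q \<inter> lattice I)))"

definition ehrhart_star :: "'a::finite set \<Rightarrow> (real ^ 'a) set \<Rightarrow> real \<Rightarrow> real" where
  "ehrhart_star I Q k = (-1) ^ nat (aff_dim Q) * poly (ehrhart I Q) (- k - 1)"

section \<open>Isomorphism classes and Fock spaces\<close>

definition relabel :: "('a \<Rightarrow> 'b) \<Rightarrow> 'a set \<Rightarrow> ('a set \<Rightarrow> ereal) \<Rightarrow> ('b set \<Rightarrow> ereal)" where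
  "relabel f I z = (\<lambda>B\<in>Pow (f ` I). z {i \<in> I. f i \<in> B})"

text \<open>The orbit, under the symmetric group, of the relabellings of \<open>z\<close> on \<open>{1..n}\<close> with \<open>n = card I\<close>.\<close>

definition iso_class :: "'a set \<Rightarrow> ('a set \<Rightarrow> ereal) \<Rightarrow> (nat \<times> (nat set \<Rightarrow> ereal)) set" where
  "iso_class I z = {(card I, relabel f I z) | f. bij_betw f I {1..card I}}"

lemma modular_empty: "modular {} (\<lambda>A\<in>Pow {}. 0)"
  by (auto simp: modular_def submodular_def)

typedef sm_class = "{iso_class {1..n} z | (n::nat) z. submodular {1..n} z}"
  using modular_empty by (auto simp: modular_def intro!: exI[of _ "0::nat"])

typedef mod_class = "{iso_class {1..n} z | (n::nat) z. modular {1..n} z}"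
  using modular_empty by (auto intro!: exI[of _ "0::nat"])

definition sm_cls :: "'a set \<Rightarrow> ('a set \<Rightarrow> ereal) \<Rightarrow> sm_class" where
  "sm_cls I z = Abs_sm_class (iso_class I z)"

definition mod_cls :: "'a set \<Rightarrow> ('a set \<Rightarrow> ereal) \<Rightarrow> mod_class" where
  "mod_cls I z = Abs_mod_class (iso_class I z)"

text \<open>The structure maps on classes are computed on a chosen representative \<open>(n, z)\<close>; they commute
  with relabelling, so the choice is irrelevant.\<close>

definition sm_rep :: "sm_class \<Rightarrow> nat \<times> (nat set \<Rightarrow> ereal)" where
  "sm_rep c = (SOME (n, z). submodular {1..n} z \<and> sm_cls {1..n} z = c)"

definition mod_rep :: "mod_class \<Rightarrow> nat \<times> (nat set \<Rightarrow> ereal)" where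
  "mod_rep c = (SOME (n, z). modular {1..n} z \<and> mod_cls {1..n} z = c)"

text \<open>The real vector space with basis \<open>'b\<close> is \<^typ>\<open>'b \<Rightarrow>\<^sub>0 real\<close>. The coinvariants of a permutation
  representation have the orbits as basis, so \<open>SM\<close> and \<open>MOD\<close> are \<^typ>\<open>sm_class \<Rightarrow>\<^sub>0 real\<close> and
  \<^typ>\<open>mod_class \<Rightarrow>\<^sub>0 real\<close>, and \<open>MOD \<otimes> MOD\<close> is \<^typ>\<open>mod_class \<times> mod_class \<Rightarrow>\<^sub>0 real\<close>.\<close>

definition basis_vec :: "'b \<Rightarrow> ('b \<Rightarrow>\<^sub>0 real)" where
  "basis_vec b = Poly_Mapping.single b 1"

definition linear_ext :: "('b \<Rightarrow> 'v::real_vector) \<Rightarrow> ('b \<Rightarrow>\<^sub>0 real) \<Rightarrow> 'v" where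
  "linear_ext f u = (\<Sum>b\<in>Poly_Mapping.keys u. Poly_Mapping.lookup u b *\<^sub>R f b)"

definition phi_bar :: "(sm_class \<Rightarrow>\<^sub>0 real) \<Rightarrow> (mod_class \<Rightarrow>\<^sub>0 real)" where
  "phi_bar = linear_ext (\<lambda>c. case sm_rep c of (n, z) \<Rightarrow>
     \<Sum>P\<in>minPre {1..n} z. basis_vec (mod_cls {1..n} (preorder_fun {1..n} z P)))"

section \<open>The double bialgebra structure of \<open>MOD\<close>\<close>

definition class_mult :: "mod_class \<Rightarrow> mod_class \<Rightarrow> mod_class" where
  "class_mult c d = (case (mod_rep c, mod_rep d) of ((m, u), (n, v)) \<Rightarrow>
     mod_cls ({1..m} <+> {1..n})
       (fun_product (Inl ` {1..m}) (Inr ` {1..n}) (relabel Inl {1..m} u) (relabel Inr {1..n} v)))"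

definition mod_mult :: "(mod_class \<Rightarrow>\<^sub>0 real) \<Rightarrow> (mod_class \<Rightarrow>\<^sub>0 real) \<Rightarrow> (mod_class \<Rightarrow>\<^sub>0 real)" where
  "mod_mult x y = linear_ext (\<lambda>c. linear_ext (\<lambda>d. basis_vec (class_mult c d)) y) x"

definition mod_unit :: "mod_class \<Rightarrow>\<^sub>0 real" where
  "mod_unit = basis_vec (mod_cls ({} :: nat set) (\<lambda>A\<in>Pow {}. 0))"

definition mod_Delta :: "(mod_class \<Rightarrow>\<^sub>0 real) \<Rightarrow> (mod_class \<times> mod_class \<Rightarrow>\<^sub>0 real)" where
  "mod_Delta = linear_ext (\<lambda>c. case mod_rep c of (n, z) \<Rightarrow>
     \<Sum>S\<in>Pow {1..n}. if z S < \<infinity>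
       then basis_vec (mod_cls S (restriction z S), mod_cls ({1..n} - S) (contraction {1..n} z S))
       else 0)"

definition mod_eps_Delta :: "(mod_class \<Rightarrow>\<^sub>0 real) \<Rightarrow> real" where
  "mod_eps_Delta = linear_ext (\<lambda>c. case mod_rep c of (n, z) \<Rightarrow> if n = 0 then 1 else 0)"

definition mod_delta :: "(mod_class \<Rightarrow>\<^sub>0 real) \<Rightarrow> (mod_class \<times> mod_class \<Rightarrow>\<^sub>0 real)" where
  "mod_delta = linear_ext (\<lambda>c. case mod_rep c of (n, z) \<Rightarrow>
     \<Sum>Q\<in>Pre {1..n} z. basis_vec
       (mod_cls {1..n} (bubble_fun {1..n} z Q), mod_cls {1..n} (preorder_fun {1..n} z Q)))"

definition mod_eps_delta :: "(mod_class \<Rightarrow>\<^sub>0 real) \<Rightarrow> real" where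
  "mod_eps_delta = linear_ext (\<lambda>c. case mod_rep c of (n, z) \<Rightarrow>
     if totally_disconnected {1..n} (pre {1..n} z) then 1 else 0)"

section \<open>The double bialgebra \<open>\<real>[x]\<close> and the morphism \<open>\<theta>\<close>\<close>

text \<open>\<open>\<real>[x] \<otimes> \<real>[x]\<close> is realized as the algebra \<open>\<real>[x][y]\<close>, with \<open>p \<otimes> q\<close> the product \<open>p(x) q(y)\<close>.\<close>

definition poly_tensor :: "real poly \<Rightarrow> real poly \<Rightarrow> real poly poly" where
  "poly_tensor p q = [:p:] * map_poly (\<lambda>a. [:a:]) q"

definition poly_X :: "real poly" where
  "poly_X = [:0, 1:]"

text \<open>The algebra homomorphism from \<open>\<real>[x]\<close> to \<open>\<real>[x] \<otimes> \<real>[x]\<close> sending \<open>x\<close> to \<open>t\<close>.\<close>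

definition poly_subst :: "real poly poly \<Rightarrow> real poly \<Rightarrow> real poly poly" where
  "poly_subst t p = poly (map_poly (\<lambda>a. [:[:a:]:]) p) t"

definition poly_Delta :: "real poly \<Rightarrow> real poly poly" where
  "poly_Delta = poly_subst (poly_tensor 1 poly_X + poly_tensor poly_X 1)"

definition poly_delta :: "real poly \<Rightarrow> real poly poly" where
  "poly_delta = poly_subst (poly_tensor poly_X poly_X)"

definition tensor_map ::
  "((mod_class \<Rightarrow>\<^sub>0 real) \<Rightarrow> real poly) \<Rightarrow> (mod_class \<times> mod_class \<Rightarrow>\<^sub>0 real) \<Rightarrow> real poly poly" where
  "tensor_map f w = (\<Sum>(c, d)\<in>Poly_Mapping.keys w.
     smult [:Poly_Mapping.lookup w (c, d):] (poly_tensor (f (basis_vec c)) (f (basis_vec d))))"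

text \<open>The counits of \<open>\<real>[x]\<close> are evaluation at \<open>0\<close> (for \<open>\<Delta>\<close>) and at \<open>1\<close> (for \<open>\<delta>\<close>).\<close>

definition double_bialgebra_morphism :: "((mod_class \<Rightarrow>\<^sub>0 real) \<Rightarrow> real poly) \<Rightarrow> bool" where
  "double_bialgebra_morphism f \<longleftrightarrow>
     Vector_Spaces.linear scaleR smult f \<and>
     f mod_unit = 1 \<and> (\<forall>x y. f (mod_mult x y) = f x * f y) \<and>
     (\<forall>x. poly_Delta (f x) = tensor_map f (mod_Delta x)) \<and>
     (\<forall>x. poly (f x) 0 = mod_eps_Delta x) \<and>
     (\<forall>x. poly_delta (f x) = tensor_map f (mod_delta x)) \<and>
     (\<forall>x. poly (f x) 1 = mod_eps_delta x)"

definition theta :: "(mod_class \<Rightarrow>\<^sub>0 real) \<Rightarrow> real poly" where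
  "theta = (THE f. double_bialgebra_morphism f)"

definition chi :: "'a set \<Rightarrow> ('a set \<Rightarrow> ereal) \<Rightarrow> real poly" where
  "chi I z = theta (phi_bar (basis_vec (sm_cls I z)))"

end

theory Submission
  imports Defs
begin

text \<open>The value of \<open>\<theta>\<close> on a modular function with preorder \<open>P\<close> is the strict order polynomial of
  \<open>P\<close>: uniqueness holds because the coproduct \<open>\<Delta>\<close> and the counit of \<open>\<delta>\<close> force all values at natural
  numbers, and compatibility with \<open>\<delta>\<close> amounts to writing a strict map to \<open>k l\<close> values as a pair of a
  quotient and a remainder. Hence \<open>\<chi>(z)\<close> is the sum of the strict order polynomials of the minimal
  conforming preorders, and each of them is \<open>Ehr\<^sup>*\<close> of the order polytope by the reciprocity between
  strict and weak order-preserving maps. On the polyhedral side, the sets that are tight on a face of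
  \<open>\<Pi>(z)\<close> form a lattice of sets, that is, the down-sets of a preorder \<open>P\<close>; the preorders that occur
  are precisely the conforming ones, and the normal cone of the face is the cone of vectors that are
  weakly decreasing along \<open>P\<close>. So the maximal cones correspond to the minimal conforming preorders.\<close>

section \<open>Preorders and their down-sets\<close>

text \<open>Conformity is defined through minors on convex sets, yet both of its halves only compare
  \<open>z\<close> on the four sets \<open>X\<close>, \<open>Y\<close>, \<open>X \<inter> Y\<close>,
  \<open>X \<union> Y\<close>. In this form (\<open>Pre_iff\<close>) it speaks of lattices of
  down-sets, which is what both the counting and the polyhedral side produce. The obstacle on both
  sides is the same: a preorder is constructed inside a given one, and it must be excluded that it
  is strictly smaller. \<open>preorder_eq_by_splitting\<close> does this for the level closures of
  strict maps and for the tight preorders of faces. Since \<open>z\<close> may be infinite, \<Pi>(z)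
  may be unbounded, and a non-empty face for a given conforming preorder has to be constructed
  (\<open>ex_feasible_tight\<close>). The sign in the reciprocity is governed by the number of
  bubbles, which is also the dimension of the order polytope. Orientation: larger elements of a
  preorder carry smaller values, so down-sets are upper level sets. The box of side
  \<open>k + 1\<close> leaves the integers \<open>1, ..., k\<close> for an interior point, hence the
  \<open>k\<close> values of a strict map.\<close>

lemma down_set_subset: "down_set I P A \<Longrightarrow> A \<subseteq> I"
  by (simp add: down_set_def)

lemma down_setD: "down_set I P A \<Longrightarrow> (x, y) \<in> P \<Longrightarrow> y \<in> A \<Longrightarrow> x \<in> A"
  by (auto simp: down_set_def)

lemma down_set_empty [simp]: "down_set I P {}"
  by (simp add: down_set_def)

lemma down_set_carrier: "preorder_on I P \<Longrightarrow> down_set I P I"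
  by (auto simp: down_set_def preorder_on_def)

lemma down_set_Un: "down_set I P A \<Longrightarrow> down_set I P B \<Longrightarrow> down_set I P (A \<union> B)"
  by (auto simp: down_set_def)

lemma down_set_Int: "down_set I P A \<Longrightarrow> down_set I P B \<Longrightarrow> down_set I P (A \<inter> B)"
  by (auto simp: down_set_def)

lemma down_set_mono: "P \<subseteq> Q \<Longrightarrow> down_set I Q A \<Longrightarrow> down_set I P A"
  by (auto simp: down_set_def)

lemma preorder_reflD: "preorder_on I P \<Longrightarrow> x \<in> I \<Longrightarrow> (x, x) \<in> P"
  by (auto simp: preorder_on_def refl_on_def)

lemma preorder_transD: "preorder_on I P \<Longrightarrow> (x, y) \<in> P \<Longrightarrow> (y, w) \<in> P \<Longrightarrow> (x, w) \<in> P"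
  by (auto simp: preorder_on_def dest: transD)

lemma preorder_fieldD: "preorder_on I P \<Longrightarrow> (x, y) \<in> P \<Longrightarrow> x \<in> I \<and> y \<in> I"
  by (auto simp: preorder_on_def)

lemma down_set_principal: "preorder_on I P \<Longrightarrow> down_set I P {x. (x, y) \<in> P}"
  unfolding down_set_def using preorder_transD preorder_fieldD by fast

text \<open>Principal down-sets recover the relation, so passing from preorders to their down-sets
  is injective and reverses inclusion.\<close>

lemma preorder_subset_iff:
  assumes "preorder_on I P" "preorder_on I Q"
  shows "P \<subseteq> Q \<longleftrightarrow> (\<forall>A. down_set I Q A \<longrightarrow> down_set I P A)"
proof
  assume *: "\<forall>A. down_set I Q A \<longrightarrow> down_set I P A"
  show "P \<subseteq> Q"
  proof clarify
    fix x y assume xy: "(x, y) \<in> P"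
    then have "(y, y) \<in> Q"
      using assms preorder_fieldD preorder_reflD by metis
    moreover have "down_set I P {x. (x, y) \<in> Q}"
      using * down_set_principal[OF assms(2)] by blast
    ultimately show "(x, y) \<in> Q"
      using xy by (auto dest: down_setD)
  qed
qed (auto dest: down_set_mono)

lemma preorder_eq_iff:
  assumes "preorder_on I P" "preorder_on I Q"
  shows "P = Q \<longleftrightarrow> (\<forall>A. down_set I P A \<longleftrightarrow> down_set I Q A)"
  using preorder_subset_iff[OF assms] preorder_subset_iff[OF assms(2,1)] by blast

lemma preorder_eqI_down_sets:
  assumes "preorder_on I P" "preorder_on I Q" "\<And>A. A \<subseteq> I \<Longrightarrow> down_set I P A \<longleftrightarrow> down_set I Q A"
  shows "P = Q"
  using preorder_eq_iff[OF assms(1,2)] assms(3) down_set_subset by metis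

lemma finite_preorders: "finite I \<Longrightarrow> finite {P. preorder_on I P}"
  by (rule finite_subset[of _ "Pow (I \<times> I)"]) (auto simp: preorder_on_def)

text \<open>Birkhoff's correspondence for finite rings of sets: finiteness of \<open>I\<close>
  yields all unions and intersections from the binary ones. It produces both \<open>pre\<close> and
  the tight preorders.\<close>

lemma preorder_of_lattice:
  assumes fin: "finite I" and sub: "\<And>A. L A \<Longrightarrow> A \<subseteq> I" and emp: "L {}" and car: "L I"
    and un: "\<And>A B. L A \<Longrightarrow> L B \<Longrightarrow> L (A \<union> B)" and int: "\<And>A B. L A \<Longrightarrow> L B \<Longrightarrow> L (A \<inter> B)"
  obtains P where "preorder_on I P" "\<And>A. down_set I P A \<longleftrightarrow> L A"
proof
  \<comment> \<open>The specialization preorder: \<open>x\<close> is below \<open>y\<close> if no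
    member of the family contains \<open>y\<close> without \<open>x\<close>.\<close>
  define P where "P = {(x, y). x \<in> I \<and> y \<in> I \<and> (\<forall>A. L A \<longrightarrow> y \<in> A \<longrightarrow> x \<in> A)}"
  show pre: "preorder_on I P"
    by (auto simp: preorder_on_def P_def refl_on_def intro!: transI)
  have finL: "finite {A. L A}"
    by (rule finite_subset[of _ "Pow I"]) (use sub fin in auto)
  have Inter: "L (I \<inter> \<Inter>F)" if "finite F" "F \<subseteq> {A. L A}" for F
    using that
  proof (induction F)
    case (insert A F)
    then have "L (A \<inter> (I \<inter> \<Inter>F))"
      using int by auto
    then show ?case by (simp add: Int_left_commute)
  qed (use car in auto)
  have Union: "L (\<Union>F)" if "finite F" "F \<subseteq> {A. L A}" for F
    using that by (induction F) (use emp un in auto)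
  fix A
  show "down_set I P A \<longleftrightarrow> L A"
  proof
    assume A: "down_set I P A"
    \<comment> \<open>For \<open>y\<close> in \<open>I\<close>, \<open>?p y\<close> is the smallest
      member of the family containing \<open>y\<close>; a down-set is the union of these over its
      elements.\<close>
    let ?p = "\<lambda>y. I \<inter> \<Inter>{B. L B \<and> y \<in> B}"
    have "L (?p y)" for y
      by (rule Inter) (use finL in \<open>auto intro: finite_subset\<close>)
    moreover have "finite (?p ` A)"
      using A fin by (auto simp: down_set_def intro: finite_subset)
    ultimately have "L (\<Union>y\<in>A. ?p y)"
      by (intro Union) auto
    moreover have "(\<Union>y\<in>A. ?p y) = A"
      using A by (auto simp: down_set_def P_def)
    ultimately show "L A" by simp
  qed (use sub in \<open>auto simp: down_set_def P_def\<close>)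
qed

text \<open>A failure \<open>i \<le> j\<close>, \<open>j \<in> X\<close>, \<open>i \<notin> X\<close> whose interval is smallest has an interval made of the
  two bubbles of \<open>i\<close> and \<open>j\<close> only; \<open>X\<close> then splits this interval.\<close>

lemma preorder_eq_by_splitting:
  assumes fin: "finite I" and Q: "preorder_on I Q" and R: "preorder_on I R" and RQ: "R \<subseteq> Q"
    and sym: "\<And>w c. (w, c) \<in> R \<Longrightarrow> (c, w) \<in> Q \<Longrightarrow> (c, w) \<in> R"
    and split: "\<And>X Y. X \<subseteq> I \<Longrightarrow> Y \<subseteq> I \<Longrightarrow> down_set I Q (X \<inter> Y) \<Longrightarrow> down_set I Q (X \<union> Y) \<Longrightarrow>
      down_set I R X \<Longrightarrow> down_set I R Y \<Longrightarrow> down_set I Q X"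
  shows "Q = R"
proof -
  have "down_set I Q X" if X: "down_set I R X" for X
  proof (rule ccontr)
    assume "\<not> down_set I Q X"
    then obtain i0 j0 where bad0: "(i0, j0) \<in> Q \<and> j0 \<in> X \<and> i0 \<notin> X"
      using X by (auto simp: down_set_def)
    define bad where "bad = (\<lambda>(i, j). (i, j) \<in> Q \<and> j \<in> X \<and> i \<notin> X)"
    define itv where "itv = (\<lambda>(i, j). {k. (i, k) \<in> Q \<and> (k, j) \<in> Q})"
    have itvI: "itv p \<subseteq> I" for p
      using preorder_fieldD[OF Q] by (auto simp: itv_def)
    have "bad (i0, j0)" using bad0 by (simp add: bad_def)
    then obtain p where p: "bad p" and least: "\<And>q. bad q \<Longrightarrow> card (itv p) \<le> card (itv q)"
      using ex_has_least_nat[of bad _ "\<lambda>p. card (itv p)"] by blast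
    obtain i j where pij: "p = (i, j)" by force
    have ij: "(i, j) \<in> Q" "j \<in> X" "i \<notin> X" using p by (auto simp: bad_def pij)
    have eq: "itv q = itv p" if "bad q" "itv q \<subseteq> itv p" for q
      using card_seteq[OF finite_subset[OF itvI fin] that(2) least[OF that(1)]] .
    have inI: "i \<in> I" "j \<in> I" using preorder_fieldD[OF Q ij(1)] by auto
    have ij_itv: "i \<in> itv p" "j \<in> itv p"
      using ij preorder_reflD[OF Q] inI by (auto simp: itv_def pij)
    \<comment> \<open>\<open>(i, k)\<close> is again a bad pair, with interval inside that of
      \<open>(i, j)\<close>; minimality makes the intervals equal, so \<open>j\<close> lies below
      \<open>k\<close>. In the same way every \<open>k\<close> of the interval outside
      \<open>X\<close> lies below \<open>i\<close>.\<close>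
    have kX: "(j, k) \<in> Q" if "k \<in> itv p" "k \<in> X" for k
    proof -
      have "itv (i, k) = itv p"
        by (rule eq) (use that ij preorder_transD[OF Q] in \<open>auto simp: bad_def itv_def pij\<close>)
      then show ?thesis using ij_itv(2) by (auto simp: itv_def)
    qed
    have kN: "(k, i) \<in> Q" if "k \<in> itv p" "k \<notin> X" for k
    proof -
      have "itv (k, j) = itv p"
        by (rule eq) (use that ij preorder_transD[OF Q] in \<open>auto simp: bad_def itv_def pij\<close>)
      then show ?thesis using ij_itv(1) by (auto simp: itv_def)
    qed
    \<comment> \<open>Two down-sets of \<open>Q\<close> whose difference is the minimal interval, so
      that \<open>split\<close> can be applied between them.\<close>
    define B where "B = {k. (k, j) \<in> Q}"
    define A where "A = {k \<in> B. (i, k) \<notin> Q}"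
    have B: "down_set I Q B" unfolding B_def by (rule down_set_principal[OF Q])
    have A: "down_set I Q A"
      using B preorder_transD[OF Q] by (fastforce simp: down_set_def A_def)
    have BA: "B - A = itv p" by (auto simp: B_def A_def itv_def pij)
    have AB: "A \<subseteq> B" by (auto simp: A_def)
    have RA: "down_set I R A" and RB: "down_set I R B"
      using A B down_set_mono[OF RQ] by auto
    \<comment> \<open>If \<open>w\<close> in \<open>X\<close> were \<open>R\<close>-below
      \<open>c\<close> outside \<open>X\<close>, then \<open>c \<le> i \<le> j \<le> w\<close> in
      \<open>Q\<close>, and \<open>sym\<close> would reverse the pair in \<open>R\<close>, against
      \<open>X\<close> being an \<open>R\<close>-down-set.\<close>
    have RY: "down_set I R (A \<union> (B - X))"
    proof -
      have "w \<in> A \<union> (B - X)" if wc: "(w, c) \<in> R" and c: "c \<in> A \<union> (B - X)" for w c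
      proof (rule ccontr)
        assume nw: "w \<notin> A \<union> (B - X)"
        have "c \<notin> A" using nw wc RA by (auto dest: down_setD)
        then have cc: "c \<in> itv p" "c \<notin> X" using c BA by auto
        have "w \<in> B" using wc c RB AB by (auto dest: down_setD)
        then have ww: "w \<in> itv p" "w \<in> X" using nw BA by auto
        have "(c, i) \<in> Q" "(j, w) \<in> Q" using kN[OF cc] kX[OF ww] by auto
        then have "(c, w) \<in> Q" using preorder_transD[OF Q] ij(1) by blast
        then have "(c, w) \<in> R" using sym[OF wc] by blast
        then show False using X ww(2) cc(2) by (auto dest: down_setD)
      qed
      then show ?thesis using down_set_subset[OF B] AB by (auto simp: down_set_def)
    qed
    have RX: "down_set I R (A \<union> (X \<inter> B))"
      by (intro down_set_Un down_set_Int RA RB X)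
    have "down_set I Q (A \<union> (X \<inter> B))"
    proof (rule split[OF _ _ _ _ RX RY])
      have "(A \<union> X \<inter> B) \<inter> (A \<union> (B - X)) = A" "(A \<union> X \<inter> B) \<union> (A \<union> (B - X)) = B"
        using AB by auto
      then show "down_set I Q ((A \<union> X \<inter> B) \<inter> (A \<union> (B - X)))"
         "down_set I Q ((A \<union> X \<inter> B) \<union> (A \<union> (B - X)))"
        using A B by auto
    qed (use RX RY down_set_subset in auto)
    moreover have "j \<in> A \<union> (X \<inter> B)"
      using ij inI preorder_reflD[OF Q] by (auto simp: B_def)
    ultimately have "i \<in> A \<union> (X \<inter> B)" using ij(1) by (auto dest: down_setD)
    then show False using ij inI preorder_reflD[OF Q] by (auto simp: A_def)
  qed
  then have "Q \<subseteq> R" using preorder_subset_iff[OF Q R] by blast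
  then show ?thesis using RQ by blast
qed

section \<open>Submodular and modular functions\<close>

lemma submodular_ne_minf: "submodular I z \<Longrightarrow> A \<subseteq> I \<Longrightarrow> z A \<noteq> -\<infinity>"
  by (auto simp: submodular_def)

lemma submodularD:
  "submodular I z \<Longrightarrow> A \<subseteq> I \<Longrightarrow> B \<subseteq> I \<Longrightarrow> z (A \<union> B) + z (A \<inter> B) \<le> z A + z B"
  by (auto simp: submodular_def)

lemma submodular_finite:
  assumes "submodular I z" "A \<subseteq> I" "z A < \<infinity>"
  obtains r where "z A = ereal r"
  using submodular_ne_minf[OF assms(1,2)] assms(3) by (cases "z A") auto

lemma submodular_finite_Un:
  assumes "submodular I z" "A \<subseteq> I" "B \<subseteq> I" "z A < \<infinity>" "z B < \<infinity>"
  shows "z (A \<union> B) < \<infinity>" "z (A \<inter> B) < \<infinity>"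
proof -
  have "z (A \<union> B) + z (A \<inter> B) < \<infinity>"
    using submodularD[OF assms(1-3)] assms(4,5) by (cases "z A"; cases "z B") auto
  moreover have "z (A \<union> B) \<noteq> -\<infinity>" "z (A \<inter> B) \<noteq> -\<infinity>"
    using submodular_ne_minf[OF assms(1)] assms(2,3) by (metis Un_least, metis le_infI1)
  ultimately show "z (A \<union> B) < \<infinity>" "z (A \<inter> B) < \<infinity>"
    by (cases "z (A \<union> B)"; cases "z (A \<inter> B)"; auto)+
qed

lemma minor_apply: "A \<subseteq> B \<Longrightarrow> E \<subseteq> B - A \<Longrightarrow> minor z A B E = z (A \<union> E) - z A"
  by (auto simp: minor_def contraction_def restriction_def intro!: arg_cong2[of _ _ _ _ "(-)"])

section \<open>Conformity in terms of down-sets\<close>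

text \<open>Only the equation for \<open>E = C1 \<union> C2\<close> has content: submodularity
  propagates this one equality to all subsets \<open>E\<close>.\<close>

lemma decomposes_minor_iff:
  assumes sm: "submodular I z" and AB: "A \<subseteq> B" "B \<subseteq> I" and fin: "z A < \<infinity>" "z B < \<infinity>"
    and C: "B - A = C1 \<union> C2" "C1 \<inter> C2 = {}"
  shows "decomposes (minor z A B) C1 C2 \<longleftrightarrow> z (A \<union> C1) + z (A \<union> C2) = z A + z B"
proof -
  obtain a where a: "z A = ereal a" using submodular_finite[OF sm _ fin(1)] AB by auto
  obtain b where b: "z B = ereal b" using submodular_finite[OF sm _ fin(2)] AB by auto
  have m: "minor z A B E = z (A \<union> E) - z A" if "E \<subseteq> C1 \<union> C2" for E
    using minor_apply[OF AB(1), of E] that C by auto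
  have ABC: "A \<union> (C1 \<union> C2) = B" using AB C by auto
  have ni: "z (A \<union> E) \<noteq> -\<infinity>" if "E \<subseteq> C1 \<union> C2" for E
    using submodular_ne_minf[OF sm, of "A \<union> E"] that AB C by blast
  show ?thesis
  proof
    assume "decomposes (minor z A B) C1 C2"
    then have "minor z A B (C1 \<union> C2) = minor z A B ((C1 \<union> C2) \<inter> C1) + minor z A B ((C1 \<union> C2) \<inter> C2)"
      unfolding decomposes_def by blast
    moreover have "(C1 \<union> C2) \<inter> C1 = C1" "(C1 \<union> C2) \<inter> C2 = C2" by auto
    ultimately have "z B - z A = (z (A \<union> C1) - z A) + (z (A \<union> C2) - z A)"
      using m ABC by simp
    then show "z (A \<union> C1) + z (A \<union> C2) = z A + z B"
      unfolding a b using ni[of C1] ni[of C2]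
      by (cases "z (A \<union> C1)"; cases "z (A \<union> C2)") auto
  next
    assume eq: "z (A \<union> C1) + z (A \<union> C2) = z A + z B"
    obtain c1 c2 where c: "z (A \<union> C1) = ereal c1" "z (A \<union> C2) = ereal c2"
      using eq ni[of C1] ni[of C2] unfolding a b
      by (cases "z (A \<union> C1)"; cases "z (A \<union> C2)") auto
    show "decomposes (minor z A B) C1 C2"
      unfolding decomposes_def
    proof (intro allI impI)
      fix E assume E: "E \<subseteq> C1 \<union> C2"
      have I: "A \<union> E \<subseteq> I" "A \<union> (E \<inter> C1) \<subseteq> I" "A \<union> (E \<inter> C2) \<subseteq> I" "A \<union> C1 \<subseteq> I" "A \<union> C2 \<subseteq> I"
        "A \<union> E \<union> C1 \<subseteq> I" using AB C E by auto
      \<comment> \<open>Adding inequalities 2 and 3 below and inserting the assumed equality gives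
        the reverse of inequality 1.\<close>
      have 1: "z (A \<union> E) + z A \<le> z (A \<union> (E \<inter> C1)) + z (A \<union> (E \<inter> C2))"
      proof -
        have "(A \<union> (E \<inter> C1)) \<union> (A \<union> (E \<inter> C2)) = A \<union> E" "(A \<union> (E \<inter> C1)) \<inter> (A \<union> (E \<inter> C2)) = A"
          using E C by auto
        then show ?thesis using submodularD[OF sm I(2,3)] by simp
      qed
      have 2: "z (A \<union> E \<union> C1) + z (A \<union> (E \<inter> C1)) \<le> z (A \<union> E) + z (A \<union> C1)"
      proof -
        have "(A \<union> E) \<union> (A \<union> C1) = A \<union> E \<union> C1" "(A \<union> E) \<inter> (A \<union> C1) = A \<union> (E \<inter> C1)" by auto
        then show ?thesis using submodularD[OF sm I(1,4)] by simp
      qed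
      have 3: "z B + z (A \<union> (E \<inter> C2)) \<le> z (A \<union> E \<union> C1) + z (A \<union> C2)"
      proof -
        have "(A \<union> E \<union> C1) \<union> (A \<union> C2) = B" "(A \<union> E \<union> C1) \<inter> (A \<union> C2) = A \<union> (E \<inter> C2)"
          using E C AB by auto
        then show ?thesis using submodularD[OF sm I(6,5)] by simp
      qed
      have "z (A \<union> E) - z A = (z (A \<union> (E \<inter> C1)) - z A) + (z (A \<union> (E \<inter> C2)) - z A)"
        using 1 2 3 eq submodular_ne_minf[OF sm I(1)] submodular_ne_minf[OF sm I(2)]
          submodular_ne_minf[OF sm I(3)] submodular_ne_minf[OF sm I(6)]
        unfolding a b c
        by (cases "z (A \<union> E)"; cases "z (A \<union> (E \<inter> C1))"; cases "z (A \<union> (E \<inter> C2))";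
            cases "z (A \<union> E \<union> C1)") auto
      then show "minor z A B E = minor z A B (E \<inter> C1) + minor z A B (E \<inter> C2)"
        using m[of E] m[of "E \<inter> C1"] m[of "E \<inter> C2"] E by (auto simp: le_infI2)
    qed
  qed
qed

text \<open>Since \<open>A\<close> and \<open>B\<close> are down-sets, an element below
  \<open>C1\<close> lies in \<open>A\<close>, \<open>C1\<close> or \<open>C2\<close>, and
  incomparability excludes \<open>C2\<close>. This gives the order side of conformity the form that
  \<open>decomposes_minor_iff\<close> gives to the side of \<open>z\<close>.\<close>

lemma disconnected_union_iff_down_sets:
  assumes P: "preorder_on I P" and A: "down_set I P A" and B: "down_set I P B" and "A \<subseteq> B"
    and C: "B - A = C1 \<union> C2" "C1 \<inter> C2 = {}"
  shows "disconnected_union P C1 C2 \<longleftrightarrow> down_set I P (A \<union> C1) \<and> down_set I P (A \<union> C2)"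
proof
  assume d: "disconnected_union P C1 C2"
  have "w \<in> A \<union> C1" if "(w, c) \<in> P" "c \<in> C1" for w c
  proof -
    have "w \<in> B" using that C B by (auto dest!: down_setD)
    then show ?thesis using that d C unfolding disconnected_union_def by blast
  qed
  moreover have "w \<in> A \<union> C2" if "(w, c) \<in> P" "c \<in> C2" for w c
  proof -
    have "w \<in> B" using that C B by (auto dest!: down_setD)
    then show ?thesis using that d C unfolding disconnected_union_def by blast
  qed
  ultimately show "down_set I P (A \<union> C1) \<and> down_set I P (A \<union> C2)"
    using A down_set_subset[OF B] C unfolding down_set_def by blast
next
  assume "down_set I P (A \<union> C1) \<and> down_set I P (A \<union> C2)"
  then show "disconnected_union P C1 C2"
    using C unfolding disconnected_union_def down_set_def by blast
qed

lemma compatibleD: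
  assumes "compatible I z P" "down_set I P A" "down_set I P B" "A \<subseteq> B" "B - A = C1 \<union> C2"
    "disconnected_union P C1 C2"
  shows "decomposes (minor z A B) C1 C2"
  using assms unfolding compatible_def by metis

text \<open>Two intervals with the same difference are both compared with the interval from
  \<open>A \<union> A'\<close> to \<open>B \<union> B'\<close>, whose difference is again the same;
  so the definite description is well defined.\<close>

lemma convex_minor_eq:
  assumes sm: "submodular I z" and comp: "compatible I z P"
    and A: "down_set I P A" and B: "down_set I P B" and AB: "A \<subseteq> B"
  shows "convex_minor I z P (B - A) = minor z A B"
proof -
  \<comment> \<open>The nested case: the part \<open>D\<close> added to the lower end is
    disconnected from \<open>B - A\<close>, so compatibility splits \<open>D\<close> off and its
    value cancels.\<close>
  have main: "minor z A B = minor z A' B'"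
    if d: "down_set I P A" "down_set I P B" "down_set I P A'" "down_set I P B'"
      and le: "A \<subseteq> B" "A' \<subseteq> B'" "A \<subseteq> A'" and eq: "B - A = B' - A'" for A B A' B'
  proof
    fix E
    define D where "D = A' - A"
    have B'A: "B' - A = (B - A) \<union> D" "(B - A) \<inter> D = {}" using le eq by (auto simp: D_def)
    have "disconnected_union P (B - A) D"
      unfolding disconnected_union_def
    proof (intro conjI ballI)
      fix x y assume x: "x \<in> B - A" and y: "y \<in> D"
      show "(x, y) \<notin> P" using x y eq d(3) by (auto simp: D_def dest: down_setD)
      show "(y, x) \<notin> P"
      proof
        assume "(y, x) \<in> P"
        then have "y \<in> B" using x d(2) by (auto dest: down_setD)
        then show False using y eq by (auto simp: D_def)
      qed
    qed (use B'A in auto)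
    moreover have AB': "A \<subseteq> B'" using le by blast
    ultimately have dec: "decomposes (minor z A B') (B - A) D"
      using compatibleD[OF comp d(1) d(4) _ B'A(1)] by blast
    show "minor z A B E = minor z A' B' E"
    proof (cases "E \<subseteq> B - A")
      case True
      have "minor z A B' (E \<union> D) = minor z A B' ((E \<union> D) \<inter> (B - A)) + minor z A B' ((E \<union> D) \<inter> D)"
        using dec[unfolded decomposes_def, rule_format, of "E \<union> D"] True by blast
      also have "(E \<union> D) \<inter> (B - A) = E" using True B'A by auto
      also have "(E \<union> D) \<inter> D = D" by auto
      finally have 1: "z (A \<union> (E \<union> D)) - z A = (z (A \<union> E) - z A) + (z (A \<union> D) - z A)"
        using minor_apply[OF AB', of E z] minor_apply[OF AB', of D z] minor_apply[OF AB', of "E \<union> D" z]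
          le_supI1[OF True, of D] True B'A by auto
      have "A \<union> (E \<union> D) = A' \<union> E" "A \<union> D = A'" using le by (auto simp: D_def)
      with 1 have 2: "z (A' \<union> E) - z A = (z (A \<union> E) - z A) + (z A' - z A)" by simp
      obtain a where a: "z A = ereal a"
        using submodular_finite[OF sm down_set_subset[OF d(1)]] comp d(1) by (auto simp: compatible_def)
      obtain a' where a': "z A' = ereal a'"
        using submodular_finite[OF sm down_set_subset[OF d(3)]] comp d(3) by (auto simp: compatible_def)
      have "z (A' \<union> E) - z A' = z (A \<union> E) - z A"
        using 2 unfolding a a' by (cases "z (A' \<union> E)"; cases "z (A \<union> E)") auto
      then show ?thesis using minor_apply[OF le(1) True] minor_apply[of A' B' E z] le True eq by auto
    qed (use eq in \<open>auto simp: minor_def contraction_def\<close>)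
  qed
  have uniq: "w = minor z A B" if "down_set I P A'" "down_set I P B'" "A' \<subseteq> B'" "B - A = B' - A'" "w = minor z A' B'"
    for w A' B'
  proof -
    have "minor z A B = minor z (A \<union> A') (B \<union> B')"
      by (rule main) (use that A B AB in \<open>auto intro: down_set_Un\<close>)
    moreover have "minor z A' B' = minor z (A \<union> A') (B \<union> B')"
      by (rule main) (use that A B AB in \<open>auto intro: down_set_Un\<close>)
    ultimately show ?thesis using that by simp
  qed
  show ?thesis
    unfolding convex_minor_def
    by (rule the_equality) (use A B AB uniq in blast)+
qed

text \<open>The two conditions are the conditions on \<open>C\<^sub>1 \<union> C\<^sub>2 = B - A\<close> for \<open>X = A \<union> C\<^sub>1\<close> and \<open>Y = A \<union> C\<^sub>2\<close>.\<close>

lemma Pre_iff: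
  assumes sm: "submodular I z"
  shows "P \<in> Pre I z \<longleftrightarrow> preorder_on I P \<and> (\<forall>A. down_set I P A \<longrightarrow> z A < \<infinity>) \<and>
    (\<forall>X\<subseteq>I. \<forall>Y\<subseteq>I. down_set I P (X \<inter> Y) \<longrightarrow> down_set I P (X \<union> Y) \<longrightarrow>
       (down_set I P X \<and> down_set I P Y \<longleftrightarrow> z X + z Y = z (X \<inter> Y) + z (X \<union> Y)))"
    (is "_ \<longleftrightarrow> ?R")
proof
  assume P: "P \<in> Pre I z"
  then have comp: "compatible I z P" by (simp add: Pre_def)
  then have pre: "preorder_on I P" and fin: "\<And>A. down_set I P A \<Longrightarrow> z A < \<infinity>"
    by (auto simp: compatible_def)
  have "down_set I P X \<and> down_set I P Y \<longleftrightarrow> z X + z Y = z (X \<inter> Y) + z (X \<union> Y)"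
    if XY: "X \<subseteq> I" "Y \<subseteq> I" "down_set I P (X \<inter> Y)" "down_set I P (X \<union> Y)" for X Y
  proof -
    have C: "(X \<union> Y) - (X \<inter> Y) = (X - Y) \<union> (Y - X)" "(X - Y) \<inter> (Y - X) = {}" and
      e: "X \<inter> Y \<union> (X - Y) = X" "X \<inter> Y \<union> (Y - X) = Y" by auto
    have "disconnected_union P (X - Y) (Y - X) \<longleftrightarrow> down_set I P X \<and> down_set I P Y"
      using disconnected_union_iff_down_sets[OF pre XY(3,4) _ C] unfolding e by blast
    moreover have "decomposes (minor z (X \<inter> Y) (X \<union> Y)) (X - Y) (Y - X) \<longleftrightarrow> z X + z Y = z (X \<inter> Y) + z (X \<union> Y)"
      using decomposes_minor_iff[OF sm _ _ fin[OF XY(3)] fin[OF XY(4)] C] XY unfolding e by blast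
    moreover have "disconnected_union P (X - Y) (Y - X) \<Longrightarrow> decomposes (minor z (X \<inter> Y) (X \<union> Y)) (X - Y) (Y - X)"
      using compatibleD[OF comp XY(3,4) _ C(1)] by blast
    moreover have "decomposes (minor z (X \<inter> Y) (X \<union> Y)) (X - Y) (Y - X) \<Longrightarrow> disconnected_union P (X - Y) (Y - X)"
    proof -
      assume "decomposes (minor z (X \<inter> Y) (X \<union> Y)) (X - Y) (Y - X)"
      then have "decomposes (convex_minor I z P ((X \<union> Y) - (X \<inter> Y))) (X - Y) (Y - X)"
        using convex_minor_eq[OF sm comp XY(3,4)] by (simp add: le_supI1)
      moreover have "convex_subset I P ((X \<union> Y) - (X \<inter> Y))"
        unfolding convex_subset_def using XY by blast
      ultimately show ?thesis using P C unfolding Pre_def by blast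
    qed
    ultimately show ?thesis by blast
  qed
  then show ?R using pre fin by blast
next
  assume R: ?R
  then have pre: "preorder_on I P" and fin: "\<And>A. down_set I P A \<Longrightarrow> z A < \<infinity>" by auto
  \<comment> \<open>From left to right this is compatibility, from right to left conformity.\<close>
  have key: "disconnected_union P C1 C2 \<longleftrightarrow> decomposes (minor z A B) C1 C2"
    if d: "down_set I P A" "down_set I P B" "A \<subseteq> B" "B - A = C1 \<union> C2" "C1 \<inter> C2 = {}" for A B C1 C2
  proof -
    have "(A \<union> C1) \<inter> (A \<union> C2) = A" "(A \<union> C1) \<union> (A \<union> C2) = B" "A \<union> C1 \<subseteq> I" "A \<union> C2 \<subseteq> I"
      using d down_set_subset[OF d(2)] by auto
    then have "down_set I P (A \<union> C1) \<and> down_set I P (A \<union> C2) \<longleftrightarrow> z (A \<union> C1) + z (A \<union> C2) = z A + z B"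
      using R d by metis
    then show ?thesis
      using disconnected_union_iff_down_sets[OF pre d]
        decomposes_minor_iff[OF sm d(3) down_set_subset[OF d(2)] fin[OF d(1)] fin[OF d(2)] d(4,5)] by blast
  qed
  have comp: "compatible I z P"
    unfolding compatible_def using pre fin key by (auto simp: disconnected_union_def)
  have "disconnected_union P C1 C2"
    if "convex_subset I P C" "C = C1 \<union> C2" "C1 \<inter> C2 = {}" "decomposes (convex_minor I z P C) C1 C2"
    for C C1 C2
  proof -
    from that(1) obtain A B where AB: "down_set I P A" "down_set I P B" "A \<subseteq> B" "C = B - A"
      unfolding convex_subset_def by blast
    then have "convex_minor I z P C = minor z A B" using convex_minor_eq[OF sm comp] by blast
    then show ?thesis using key[OF AB(1-3), of C1 C2] AB(4) that(2-4) by metis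
  qed
  with comp show "P \<in> Pre I z" unfolding Pre_def by blast
qed

section \<open>The preorder of finite values\<close>

lemma pre_eqI:
  assumes "preorder_on I P" "\<And>A. A \<subseteq> I \<Longrightarrow> down_set I P A \<longleftrightarrow> z A < \<infinity>"
  shows "pre I z = P"
  unfolding pre_def
proof (rule the_equality)
  fix Q assume "preorder_on I Q \<and> (\<forall>A\<subseteq>I. down_set I Q A \<longleftrightarrow> z A < \<infinity>)"
  then show "Q = P" using assms preorder_eqI_down_sets[of I Q P] by blast
qed (use assms in blast)

text \<open>Submodularity preserves finiteness under union and intersection, so the sets of finite
  value form a lattice and the description in \<open>pre\<close> is well defined.\<close>

lemma pre_submodular:
  assumes "finite I" "submodular I z"
  shows "preorder_on I (pre I z)" "A \<subseteq> I \<Longrightarrow> down_set I (pre I z) A \<longleftrightarrow> z A < \<infinity>"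
proof -
  have "z {} < \<infinity>" "z I < \<infinity>" using assms(2) by (auto simp: submodular_def)
  note z0I = this
  obtain P where P: "preorder_on I P" "\<And>A. down_set I P A \<longleftrightarrow> A \<subseteq> I \<and> z A < \<infinity>"
  proof (rule preorder_of_lattice[OF assms(1), of "\<lambda>A. A \<subseteq> I \<and> z A < \<infinity>"])
    fix A B assume "A \<subseteq> I \<and> z A < \<infinity>" "B \<subseteq> I \<and> z B < \<infinity>"
    then show "A \<union> B \<subseteq> I \<and> z (A \<union> B) < \<infinity>" "A \<inter> B \<subseteq> I \<and> z (A \<inter> B) < \<infinity>"
      using submodular_finite_Un[OF assms(2), of A B] by auto
  qed (use z0I in auto)
  then have "pre I z = P" by (intro pre_eqI) auto
  then show "preorder_on I (pre I z)" "A \<subseteq> I \<Longrightarrow> down_set I (pre I z) A \<longleftrightarrow> z A < \<infinity>"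
    using P by auto
qed

lemma modular_submodular: "modular I z \<Longrightarrow> submodular I z"
  by (simp add: modular_def)

lemma modularD:
  "modular I z \<Longrightarrow> A \<subseteq> I \<Longrightarrow> B \<subseteq> I \<Longrightarrow> z A < \<infinity> \<Longrightarrow> z B < \<infinity> \<Longrightarrow> z (A \<union> B) + z (A \<inter> B) = z A + z B"
  by (auto simp: modular_def)

text \<open>The uniform way to treat restriction, contraction, product, \<open>bubble_fun\<close>
  and \<open>preorder_fun\<close>: guess the preorder of finite values and check additivity on its
  down-sets; elsewhere the right side of the submodular inequality is infinite.\<close>

lemma modularI:
  assumes P: "preorder_on I P" and ext: "z \<in> extensional (Pow I)" and z0: "z {} = 0"
    and ni: "\<And>A. A \<subseteq> I \<Longrightarrow> z A \<noteq> -\<infinity>" and fin: "\<And>A. A \<subseteq> I \<Longrightarrow> z A < \<infinity> \<longleftrightarrow> down_set I P A"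
    and eq: "\<And>A B. down_set I P A \<Longrightarrow> down_set I P B \<Longrightarrow> z (A \<union> B) + z (A \<inter> B) = z A + z B"
  shows "modular I z" "pre I z = P"
proof -
  have "z (A \<union> B) + z (A \<inter> B) \<le> z A + z B" if "A \<subseteq> I" "B \<subseteq> I" for A B
  proof (cases "down_set I P A \<and> down_set I P B")
    case False
    then have "z A = \<infinity> \<or> z B = \<infinity>" using fin[OF that(1)] fin[OF that(2)] by auto
    then have s: "z A + z B = \<infinity>" using ni[OF that(1)] ni[OF that(2)] by (cases "z A"; cases "z B") auto
    show ?thesis unfolding s by simp
  qed (use eq in auto)
  moreover have "z I < \<infinity>" using fin down_set_carrier[OF P] by blast
  ultimately show "modular I z"
    unfolding modular_def submodular_def using ext z0 ni eq fin by auto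
  show "pre I z = P" using P fin by (intro pre_eqI) auto
qed

lemma modular_finite_iff:
  "finite I \<Longrightarrow> modular I z \<Longrightarrow> A \<subseteq> I \<Longrightarrow> z A < \<infinity> \<longleftrightarrow> down_set I (pre I z) A"
  using pre_submodular(2)[OF _ modular_submodular] by blast

text \<open>Conformity supplies the additivity of \<open>z\<close> on the down-sets of
  \<open>P\<close>. Getting \<open>P\<close> back as the preorder of \<open>z\<^sup>P\<close> is
  what turns \<chi> into a sum of order polynomials of minimal conforming preorders.\<close>

lemma preorder_fun_modular:
  assumes sm: "submodular I z" and P: "P \<in> Pre I z"
  shows "modular I (preorder_fun I z P)" "pre I (preorder_fun I z P) = P"
proof -
  have pre: "preorder_on I P" and fin: "\<And>A. down_set I P A \<Longrightarrow> z A < \<infinity>"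
    and eq: "\<And>X Y. X \<subseteq> I \<Longrightarrow> Y \<subseteq> I \<Longrightarrow> down_set I P (X \<inter> Y) \<Longrightarrow> down_set I P (X \<union> Y) \<Longrightarrow>
       (down_set I P X \<and> down_set I P Y \<longleftrightarrow> z X + z Y = z (X \<inter> Y) + z (X \<union> Y))"
    using P by (auto simp: Pre_iff[OF sm])
  have a: "preorder_fun I z P A = (if down_set I P A then z A else \<infinity>)" if "A \<subseteq> I" for A
    using that by (simp add: preorder_fun_def)
  have "preorder_fun I z P \<in> extensional (Pow I)" by (simp add: preorder_fun_def)
  moreover have "preorder_fun I z P {} = 0" using sm by (simp add: a submodular_def)
  moreover have "preorder_fun I z P A \<noteq> -\<infinity>" if "A \<subseteq> I" for A
    using submodular_ne_minf[OF sm that] by (simp add: a that)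
  moreover have "preorder_fun I z P A < \<infinity> \<longleftrightarrow> down_set I P A" if "A \<subseteq> I" for A
    using fin by (simp add: a that)
  moreover have "preorder_fun I z P (A \<union> B) + preorder_fun I z P (A \<inter> B) = preorder_fun I z P A + preorder_fun I z P B"
    if AB: "down_set I P A" "down_set I P B" for A B
  proof -
    have s: "A \<subseteq> I" "B \<subseteq> I" using AB by (auto simp: down_set_def)
    have d: "down_set I P (A \<inter> B)" "down_set I P (A \<union> B)" using AB by (auto intro: down_set_Int down_set_Un)
    show ?thesis
      using eq[OF s d] AB d a[OF s(1)] a[OF s(2)] a[of "A \<union> B"] a[of "A \<inter> B"] s
      by (auto simp: le_infI1 add.commute)
  qed
  ultimately show "modular I (preorder_fun I z P)" "pre I (preorder_fun I z P) = P"
    using modularI[OF pre, of "preorder_fun I z P"] by blast+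
qed

section \<open>Restriction, contraction, product and bubble functions of modular functions\<close>

lemma preorder_on_restrict: "preorder_on I P \<Longrightarrow> S \<subseteq> I \<Longrightarrow> preorder_on S (P \<inter> S \<times> S)"
  unfolding preorder_on_def refl_on_def by (auto intro!: transI dest: transD)

lemma down_set_restrict:
  "down_set I P S \<Longrightarrow> X \<subseteq> S \<Longrightarrow> down_set S (P \<inter> S \<times> S) X \<longleftrightarrow> down_set I P X"
  unfolding down_set_def by blast

lemma down_set_contract:
  "preorder_on I P \<Longrightarrow> down_set I P S \<Longrightarrow> U \<subseteq> I - S \<Longrightarrow>
    down_set (I - S) (P \<inter> (I - S) \<times> (I - S)) U \<longleftrightarrow> down_set I P (S \<union> U)"
  unfolding down_set_def preorder_on_def by blast

lemma restriction_modular: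
  assumes I: "finite I" and m: "modular I z" and S: "S \<subseteq> I" "z S < \<infinity>"
  shows "modular S (restriction z S)" "pre S (restriction z S) = pre I z \<inter> S \<times> S"
proof -
  let ?P = "pre I z"
  have sm: "submodular I z" using m by (rule modular_submodular)
  have P: "preorder_on I ?P" using pre_submodular[OF I sm] by simp
  have dS: "down_set I ?P S" using modular_finite_iff[OF I m] S by blast
  have a: "restriction z S A = z A" if "A \<subseteq> S" for A
    using that by (simp add: restriction_def)
  have 1: "restriction z S \<in> extensional (Pow S)" by (simp add: restriction_def)
  have 2: "restriction z S {} = 0" using sm by (simp add: a submodular_def)
  have 3: "restriction z S A \<noteq> -\<infinity>" if "A \<subseteq> S" for A
    using submodular_ne_minf[OF sm, of A] S by (simp add: a that order_trans[OF that])
  have 4: "restriction z S A < \<infinity> \<longleftrightarrow> down_set S (?P \<inter> S \<times> S) A" if "A \<subseteq> S" for A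
    using modular_finite_iff[OF I m] S that down_set_restrict[OF dS that] a by auto
  have 5: "restriction z S (A \<union> B) + restriction z S (A \<inter> B) = restriction z S A + restriction z S B"
    if "down_set S (?P \<inter> S \<times> S) A" "down_set S (?P \<inter> S \<times> S) B" for A B
  proof -
    have s: "A \<subseteq> S" "B \<subseteq> S" using that by (auto simp: down_set_def)
    have "z A < \<infinity>" "z B < \<infinity>" using 4[OF s(1)] 4[OF s(2)] that a s by auto
    then show ?thesis
      using modularD[OF m, of A B] s S a[of A] a[of B] a[of "A \<union> B"] a[of "A \<inter> B"] by (auto simp: le_infI1)
  qed
  show "modular S (restriction z S)" "pre S (restriction z S) = ?P \<inter> S \<times> S"
    using modularI[OF preorder_on_restrict[OF P S(1)] 1 2] 3 4 5 by blast+
qed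

lemma contraction_modular:
  assumes I: "finite I" and m: "modular I z" and S: "S \<subseteq> I" "z S < \<infinity>"
  shows "modular (I - S) (contraction I z S)" "pre (I - S) (contraction I z S) = pre I z \<inter> (I - S) \<times> (I - S)"
proof -
  let ?P = "pre I z" and ?J = "I - S"
  have sm: "submodular I z" using m by (rule modular_submodular)
  have P: "preorder_on I ?P" using pre_submodular[OF I sm] by simp
  have dS: "down_set I ?P S" using modular_finite_iff[OF I m] S by blast
  obtain s where s: "z S = ereal s" using submodular_finite[OF sm S] .
  have a: "contraction I z S A = z (S \<union> A) - ereal s" if "A \<subseteq> ?J" for A
    using that by (simp add: contraction_def s)
  have 1: "contraction I z S \<in> extensional (Pow ?J)" by (simp add: contraction_def)
  have 2: "contraction I z S {} = 0" by (simp add: a s)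
  have sub: "S \<union> A \<subseteq> I" if "A \<subseteq> ?J" for A using S that by auto
  have 3: "contraction I z S A \<noteq> -\<infinity>" if "A \<subseteq> ?J" for A
    using submodular_ne_minf[OF sm sub[OF that]] a[OF that] by (cases "z (S \<union> A)") auto
  have 4: "contraction I z S A < \<infinity> \<longleftrightarrow> down_set ?J (?P \<inter> ?J \<times> ?J) A" if "A \<subseteq> ?J" for A
    using modular_finite_iff[OF I m sub[OF that]] down_set_contract[OF P dS that] a[OF that]
    by (cases "z (S \<union> A)") auto
  have 5: "contraction I z S (A \<union> B) + contraction I z S (A \<inter> B) = contraction I z S A + contraction I z S B"
    if "down_set ?J (?P \<inter> ?J \<times> ?J) A" "down_set ?J (?P \<inter> ?J \<times> ?J) B" for A B
  proof -
    have ss: "A \<subseteq> ?J" "B \<subseteq> ?J" using that by (auto simp: down_set_def)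
    have fin: "z (S \<union> A) < \<infinity>" "z (S \<union> B) < \<infinity>"
      using down_set_contract[OF P dS] modular_finite_iff[OF I m] sub ss that by auto
    have "(S \<union> A) \<union> (S \<union> B) = S \<union> (A \<union> B)" "(S \<union> A) \<inter> (S \<union> B) = S \<union> (A \<inter> B)" by auto
    then have "z (S \<union> (A \<union> B)) + z (S \<union> (A \<inter> B)) = z (S \<union> A) + z (S \<union> B)"
      using modularD[OF m sub[OF ss(1)] sub[OF ss(2)] fin] by simp
    then show ?thesis
      using fin a[OF ss(1)] a[OF ss(2)] a[of "A \<union> B"] a[of "A \<inter> B"] ss
      by (cases "z (S \<union> A)"; cases "z (S \<union> B)"; cases "z (S \<union> (A \<union> B))"; cases "z (S \<union> (A \<inter> B))")
        (auto simp: le_infI1)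
  qed
  show "modular ?J (contraction I z S)" "pre ?J (contraction I z S) = ?P \<inter> ?J \<times> ?J"
    using modularI[OF preorder_on_restrict[OF P, of ?J] 1 2] 3 4 5 by blast+
qed

lemma fun_product_modular:
  assumes fin: "finite S" "finite T" and d: "S \<inter> T = {}" and u: "modular S u" and v: "modular T v"
  shows "modular (S \<union> T) (fun_product S T u v)" "pre (S \<union> T) (fun_product S T u v) = pre S u \<union> pre T v"
proof -
  let ?P = "pre S u" and ?Q = "pre T v"
  note su = modular_submodular[OF u] and sv = modular_submodular[OF v]
  have P: "preorder_on S ?P" and Q: "preorder_on T ?Q"
    using pre_submodular(1)[OF fin(1) su] pre_submodular(1)[OF fin(2) sv] by auto
  have PQ: "preorder_on (S \<union> T) (?P \<union> ?Q)"
    using P Q d unfolding preorder_on_def refl_on_def trans_def by blast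
  have ds: "down_set (S \<union> T) (?P \<union> ?Q) A \<longleftrightarrow> down_set S ?P (A \<inter> S) \<and> down_set T ?Q (A \<inter> T)" if "A \<subseteq> S \<union> T" for A
    using P Q d that unfolding preorder_on_def down_set_def by blast
  let ?w = "fun_product S T u v"
  have a: "?w A = u (A \<inter> S) + v (A \<inter> T)" if "A \<subseteq> S \<union> T" for A
    using that by (simp add: fun_product_def)
  have niu: "u (A \<inter> S) \<noteq> -\<infinity>" and niv: "v (A \<inter> T) \<noteq> -\<infinity>" for A
    using submodular_ne_minf[OF su, of "A \<inter> S"] submodular_ne_minf[OF sv, of "A \<inter> T"] by auto
  have 1: "?w \<in> extensional (Pow (S \<union> T))" by (simp add: fun_product_def)
  have 2: "?w {} = 0" using su sv by (simp add: a submodular_def)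
  have 3: "?w A \<noteq> -\<infinity>" if "A \<subseteq> S \<union> T" for A
    using niu[of A] niv[of A] by (simp add: a that)
  have 4: "?w A < \<infinity> \<longleftrightarrow> down_set (S \<union> T) (?P \<union> ?Q) A" if "A \<subseteq> S \<union> T" for A
    using modular_finite_iff[OF fin(1) u, of "A \<inter> S"] modular_finite_iff[OF fin(2) v, of "A \<inter> T"]
      niu[of A] niv[of A] ds[OF that] a[OF that]
    by (cases "u (A \<inter> S)"; cases "v (A \<inter> T)") auto
  have 5: "?w (A \<union> B) + ?w (A \<inter> B) = ?w A + ?w B"
    if "down_set (S \<union> T) (?P \<union> ?Q) A" "down_set (S \<union> T) (?P \<union> ?Q) B" for A B
  proof -
    have ss: "A \<subseteq> S \<union> T" "B \<subseteq> S \<union> T" using that by (auto simp: down_set_def)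
    have "u (A \<inter> S \<union> B \<inter> S) + u (A \<inter> S \<inter> (B \<inter> S)) = u (A \<inter> S) + u (B \<inter> S)"
      "v (A \<inter> T \<union> B \<inter> T) + v (A \<inter> T \<inter> (B \<inter> T)) = v (A \<inter> T) + v (B \<inter> T)"
      using modularD[OF u, of "A \<inter> S" "B \<inter> S"] modularD[OF v, of "A \<inter> T" "B \<inter> T"]
        modular_finite_iff[OF fin(1) u] modular_finite_iff[OF fin(2) v] that ds ss by auto
    moreover have "A \<inter> S \<union> B \<inter> S = (A \<union> B) \<inter> S" "A \<inter> S \<inter> (B \<inter> S) = (A \<inter> B) \<inter> S"
      "A \<inter> T \<union> B \<inter> T = (A \<union> B) \<inter> T" "A \<inter> T \<inter> (B \<inter> T) = (A \<inter> B) \<inter> T" by auto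
    ultimately have *: "u ((A \<union> B) \<inter> S) + u ((A \<inter> B) \<inter> S) = u (A \<inter> S) + u (B \<inter> S)"
      "v ((A \<union> B) \<inter> T) + v ((A \<inter> B) \<inter> T) = v (A \<inter> T) + v (B \<inter> T)"
      by simp_all
    have "?w (A \<union> B) + ?w (A \<inter> B) = (u ((A \<union> B) \<inter> S) + u ((A \<inter> B) \<inter> S)) + (v ((A \<union> B) \<inter> T) + v ((A \<inter> B) \<inter> T))"
      using a[of "A \<union> B"] a[of "A \<inter> B"] ss by (simp add: le_infI1 ac_simps)
    also have "\<dots> = ?w A + ?w B"
      unfolding * a[OF ss(1)] a[OF ss(2)] by (simp add: ac_simps)
    finally show ?thesis .
  qed
  show "modular (S \<union> T) ?w" "pre (S \<union> T) ?w = ?P \<union> ?Q"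
    using modularI[OF PQ 1 2] 3 4 5 by blast+
qed

text \<open>The conforming preorders of a modular function whose preorder is \<open>P\<close>: those obtained from \<open>P\<close> by
  merging \<open>P\<close>-connected sets into bubbles.\<close>

definition preorder_contraction :: "'a set \<Rightarrow> 'a rel \<Rightarrow> 'a rel \<Rightarrow> bool" where
  "preorder_contraction I P Q \<longleftrightarrow> preorder_on I Q \<and> P \<subseteq> Q \<and>
     (\<forall>X Y. down_set I P X \<longrightarrow> down_set I P Y \<longrightarrow> down_set I Q (X \<inter> Y) \<longrightarrow> down_set I Q (X \<union> Y) \<longrightarrow>
        down_set I Q X \<and> down_set I Q Y)"

text \<open>For modular \<open>z\<close> the equation in \<open>Pre_iff\<close> holds precisely when
  \<open>X\<close> and \<open>Y\<close> both have finite value, that is, are down-sets of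
  \<open>pre I z\<close>; the values of \<open>z\<close> drop out and only its preorder
  remains.\<close>

lemma Pre_modular_iff:
  assumes I: "finite I" and m: "modular I z"
  shows "Q \<in> Pre I z \<longleftrightarrow> preorder_contraction I (pre I z) Q"
proof -
  let ?P = "pre I z"
  have sm: "submodular I z" using m by (rule modular_submodular)
  have P: "preorder_on I ?P" using pre_submodular[OF I sm] by simp
  note fin = modular_finite_iff[OF I m]
  have eq: "z X + z Y = z (X \<inter> Y) + z (X \<union> Y) \<longleftrightarrow> down_set I ?P X \<and> down_set I ?P Y"
    if XY: "X \<subseteq> I" "Y \<subseteq> I" "down_set I ?P (X \<inter> Y)" "down_set I ?P (X \<union> Y)" for X Y
  proof
    assume e: "z X + z Y = z (X \<inter> Y) + z (X \<union> Y)"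
    have "z (X \<inter> Y) < \<infinity>" "z (X \<union> Y) < \<infinity>" using fin[of "X \<inter> Y"] fin[of "X \<union> Y"] XY by auto
    then have "z X < \<infinity>" "z Y < \<infinity>" using e submodular_ne_minf[OF sm XY(1)] submodular_ne_minf[OF sm XY(2)]
      by (cases "z X"; cases "z Y"; auto)+
    then show "down_set I ?P X \<and> down_set I ?P Y" using fin XY by blast
  next
    assume "down_set I ?P X \<and> down_set I ?P Y"
    then show "z X + z Y = z (X \<inter> Y) + z (X \<union> Y)"
      using modularD[OF m XY(1,2)] fin XY by (simp add: add.commute)
  qed
  have sub: "(\<forall>A. down_set I Q A \<longrightarrow> z A < \<infinity>) \<longleftrightarrow> ?P \<subseteq> Q" if "preorder_on I Q"
    using preorder_subset_iff[OF P that] fin down_set_subset by metis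
  show ?thesis
  proof (cases "preorder_on I Q \<and> ?P \<subseteq> Q")
    case True
    then have QP: "down_set I ?P A" if "down_set I Q A" for A using that down_set_mono by blast
    have "(\<forall>X\<subseteq>I. \<forall>Y\<subseteq>I. down_set I Q (X \<inter> Y) \<longrightarrow> down_set I Q (X \<union> Y) \<longrightarrow>
       (down_set I Q X \<and> down_set I Q Y \<longleftrightarrow> z X + z Y = z (X \<inter> Y) + z (X \<union> Y))) \<longleftrightarrow>
       (\<forall>X Y. down_set I ?P X \<longrightarrow> down_set I ?P Y \<longrightarrow> down_set I Q (X \<inter> Y) \<longrightarrow> down_set I Q (X \<union> Y) \<longrightarrow>
        down_set I Q X \<and> down_set I Q Y)" (is "?L \<longleftrightarrow> ?R")
    proof
      assume L: ?L
      show ?R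
      proof (intro allI impI)
        fix X Y assume a: "down_set I ?P X" "down_set I ?P Y" "down_set I Q (X \<inter> Y)" "down_set I Q (X \<union> Y)"
        then show "down_set I Q X \<and> down_set I Q Y"
          using L[rule_format, of X Y] eq[of X Y] QP down_set_subset[OF a(1)] down_set_subset[OF a(2)] by blast
      qed
    next
      assume R: ?R
      show ?L
      proof (intro allI impI)
        fix X Y assume a: "X \<subseteq> I" "Y \<subseteq> I" "down_set I Q (X \<inter> Y)" "down_set I Q (X \<union> Y)"
        show "down_set I Q X \<and> down_set I Q Y \<longleftrightarrow> z X + z Y = z (X \<inter> Y) + z (X \<union> Y)"
          using R[rule_format, of X Y] eq[OF a(1,2) QP[OF a(3)] QP[OF a(4)]] QP a by blast
      qed
    qed
    then show ?thesis unfolding Pre_iff[OF sm] preorder_contraction_def using sub True by simp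
  next
    case False
    then show ?thesis unfolding Pre_iff[OF sm] preorder_contraction_def using sub by blast
  qed
qed

lemma preorder_bubble_equiv: "preorder_on I P \<Longrightarrow> equiv I (P \<inter> P\<inverse>)"
  unfolding preorder_on_def equiv_def refl_on_def sym_def trans_def by blast

text \<open>A bubble is the principal down-set of one of its elements minus the strictly smaller
  elements, hence convex, so \<open>convex_minor_eq\<close> applies to it.\<close>

lemma bubble_interval:
  assumes P: "preorder_on I P" and C: "C \<in> bubbles I P"
  obtains A B where "down_set I P A" "down_set I P B" "A \<subseteq> B" "C = B - A"
    "\<And>x y. x \<in> C \<Longrightarrow> (x, y) \<in> P \<inter> P\<inverse> \<longleftrightarrow> y \<in> C"
    "\<And>x y. y \<in> C \<Longrightarrow> (x, y) \<in> P \<inter> P\<inverse> \<longleftrightarrow> x \<in> C"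
proof -
  obtain x where x: "x \<in> I" "C = (P \<inter> P\<inverse>) `` {x}"
    using C unfolding bubbles_def quotient_def by blast
  let ?B = "{y. (y, x) \<in> P}" and ?A = "{y. (y, x) \<in> P \<and> (x, y) \<notin> P}"
  have "down_set I P ?B" by (rule down_set_principal[OF P])
  moreover have "down_set I P ?A"
    using preorder_transD[OF P] preorder_fieldD[OF P] unfolding down_set_def by fast
  moreover have "C = ?B - ?A" using x by auto
  ultimately show ?thesis
    using that[of ?A ?B] preorder_transD[OF P] x by auto
qed

lemma bubbles_finite: "finite I \<Longrightarrow> preorder_on I P \<Longrightarrow> finite (bubbles I P)"
  unfolding bubbles_def using finite_quotient[of I "P \<inter> P\<inverse>"] preorder_bubble_equiv[of I P] by (simp add: equiv_def)

lemma ereal_sum_ne_minf: "finite B \<Longrightarrow> (\<And>i. i \<in> B \<Longrightarrow> f i \<noteq> (-\<infinity>::ereal)) \<Longrightarrow> sum f B \<noteq> -\<infinity>"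
  by (induction B rule: finite_induct) auto

text \<open>Each summand sees one bubble of \<open>Q\<close>, so finiteness of the sum is controlled
  by the comparabilities of \<open>pre I z\<close> inside bubbles. The resulting preorder is the one
  that governs the remainders in \<open>card_strict_maps_mult\<close>.\<close>

lemma bubble_fun_modular:
  assumes I: "finite I" and m: "modular I z" and Q: "Q \<in> Pre I z"
  shows "modular I (bubble_fun I z Q)" "pre I (bubble_fun I z Q) = pre I z \<inter> (Q \<inter> Q\<inverse>)"
proof -
  let ?P = "pre I z" and ?w = "bubble_fun I z Q" and ?E = "Q \<inter> Q\<inverse>"
  have sm: "submodular I z" using m by (rule modular_submodular)
  have P: "preorder_on I ?P" using pre_submodular[OF I sm] by simp
  have comp: "compatible I z Q" using Q by (simp add: Pre_def)
  have preQ: "preorder_on I Q" using Q by (simp add: Pre_iff[OF sm])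
  have PQ: "?P \<subseteq> Q" using Q unfolding Pre_modular_iff[OF I m] preorder_contraction_def by blast
  have preI: "preorder_on I (?P \<inter> ?E)"
    using P preQ unfolding preorder_on_def refl_on_def trans_def by blast
  have finb: "finite (bubbles I Q)" by (rule bubbles_finite[OF I preQ])
  have Un: "\<Union>(bubbles I Q) = I" unfolding bubbles_def by (rule Union_quotient[OF preorder_bubble_equiv[OF preQ]])
  let ?c = "\<lambda>C E. convex_minor I z Q C (E \<inter> C)"
  have c0: "?c C {} = 0"
    and cni: "\<And>E. ?c C E \<noteq> -\<infinity>"
    and cfin: "\<And>E. E \<subseteq> I \<Longrightarrow> ?c C E < \<infinity> \<longleftrightarrow> (\<forall>x y. (x, y) \<in> ?P \<inter> ?E \<longrightarrow> y \<in> E \<inter> C \<longrightarrow> x \<in> E)"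
    and ceq: "\<And>E F. ?c C E < \<infinity> \<Longrightarrow> ?c C F < \<infinity> \<Longrightarrow> ?c C (E \<union> F) + ?c C (E \<inter> F) = ?c C E + ?c C F"
    if C: "C \<in> bubbles I Q" for C
  proof -
    obtain A B where AB: "down_set I Q A" "down_set I Q B" "A \<subseteq> B" "C = B - A"
      and cl: "\<And>x y. x \<in> C \<Longrightarrow> (x, y) \<in> ?E \<longleftrightarrow> y \<in> C" "\<And>x y. y \<in> C \<Longrightarrow> (x, y) \<in> ?E \<longleftrightarrow> x \<in> C"
      using bubble_interval[OF preQ C] by metis
    have PAB: "down_set I ?P A" "down_set I ?P B" using AB down_set_mono[OF PQ] by auto
    have AI: "A \<subseteq> I" and BI: "B \<subseteq> I" using PAB by (auto simp: down_set_def)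
    obtain a where a: "z A = ereal a"
      using submodular_finite[OF sm AI] modular_finite_iff[OF I m AI] PAB by auto
    have c: "?c C E = z (A \<union> (E \<inter> C)) - ereal a" for E
      using convex_minor_eq[OF sm comp AB(1-3)] AB(4) minor_apply[OF AB(3), of "E \<inter> C" z] a by auto
    have sub: "A \<union> (E \<inter> C) \<subseteq> I" for E using AI BI AB(4) by auto
    have ni: "z (A \<union> (E \<inter> C)) \<noteq> -\<infinity>" for E by (rule submodular_ne_minf[OF sm sub])
    have cf: "?c C E < \<infinity> \<longleftrightarrow> z (A \<union> (E \<inter> C)) < \<infinity>" for E
      unfolding c by (cases "z (A \<union> (E \<inter> C))") auto
    show "?c C {} = 0" using c[of "{}"] a by simp
    show "?c C E \<noteq> -\<infinity>" for E unfolding c using ni[of E] by (cases "z (A \<union> (E \<inter> C))") auto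
    show "?c C E < \<infinity> \<longleftrightarrow> (\<forall>x y. (x, y) \<in> ?P \<inter> ?E \<longrightarrow> y \<in> E \<inter> C \<longrightarrow> x \<in> E)" if "E \<subseteq> I" for E
    proof -
      \<comment> \<open>Adding \<open>E \<inter> C\<close> to the down-set \<open>A\<close> can fail
        only at pairs inside \<open>C\<close>: what lies below \<open>C\<close> stays in
        \<open>B\<close>, hence in \<open>A\<close> or in \<open>C\<close>.\<close>
      have "down_set I ?P (A \<union> (E \<inter> C)) \<longleftrightarrow> (\<forall>x y. (x, y) \<in> ?P \<inter> ?E \<longrightarrow> y \<in> E \<inter> C \<longrightarrow> x \<in> E)"
      proof
        assume d: "down_set I ?P (A \<union> (E \<inter> C))"
        show "\<forall>x y. (x, y) \<in> ?P \<inter> ?E \<longrightarrow> y \<in> E \<inter> C \<longrightarrow> x \<in> E"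
        proof (intro allI impI)
          fix x y assume xy: "(x, y) \<in> ?P \<inter> ?E" "y \<in> E \<inter> C"
          then have "x \<in> A \<union> (E \<inter> C)" using down_setD[OF d] by blast
          moreover have "x \<in> C" using cl(2) xy by blast
          ultimately show "x \<in> E" using AB(4) by blast
        qed
      next
        assume r: "\<forall>x y. (x, y) \<in> ?P \<inter> ?E \<longrightarrow> y \<in> E \<inter> C \<longrightarrow> x \<in> E"
        have "x \<in> A \<union> (E \<inter> C)" if xy: "(x, y) \<in> ?P" "y \<in> A \<union> (E \<inter> C)" for x y
        proof (cases "x \<in> A")
          case False
          then have y: "y \<in> E \<inter> C" using xy down_setD[OF PAB(1)] by blast
          then have "x \<in> B" using down_setD[OF PAB(2)] xy AB(4) by blast
          then have "x \<in> C" using False AB(4) by blast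
          then show ?thesis using r xy y cl(1) by blast
        qed simp
        then show "down_set I ?P (A \<union> (E \<inter> C))" using sub unfolding down_set_def by blast
      qed
      then show ?thesis using cf modular_finite_iff[OF I m sub] by simp
    qed
    show "?c C (E \<union> F) + ?c C (E \<inter> F) = ?c C E + ?c C F" if "?c C E < \<infinity>" "?c C F < \<infinity>" for E F
    proof -
      have f: "z (A \<union> (E \<inter> C)) < \<infinity>" "z (A \<union> (F \<inter> C)) < \<infinity>" using that cf by auto
      have e: "(A \<union> (E \<inter> C)) \<union> (A \<union> (F \<inter> C)) = A \<union> ((E \<union> F) \<inter> C)" "(A \<union> (E \<inter> C)) \<inter> (A \<union> (F \<inter> C)) = A \<union> ((E \<inter> F) \<inter> C)"
        by auto
      have "z (A \<union> ((E \<union> F) \<inter> C)) + z (A \<union> ((E \<inter> F) \<inter> C)) = z (A \<union> (E \<inter> C)) + z (A \<union> (F \<inter> C))"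
        using modularD[OF m sub sub f] unfolding e .
      then show ?thesis unfolding c using f ni[of "E"] ni[of F]
        by (cases "z (A \<union> (E \<inter> C))"; cases "z (A \<union> (F \<inter> C))"; cases "z (A \<union> ((E \<union> F) \<inter> C))"; cases "z (A \<union> ((E \<inter> F) \<inter> C))") auto
    qed
  qed
  have w: "?w E = (\<Sum>C\<in>bubbles I Q. ?c C E)" if "E \<subseteq> I" for E
    using that by (simp add: bubble_fun_def)
  have 1: "?w \<in> extensional (Pow I)" by (simp add: bubble_fun_def)
  have 2: "?w {} = 0" using c0 by (simp add: w)
  have 3: "?w E \<noteq> -\<infinity>" if "E \<subseteq> I" for E
    unfolding w[OF that] by (rule ereal_sum_ne_minf[OF finb cni])
  have fw: "?w E < \<infinity> \<longleftrightarrow> (\<forall>C\<in>bubbles I Q. ?c C E < \<infinity>)" if "E \<subseteq> I" for E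
    unfolding w[OF that] by (simp add: sum_Pinfty finb)
  have 4: "?w E < \<infinity> \<longleftrightarrow> down_set I (?P \<inter> ?E) E" if "E \<subseteq> I" for E
  proof -
    have "(\<forall>C\<in>bubbles I Q. ?c C E < \<infinity>) \<longleftrightarrow>
        (\<forall>C\<in>bubbles I Q. \<forall>x y. (x, y) \<in> ?P \<inter> ?E \<longrightarrow> y \<in> E \<inter> C \<longrightarrow> x \<in> E)"
      using cfin[OF _ that] by simp
    also have "\<dots> \<longleftrightarrow> (\<forall>x y. (x, y) \<in> ?P \<inter> ?E \<longrightarrow> y \<in> E \<inter> \<Union>(bubbles I Q) \<longrightarrow> x \<in> E)"
      by blast
    also have "\<dots> \<longleftrightarrow> down_set I (?P \<inter> ?E) E"
      unfolding Un down_set_def using that by blast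
    finally show ?thesis unfolding fw[OF that] .
  qed
  have 5: "?w (E \<union> F) + ?w (E \<inter> F) = ?w E + ?w F"
    if d: "down_set I (?P \<inter> ?E) E" "down_set I (?P \<inter> ?E) F" for E F
  proof -
    have s: "E \<subseteq> I" "F \<subseteq> I" "E \<union> F \<subseteq> I" "E \<inter> F \<subseteq> I" using d by (auto simp: down_set_def)
    have f: "?c C E < \<infinity>" "?c C F < \<infinity>" if "C \<in> bubbles I Q" for C
      using d 4[OF s(1)] 4[OF s(2)] fw[OF s(1)] fw[OF s(2)] that by auto
    have "?w (E \<union> F) + ?w (E \<inter> F) = (\<Sum>C\<in>bubbles I Q. ?c C (E \<union> F) + ?c C (E \<inter> F))"
      unfolding w[OF s(3)] w[OF s(4)] by (rule sum.distrib[symmetric])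
    also have "\<dots> = (\<Sum>C\<in>bubbles I Q. ?c C E + ?c C F)"
      by (rule sum.cong[OF refl]) (use ceq f in blast)
    also have "\<dots> = ?w E + ?w F"
      unfolding w[OF s(1)] w[OF s(2)] by (rule sum.distrib)
    finally show ?thesis .
  qed
  show "modular I ?w" "pre I ?w = ?P \<inter> ?E"
    using modularI[OF preI 1 2] 3 4 5 by blast+
qed

section \<open>Transport along injective maps\<close>

lemma down_set_image:
  assumes f: "inj_on f I" and P: "P \<subseteq> I \<times> I" and A: "A \<subseteq> I"
  shows "down_set (f ` I) (map_prod f f ` P) (f ` A) \<longleftrightarrow> down_set I P A"
proof -
  have mem: "f x \<in> f ` A \<longleftrightarrow> x \<in> A" if "x \<in> I" for x
    using inj_on_image_mem_iff[OF f that A] .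
  show ?thesis
  proof
    assume d: "down_set (f ` I) (map_prod f f ` P) (f ` A)"
    have "x \<in> A" if xy: "(x, y) \<in> P" "y \<in> A" for x y
    proof -
      have "(f x, f y) \<in> map_prod f f ` P" using xy by force
      then have "f x \<in> f ` A" using down_setD[OF d] xy(2) by (meson imageI)
      then show ?thesis using mem[of x] P xy by blast
    qed
    then show "down_set I P A" using A by (simp add: down_set_def)
  next
    assume d: "down_set I P A"
    have "u \<in> f ` A" if uv: "(u, v) \<in> map_prod f f ` P" "v \<in> f ` A" for u v
    proof -
      obtain x y where xy: "(x, y) \<in> P" "u = f x" "v = f y" using uv(1) by auto
      then have "y \<in> A" using mem[of y] P uv(2) by blast
      then show ?thesis using down_setD[OF d xy(1)] xy by blast
    qed
    then show "down_set (f ` I) (map_prod f f ` P) (f ` A)" using A unfolding down_set_def by (meson image_mono)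
  qed
qed

lemma preorder_on_image:
  assumes f: "inj_on f I" and P: "P \<subseteq> I \<times> I"
  shows "preorder_on (f ` I) (map_prod f f ` P) \<longleftrightarrow> preorder_on I P"
proof -
  have mem: "(f x, f y) \<in> map_prod f f ` P \<longleftrightarrow> (x, y) \<in> P" if "x \<in> I" "y \<in> I" for x y
    using inj_on_image_mem_iff[OF map_prod_inj_on[OF f f], of "(x, y)" P] that P by simp
  have sub: "map_prod f f ` P \<subseteq> f ` I \<times> f ` I" using P by auto
  have "refl_on (f ` I) (map_prod f f ` P) \<longleftrightarrow> refl_on I P"
    unfolding refl_on_def using mem by auto
  moreover have "trans (map_prod f f ` P) \<longleftrightarrow> trans P"
  proof
    assume t: "trans (map_prod f f ` P)"
    show "trans P"
    proof (rule transI)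
      fix x y w assume a: "(x, y) \<in> P" "(y, w) \<in> P"
      then have I: "x \<in> I" "y \<in> I" "w \<in> I" using P by auto
      show "(x, w) \<in> P"
        using transD[OF t, of "f x" "f y" "f w"] a
        unfolding mem[OF I(1,2)] mem[OF I(2,3)] mem[OF I(1,3)] by simp
    qed
  next
    assume t: "trans P"
    show "trans (map_prod f f ` P)"
    proof (rule transI)
      fix u v w assume a: "(u, v) \<in> map_prod f f ` P" "(v, w) \<in> map_prod f f ` P"
      obtain x y where xy: "(x, y) \<in> P" "u = f x" "v = f y" using a(1) by auto
      obtain y' w' where yw: "(y', w') \<in> P" "v = f y'" "w = f w'" using a(2) by auto
      have "y = y'" using f xy yw P by (auto dest: inj_onD)
      then have "(x, w') \<in> P" using transD[OF t xy(1)] yw(1) by simp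
      then show "(u, w) \<in> map_prod f f ` P" unfolding xy(2) yw(3) by (metis image_eqI map_prod_simp)
    qed
  qed
  ultimately show ?thesis unfolding preorder_on_def using sub P by blast
qed

lemma relabel_image:
  assumes "inj_on f I" "A \<subseteq> I"
  shows "relabel f I z (f ` A) = z A"
proof -
  have "{i \<in> I. f i \<in> f ` A} = A" using assms by (auto simp: inj_on_def)
  then show ?thesis using assms by (simp add: relabel_def image_mono)
qed

lemma relabel_extensional: "relabel f I z \<in> extensional (Pow (f ` I))"
  by (simp add: relabel_def)

lemma ball_Pow_image: "(\<forall>A\<subseteq>f ` I. Q A) \<longleftrightarrow> (\<forall>A\<subseteq>I. Q (f ` A))"
  by (metis subset_image_iff)

lemma submodular_relabel:
  assumes f: "inj_on f I" and z: "submodular I z"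
  shows "submodular (f ` I) (relabel f I z)"
proof -
  have i: "f ` A \<inter> f ` B = f ` (A \<inter> B)" if "A \<subseteq> I" "B \<subseteq> I" for A B
    using inj_on_image_Int[OF f that] by simp
  have r: "relabel f I z (f ` A) = z A" if "A \<subseteq> I" for A using relabel_image[OF f that] .
  show ?thesis
    unfolding submodular_def ball_Pow_image
    using z r[of "{}"] relabel_extensional[of f I z]
    by (auto simp: submodular_def r i image_Un[symmetric] le_infI1 simp del: ereal_infty_less)
qed

lemma modular_relabel:
  assumes f: "inj_on f I" and z: "modular I z"
  shows "modular (f ` I) (relabel f I z)"
proof -
  have i: "f ` A \<inter> f ` B = f ` (A \<inter> B)" if "A \<subseteq> I" "B \<subseteq> I" for A B
    using inj_on_image_Int[OF f that] by simp
  have r: "relabel f I z (f ` A) = z A" if "A \<subseteq> I" for A using relabel_image[OF f that] .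
  show ?thesis
    unfolding modular_def ball_Pow_image
    using z submodular_relabel[OF f]
    by (auto simp: modular_def r i image_Un[symmetric] le_infI1 simp del: ereal_infty_less)
qed

lemma pre_relabel:
  assumes I: "finite I" and f: "inj_on f I" and z: "submodular I z"
  shows "pre (f ` I) (relabel f I z) = map_prod f f ` pre I z"
proof (rule pre_eqI)
  have P: "preorder_on I (pre I z)" using pre_submodular[OF I z] by simp
  then have sub: "pre I z \<subseteq> I \<times> I" by (simp add: preorder_on_def)
  show "preorder_on (f ` I) (map_prod f f ` pre I z)" using preorder_on_image[OF f sub] P by simp
  show "down_set (f ` I) (map_prod f f ` pre I z) B \<longleftrightarrow> relabel f I z B < \<infinity>" if B: "B \<subseteq> f ` I" for B
  proof -
    obtain A where A: "A \<subseteq> I" "B = f ` A" using B by (auto simp: subset_image_iff)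
    show ?thesis unfolding A(2) down_set_image[OF f sub A(1)] relabel_image[OF f A(1)]
      using pre_submodular(2)[OF I z A(1)] .
  qed
qed

lemma Pre_relabel_iff:
  assumes f: "inj_on f I" and z: "submodular I z" and P: "P \<subseteq> I \<times> I"
  shows "map_prod f f ` P \<in> Pre (f ` I) (relabel f I z) \<longleftrightarrow> P \<in> Pre I z"
proof -
  have i: "f ` A \<inter> f ` B = f ` (A \<inter> B)" if "A \<subseteq> I" "B \<subseteq> I" for A B
    using inj_on_image_Int[OF f that] by simp
  have r: "relabel f I z (f ` A) = z A" if "A \<subseteq> I" for A using relabel_image[OF f that] .
  \<comment> \<open>Bounding the quantifier by the carrier makes \<open>ball_Pow_image\<close>
    applicable, after which both sides speak of subsets of \<open>I\<close>.\<close>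
  have d: "(\<forall>A. down_set I P A \<longrightarrow> Q A) \<longleftrightarrow> (\<forall>A\<subseteq>I. down_set I P A \<longrightarrow> Q A)" for I :: "'c set" and P Q
    by (auto dest: down_set_subset)
  show ?thesis
    unfolding Pre_iff[OF z] Pre_iff[OF submodular_relabel[OF f z]] preorder_on_image[OF f P]
      d[of I] d[of "f ` I"] ball_Pow_image
    by (simp add: r i image_Un[symmetric] le_infI1 down_set_image[OF f P] del: ereal_infty_less cong: imp_cong)
qed

lemma minPre_relabel:
  fixes f :: "'a \<Rightarrow> 'b"
  assumes f: "inj_on f I" and z: "submodular I z"
  shows "minPre (f ` I) (relabel f I z) = (`) (map_prod f f) ` minPre I z"
proof -
  let ?g = "(`) (map_prod f f)"
  have sub: "P \<subseteq> I \<times> I" if "P \<in> Pre I z" for P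
    using that by (auto simp: Pre_iff[OF z] preorder_on_def)
  have inj: "inj_on (map_prod f f) (I \<times> I)" using f by (auto simp: inj_on_def)
  have Pre: "Pre (f ` I) (relabel f I z) = ?g ` Pre I z"
  proof
    show "?g ` Pre I z \<subseteq> Pre (f ` I) (relabel f I z)"
      using Pre_relabel_iff[OF f z] sub by blast
    show "Pre (f ` I) (relabel f I z) \<subseteq> ?g ` Pre I z"
    proof
      fix P' assume P': "P' \<in> Pre (f ` I) (relabel f I z)"
      then have "P' \<subseteq> map_prod f f ` (I \<times> I)"
        by (auto simp: Pre_iff[OF submodular_relabel[OF f z]] preorder_on_def map_prod_def image_iff)
      then obtain P where "P \<subseteq> I \<times> I" "P' = map_prod f f ` P" by (auto simp: subset_image_iff)
      then show "P' \<in> ?g ` Pre I z" using P' Pre_relabel_iff[OF f z] by blast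
    qed
  qed
  have le: "?g P \<subseteq> ?g Q \<longleftrightarrow> P \<subseteq> Q" if "P \<in> Pre I z" "Q \<in> Pre I z" for P Q
    using inj_on_image_subset_iff[OF inj sub sub] that by blast
  have eq: "?g P = ?g Q \<longleftrightarrow> P = Q" if "P \<in> Pre I z" "Q \<in> Pre I z" for P Q
    using le that by blast
  have gen: "{P \<in> g ` X. \<forall>Q\<in>g ` X. Q \<subseteq> P \<longrightarrow> Q = P} = g ` {P \<in> X. \<forall>Q\<in>X. Q \<subseteq> P \<longrightarrow> Q = P}"
    if "\<And>P Q. P \<in> X \<Longrightarrow> Q \<in> X \<Longrightarrow> g P \<subseteq> g Q \<longleftrightarrow> P \<subseteq> Q"
      "\<And>P Q. P \<in> X \<Longrightarrow> Q \<in> X \<Longrightarrow> g P = g Q \<longleftrightarrow> P = Q"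
    for X and g :: "'a rel \<Rightarrow> 'b rel"
    using that by auto
  show ?thesis
    unfolding minPre_def Pre by (rule gen) (use le eq in blast)+
qed

section \<open>Strict and weak maps\<close>

text \<open>Order-reversing, as in the inequalities of \<Pi>(P): constant on each bubble and strict
  between comparable bubbles. For a preorder, their number is the strict order polynomial of the
  poset of bubbles at \<open>k\<close>.\<close>

definition strict_maps :: "'a set \<Rightarrow> 'a rel \<Rightarrow> nat \<Rightarrow> ('a \<Rightarrow> nat) set" where
  "strict_maps I P k = {f \<in> I \<rightarrow>\<^sub>E {..<k}. \<forall>x y. (x, y) \<in> P \<longrightarrow> f y \<le> f x \<and> ((y, x) \<in> P \<or> f y < f x)}"

definition weak_maps :: "'a set \<Rightarrow> 'a rel \<Rightarrow> nat \<Rightarrow> ('a \<Rightarrow> nat) set" where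
  "weak_maps I P k = {f \<in> I \<rightarrow>\<^sub>E {..<k}. \<forall>x y. (x, y) \<in> P \<longrightarrow> f y \<le> f x}"

lemma strict_mapsD:
  assumes "f \<in> strict_maps I P k"
  shows "x \<in> I \<Longrightarrow> f x < k" "x \<notin> I \<Longrightarrow> f x = undefined" "(x, y) \<in> P \<Longrightarrow> f y \<le> f x"
    "(x, y) \<in> P \<Longrightarrow> (y, x) \<notin> P \<Longrightarrow> f y < f x"
  using assms by (auto simp: strict_maps_def PiE_def extensional_def)

lemma strict_mapsI:
  assumes "\<And>x. x \<in> I \<Longrightarrow> f x < k" "\<And>x. x \<notin> I \<Longrightarrow> f x = undefined"
    "\<And>x y. (x, y) \<in> P \<Longrightarrow> f y \<le> f x" "\<And>x y. (x, y) \<in> P \<Longrightarrow> (y, x) \<notin> P \<Longrightarrow> f y < f x"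
  shows "f \<in> strict_maps I P k"
  unfolding strict_maps_def using assms by (simp add: PiE_iff extensional_def) blast

lemma weak_mapsD:
  assumes "f \<in> weak_maps I P k"
  shows "x \<in> I \<Longrightarrow> f x < k" "x \<notin> I \<Longrightarrow> f x = undefined" "(x, y) \<in> P \<Longrightarrow> f y \<le> f x"
  using assms by (auto simp: weak_maps_def PiE_def extensional_def)

lemma weak_mapsI:
  assumes "\<And>x. x \<in> I \<Longrightarrow> f x < k" "\<And>x. x \<notin> I \<Longrightarrow> f x = undefined"
    "\<And>x y. (x, y) \<in> P \<Longrightarrow> f y \<le> f x"
  shows "f \<in> weak_maps I P k"
  unfolding weak_maps_def using assms by (simp add: PiE_iff extensional_def)

lemma finite_strict_maps: "finite I \<Longrightarrow> finite (strict_maps I P k)"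
  by (rule finite_subset[of _ "I \<rightarrow>\<^sub>E {..<k}"]) (auto simp: strict_maps_def intro: finite_PiE)

lemma finite_weak_maps: "finite I \<Longrightarrow> finite (weak_maps I P k)"
  by (rule finite_subset[of _ "I \<rightarrow>\<^sub>E {..<k}"]) (auto simp: weak_maps_def intro: finite_PiE)

lemma card_strict_maps_0: "preorder_on I P \<Longrightarrow> card (strict_maps I P 0) = (if I = {} then 1 else 0)"
proof -
  assume "preorder_on I P"
  then have "I = {} \<Longrightarrow> strict_maps I P 0 = {\<lambda>_. undefined}"
    by (auto simp: strict_maps_def preorder_on_def)
  moreover have "I \<noteq> {} \<Longrightarrow> strict_maps I P 0 = {}"
    by (auto dest: strict_mapsD(1))
  ultimately show ?thesis by auto
qed

text \<open>The zero map is the only candidate, and it is strict unless some comparability is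
  one-sided. This is the counit of \<delta>: a symmetric preorder is an equivalence
  relation.\<close>

lemma card_strict_maps_1: 
  assumes P: "preorder_on I P" 
  shows "card (strict_maps I P 1) = (if sym P then 1 else 0)"
proof (cases "sym P")
  case True
  have "strict_maps I P 1 = {\<lambda>x\<in>I. 0}"
  proof
    show "strict_maps I P 1 \<subseteq> {\<lambda>x\<in>I. 0}"
    proof
      fix f assume f: "f \<in> strict_maps I P 1"
      have "f = (\<lambda>x\<in>I. 0)"
        using strict_mapsD(1,2)[OF f] by (auto simp: restrict_def fun_eq_iff)
      then show "f \<in> {\<lambda>x\<in>I. 0}" by simp
    qed
    have "(\<lambda>x\<in>I. 0) \<in> strict_maps I P 1"
      by (rule strict_mapsI) (use True preorder_fieldD[OF P] in \<open>auto dest: symD\<close>)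
    then show "{\<lambda>x\<in>I. 0} \<subseteq> strict_maps I P 1" by simp
  qed
  then show ?thesis using True by simp
next
  case False
  then obtain x y where xy: "(x, y) \<in> P" "(y, x) \<notin> P" by (auto simp: sym_def)
  have "f \<notin> strict_maps I P 1" for f
    using strict_mapsD(4)[OF _ xy, of f I 1] strict_mapsD(1)[of f I P 1] preorder_fieldD[OF P xy(1)] by fastforce
  then have "strict_maps I P 1 = {}" by blast
  then show ?thesis using False by simp
qed

lemma card_strict_maps_image:
  assumes f: "inj_on f I" and P: "P \<subseteq> I \<times> I"
  shows "card (strict_maps (f ` I) (map_prod f f ` P) k) = card (strict_maps I P k)"
proof -
  have mem: "(f x, f y) \<in> map_prod f f ` P \<longleftrightarrow> (x, y) \<in> P" if "x \<in> I" "y \<in> I" for x y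
    using inj_on_image_mem_iff[OF map_prod_inj_on[OF f f], of "(x, y)" P] that P by simp
  define g where "g = inv_into I f"
  have gf: "g (f x) = x" if "x \<in> I" for x using f that by (simp add: g_def)
  have fg: "f (g y) = y" "g y \<in> I" if "y \<in> f ` I" for y using that gf by auto
  have mem': "(g u, g v) \<in> P \<longleftrightarrow> (u, v) \<in> map_prod f f ` P" if "u \<in> f ` I" "v \<in> f ` I" for u v
    using mem[of "g u" "g v"] fg that by simp
  have sub: "map_prod f f ` P \<subseteq> f ` I \<times> f ` I" using P by auto
  have "bij_betw (\<lambda>h. \<lambda>x\<in>I. h (f x)) (strict_maps (f ` I) (map_prod f f ` P) k) (strict_maps I P k)"
  proof (rule bij_betw_byWitness[where f' = "\<lambda>h. \<lambda>y\<in>f ` I. h (g y)"])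
    show "\<forall>h\<in>strict_maps (f ` I) (map_prod f f ` P) k. (\<lambda>y\<in>f ` I. (\<lambda>x\<in>I. h (f x)) (g y)) = h"
      using strict_mapsD(2) fg by (fastforce simp: fun_eq_iff restrict_def)
    show "\<forall>h\<in>strict_maps I P k. (\<lambda>x\<in>I. (\<lambda>y\<in>f ` I. h (g y)) (f x)) = h"
      using strict_mapsD(2) gf by (fastforce simp: fun_eq_iff restrict_def)
    show "(\<lambda>h. \<lambda>x\<in>I. h (f x)) ` strict_maps (f ` I) (map_prod f f ` P) k \<subseteq> strict_maps I P k"
    proof (rule image_subsetI, rule strict_mapsI)
      fix h assume h: "h \<in> strict_maps (f ` I) (map_prod f f ` P) k"
      fix x y
      show "(\<lambda>x\<in>I. h (f x)) x < k" if "x \<in> I" using strict_mapsD(1)[OF h] that by simp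
      show "(\<lambda>x\<in>I. h (f x)) x = undefined" if "x \<notin> I" using that by simp
      assume xy: "(x, y) \<in> P"
      then have I: "x \<in> I" "y \<in> I" using P by auto
      show "(\<lambda>x\<in>I. h (f x)) y \<le> (\<lambda>x\<in>I. h (f x)) x"
        using strict_mapsD(3)[OF h, of "f x" "f y"] mem[OF I] xy I by simp
      show "(\<lambda>x\<in>I. h (f x)) y < (\<lambda>x\<in>I. h (f x)) x" if "(y, x) \<notin> P"
        using strict_mapsD(4)[OF h, of "f x" "f y"] mem[OF I] mem[OF I(2,1)] xy I that by simp
    qed
    show "(\<lambda>h. \<lambda>y\<in>f ` I. h (g y)) ` strict_maps I P k \<subseteq> strict_maps (f ` I) (map_prod f f ` P) k"
    proof (rule image_subsetI, rule strict_mapsI)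
      fix h assume h: "h \<in> strict_maps I P k"
      fix x y
      show "(\<lambda>y\<in>f ` I. h (g y)) x < k" if "x \<in> f ` I" using strict_mapsD(1)[OF h] fg(2)[OF that] that by simp
      show "(\<lambda>y\<in>f ` I. h (g y)) x = undefined" if "x \<notin> f ` I" using that by simp
      assume xy: "(x, y) \<in> map_prod f f ` P"
      then have I: "x \<in> f ` I" "y \<in> f ` I" using sub by auto
      have xy': "(g x, g y) \<in> P" using mem'[OF I] xy by blast
      show "(\<lambda>y\<in>f ` I. h (g y)) y \<le> (\<lambda>y\<in>f ` I. h (g y)) x"
        using strict_mapsD(3)[OF h xy'] I by simp
      show "(\<lambda>y\<in>f ` I. h (g y)) y < (\<lambda>y\<in>f ` I. h (g y)) x" if "(y, x) \<notin> map_prod f f ` P"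
        using strict_mapsD(4)[OF h xy'] mem'[OF I(2,1)] I that by simp
    qed
  qed
  then show ?thesis by (rule bij_betw_same_card)
qed

section \<open>Decompositions of strict maps along disjoint unions, sums and products\<close>

lemma card_strict_maps_Un:
  assumes P: "preorder_on I P" and Q: "preorder_on J Q" and d: "I \<inter> J = {}"
  shows "card (strict_maps (I \<union> J) (P \<union> Q) k) = card (strict_maps I P k) * card (strict_maps J Q k)"
proof -
  have fP: "x \<in> I" "y \<in> I" if "(x, y) \<in> P" for x y using preorder_fieldD[OF P that] by auto
  have fQ: "x \<in> J" "y \<in> J" if "(x, y) \<in> Q" for x y using preorder_fieldD[OF Q that] by auto
  have dj: "x \<in> J \<Longrightarrow> x \<notin> I" for x using d by auto
  have "bij_betw (\<lambda>h. (restrict h I, restrict h J)) (strict_maps (I \<union> J) (P \<union> Q) k) (strict_maps I P k \<times> strict_maps J Q k)"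
  proof (rule bij_betw_byWitness[where f' = "\<lambda>(g, h). \<lambda>x\<in>I \<union> J. if x \<in> I then g x else h x"])
    show "\<forall>h\<in>strict_maps (I \<union> J) (P \<union> Q) k.
      (\<lambda>(g, h). \<lambda>x\<in>I \<union> J. if x \<in> I then g x else h x) (restrict h I, restrict h J) = h"
      using strict_mapsD(2) by (fastforce simp: fun_eq_iff restrict_def)
    show "\<forall>p\<in>strict_maps I P k \<times> strict_maps J Q k.
      (restrict ((\<lambda>(g, h). \<lambda>x\<in>I \<union> J. if x \<in> I then g x else h x) p) I,
       restrict ((\<lambda>(g, h). \<lambda>x\<in>I \<union> J. if x \<in> I then g x else h x) p) J) = p"
      using strict_mapsD(2) dj by (fastforce simp: fun_eq_iff restrict_def)
    show "(\<lambda>h. (restrict h I, restrict h J)) ` strict_maps (I \<union> J) (P \<union> Q) k \<subseteq> strict_maps I P k \<times> strict_maps J Q k"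
    proof (rule image_subsetI, rule SigmaI)
      fix h assume h: "h \<in> strict_maps (I \<union> J) (P \<union> Q) k"
      show "restrict h I \<in> strict_maps I P k"
        by (rule strict_mapsI) (use strict_mapsD[OF h] fP fQ dj in \<open>auto, blast\<close>)
      show "restrict h J \<in> strict_maps J Q k"
        by (rule strict_mapsI) (use strict_mapsD[OF h] fP fQ dj in \<open>auto, blast\<close>)
    qed
    show "(\<lambda>(g, h). \<lambda>x\<in>I \<union> J. if x \<in> I then g x else h x) ` (strict_maps I P k \<times> strict_maps J Q k)
       \<subseteq> strict_maps (I \<union> J) (P \<union> Q) k"
    proof (clarsimp, rule strict_mapsI)
      fix g h assume g: "g \<in> strict_maps I P k" and h: "h \<in> strict_maps J Q k"
      fix x y
      let ?f = "\<lambda>x\<in>I \<union> J. if x \<in> I then g x else h x"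
      show "?f x < k" if "x \<in> I \<union> J" using that strict_mapsD(1)[OF g] strict_mapsD(1)[OF h] by auto
      show "?f x = undefined" if "x \<notin> I \<union> J" using that by auto
      have c: "(x, y) \<in> P \<and> x \<in> I \<and> y \<in> I \<or> (x, y) \<in> Q \<and> x \<in> J \<and> x \<notin> I \<and> y \<in> J \<and> y \<notin> I"
        if "(x, y) \<in> P \<union> Q" using that fP fQ dj by blast
      show "?f y \<le> ?f x" if "(x, y) \<in> P \<union> Q"
        using c[OF that] strict_mapsD(3)[OF g, of x y] strict_mapsD(3)[OF h, of x y] by auto
      show "?f y < ?f x" if "(x, y) \<in> P \<union> Q" "(y, x) \<notin> P \<union> Q"
        using c[OF that(1)] that(2) strict_mapsD(4)[OF g, of x y] strict_mapsD(4)[OF h, of x y] by auto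
    qed
  qed
  then show ?thesis by (simp add: bij_betw_same_card card_cartesian_product)
qed

text \<open>\<open>A\<close> is the set where the map takes a value \<open>\<ge> l\<close>.\<close>

lemma card_strict_maps_add:
  assumes I: "finite I" and P: "preorder_on I P"
  shows "card (strict_maps I P (k + l)) =
    (\<Sum>A | down_set I P A. card (strict_maps A (P \<inter> A \<times> A) k) * card (strict_maps (I - A) (P \<inter> (I - A) \<times> (I - A)) l))"
proof -
  let ?D = "{A. down_set I P A}"
  let ?S = "\<lambda>A. strict_maps A (P \<inter> A \<times> A) k \<times> strict_maps (I - A) (P \<inter> (I - A) \<times> (I - A)) l"
  let ?A = "\<lambda>f. {x \<in> I. l \<le> f x}"
  have fin: "finite ?D" by (rule finite_subset[of _ "Pow I"]) (use I in \<open>auto simp: down_set_def\<close>)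
  have fP: "x \<in> I" "y \<in> I" if "(x, y) \<in> P" for x y using preorder_fieldD[OF P that] by auto
  have "bij_betw (\<lambda>f. (?A f, (\<lambda>x\<in>?A f. f x - l), restrict f (I - ?A f)))
     (strict_maps I P (k + l)) (Sigma ?D ?S)"
  proof (rule bij_betw_byWitness[where f' = "\<lambda>(A, g, h). \<lambda>x\<in>I. if x \<in> A then g x + l else h x"])
    show "\<forall>f\<in>strict_maps I P (k + l).
       (\<lambda>(A, g, h). \<lambda>x\<in>I. if x \<in> A then g x + l else h x) (?A f, (\<lambda>x\<in>?A f. f x - l), restrict f (I - ?A f)) = f"
      using strict_mapsD(2) by (fastforce simp: fun_eq_iff restrict_def)
    show "(\<lambda>f. (?A f, (\<lambda>x\<in>?A f. f x - l), restrict f (I - ?A f))) ` strict_maps I P (k + l) \<subseteq> Sigma ?D ?S"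
    proof (rule image_subsetI)
      fix f assume f: "f \<in> strict_maps I P (k + l)"
      have "down_set I P (?A f)"
        unfolding down_set_def using strict_mapsD(3)[OF f] fP by (auto intro: order_trans)
      moreover have "(\<lambda>x\<in>?A f. f x - l) \<in> strict_maps (?A f) (P \<inter> ?A f \<times> ?A f) k"
      proof (rule strict_mapsI)
        fix x y
        show "(\<lambda>x\<in>?A f. f x - l) x < k" if "x \<in> ?A f" using strict_mapsD(1)[OF f, of x] that by auto
        show "(\<lambda>x\<in>?A f. f x - l) x = undefined" if "x \<notin> ?A f" using that by auto
        assume xy: "(x, y) \<in> P \<inter> ?A f \<times> ?A f"
        show "(\<lambda>x\<in>?A f. f x - l) y \<le> (\<lambda>x\<in>?A f. f x - l) x"
          using strict_mapsD(3)[OF f, of x y] xy by auto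
        show "(\<lambda>x\<in>?A f. f x - l) y < (\<lambda>x\<in>?A f. f x - l) x" if "(y, x) \<notin> P \<inter> ?A f \<times> ?A f"
          using strict_mapsD(4)[OF f, of x y] that xy by auto
      qed
      moreover have "restrict f (I - ?A f) \<in> strict_maps (I - ?A f) (P \<inter> (I - ?A f) \<times> (I - ?A f)) l"
      proof (rule strict_mapsI)
        fix x y
        show "restrict f (I - ?A f) x < l" if "x \<in> I - ?A f" using that by auto
        show "restrict f (I - ?A f) x = undefined" if "x \<notin> I - ?A f" using that by auto
        assume xy: "(x, y) \<in> P \<inter> (I - ?A f) \<times> (I - ?A f)"
        show "restrict f (I - ?A f) y \<le> restrict f (I - ?A f) x"
          using strict_mapsD(3)[OF f, of x y] xy by auto
        show "restrict f (I - ?A f) y < restrict f (I - ?A f) x" if "(y, x) \<notin> P \<inter> (I - ?A f) \<times> (I - ?A f)"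
          using strict_mapsD(4)[OF f, of x y] that xy by auto
      qed
      ultimately show "(?A f, (\<lambda>x\<in>?A f. f x - l), restrict f (I - ?A f)) \<in> Sigma ?D ?S" by simp
    qed
    have key: "(\<lambda>x\<in>I. if x \<in> A then g x + l else h x) \<in> strict_maps I P (k + l) \<and>
        ?A (\<lambda>x\<in>I. if x \<in> A then g x + l else h x) = A"
      if A: "down_set I P A" and g: "g \<in> strict_maps A (P \<inter> A \<times> A) k"
        and h: "h \<in> strict_maps (I - A) (P \<inter> (I - A) \<times> (I - A)) l" for A g h
    proof
      let ?f = "\<lambda>x\<in>I. if x \<in> A then g x + l else h x"
      have AI: "A \<subseteq> I" using A by (simp add: down_set_def)
      show "?A ?f = A" using AI strict_mapsD(1)[OF h] by (fastforce split: if_splits)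
      show "?f \<in> strict_maps I P (k + l)"
      proof (rule strict_mapsI)
        fix x y
        show "?f x < k + l" if "x \<in> I" using that strict_mapsD(1)[OF g, of x] strict_mapsD(1)[OF h, of x] by auto
        show "?f x = undefined" if "x \<notin> I" using that by auto
        assume xy: "(x, y) \<in> P"
        \<comment> \<open>The down-set property rules out \<open>y\<close> in \<open>A\<close> with
          \<open>x\<close> outside. In the mixed case strictness is automatic, since values on
          \<open>A\<close> are at least \<open>l\<close> and values outside are below
          \<open>l\<close>.\<close>
        consider "x \<in> A" "y \<in> A" | "x \<in> A" "y \<notin> A" | "x \<notin> A" "y \<notin> A"
          using down_setD[OF A xy] by blast
        note cas = this
        show "?f y \<le> ?f x"
          using strict_mapsD(3)[OF g, of x y] strict_mapsD(3)[OF h, of x y] strict_mapsD(1)[OF h, of y] fP[OF xy] xy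
          by (cases rule: cas) auto
        show "?f y < ?f x" if "(y, x) \<notin> P"
          using strict_mapsD(4)[OF g, of x y] strict_mapsD(4)[OF h, of x y] strict_mapsD(1)[OF h, of y] fP[OF xy] xy that
          by (cases rule: cas) auto
      qed
    qed
    show "(\<lambda>(A, g, h). \<lambda>x\<in>I. if x \<in> A then g x + l else h x) ` Sigma ?D ?S \<subseteq> strict_maps I P (k + l)"
      using key by auto
    show "\<forall>p\<in>Sigma ?D ?S. (\<lambda>f. (?A f, (\<lambda>x\<in>?A f. f x - l), restrict f (I - ?A f)))
        ((\<lambda>(A, g, h). \<lambda>x\<in>I. if x \<in> A then g x + l else h x) p) = p"
    proof
      fix p assume p: "p \<in> Sigma ?D ?S"
      obtain A g h where pe: "p = (A, g, h)" by (cases p)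
      have A: "down_set I P A" and g: "g \<in> strict_maps A (P \<inter> A \<times> A) k"
        and h: "h \<in> strict_maps (I - A) (P \<inter> (I - A) \<times> (I - A)) l" using p by (auto simp: pe)
      let ?f = "\<lambda>x\<in>I. if x \<in> A then g x + l else h x"
      have AI: "A \<subseteq> I" using A by (simp add: down_set_def)
      have e: "?A ?f = A" using key[OF A g h] by blast
      have 1: "(\<lambda>x\<in>A. ?f x - l) = g" using AI strict_mapsD(2)[OF g] by (auto simp: fun_eq_iff restrict_def)
      have 2: "restrict ?f (I - A) = h" using AI strict_mapsD(2)[OF h] by (auto simp: fun_eq_iff restrict_def)
      show "(\<lambda>f. (?A f, (\<lambda>x\<in>?A f. f x - l), restrict f (I - ?A f)))
        ((\<lambda>(A, g, h). \<lambda>x\<in>I. if x \<in> A then g x + l else h x) p) = p"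
        by (simp only: pe prod.case e 1 2)
    qed
  qed
  then have "card (strict_maps I P (k + l)) = card (Sigma ?D ?S)" by (rule bij_betw_same_card)
  also have "\<dots> = (\<Sum>A\<in>?D. card (?S A))"
    by (rule card_SigmaI[OF fin]) (use I in \<open>auto intro!: finite_strict_maps simp: down_set_def dest: finite_subset\<close>)
  finally show ?thesis by (simp add: card_cartesian_product)
qed

text \<open>The bubbles of the level closure are the connected components of the level sets of \<open>f\<close>.\<close>

definition level_closure :: "'a rel \<Rightarrow> ('a \<Rightarrow> nat) \<Rightarrow> 'a rel" where
  "level_closure P f = (P \<union> {(y, x). (x, y) \<in> P \<and> f x = f y})\<^sup>+"

text \<open>Along \<open>P\<close> a map that is strict for \<open>Q\<close> is constant only inside
  bubbles of \<open>Q\<close>, so its level closure lies in \<open>Q\<close>; the contraction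
  property is the splitting hypothesis that excludes a proper inclusion.\<close>

lemma level_closure_unique:
  assumes I: "finite I" and P: "preorder_on I P" and Q: "preorder_contraction I P Q"
    and f: "f \<in> strict_maps I Q l"
  shows "level_closure P f = Q"
proof -
  have preQ: "preorder_on I Q" and PQ: "P \<subseteq> Q" using Q by (auto simp: preorder_contraction_def)
  have tQ: "trans Q" using preQ by (simp add: preorder_on_def)
  let ?S = "P \<union> (P\<inverse> \<inter> Q)" let ?R = "?S\<^sup>+"
  have E: "{(y, x). (x, y) \<in> P \<and> f x = f y} = P\<inverse> \<inter> Q"
  proof -
    have "f x = f y \<longleftrightarrow> (y, x) \<in> Q" if "(x, y) \<in> P" for x y
    proof -
      have "(x, y) \<in> Q" using that PQ by blast
      then show ?thesis
        using strict_mapsD(3)[OF f, of x y] strict_mapsD(3)[OF f, of y x] strict_mapsD(4)[OF f, of x y] by force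
    qed
    then show ?thesis by auto
  qed
  have RQ: "?R \<subseteq> Q"
  proof -
    have "?R \<subseteq> Q\<^sup>+" using PQ by (intro subsetI) (erule trancl_mono, blast)
    then show ?thesis using tQ by simp
  qed
  have R: "preorder_on I ?R"
    using RQ P preQ unfolding preorder_on_def refl_on_def by (auto simp: trans_trancl)
  have step: "(c, w) \<in> ?R" if "(w, c) \<in> ?S" "(c, w) \<in> Q" for w c
    using that by (intro r_into_trancl) auto
  \<comment> \<open>If \<open>w\<close> is linked to \<open>c\<close> in \<open>?R\<close> while
    \<open>c\<close> is below \<open>w\<close> in \<open>Q\<close>, the whole chain lies in one
    bubble of \<open>Q\<close>, so each of its steps can be reversed.\<close>
  have sym: "(c, w) \<in> Q \<longrightarrow> (c, w) \<in> ?R" if "(w, c) \<in> ?R" for w c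
    using that
  proof (induction rule: trancl_induct)
    case (step y c)
    show ?case
    proof
      assume cw: "(c, w) \<in> Q"
      have "(w, y) \<in> Q" "(y, c) \<in> Q" using step.hyps RQ PQ by blast+
      then have "(c, y) \<in> Q" "(y, w) \<in> Q" using cw tQ by (auto dest: transD)
      then have "(c, y) \<in> ?R" "(y, w) \<in> ?R" using step.IH \<open>\<And>w c. (w, c) \<in> ?S \<Longrightarrow> (c, w) \<in> Q \<Longrightarrow> (c, w) \<in> ?R\<close>[OF step.hyps(2)] by blast+
      then show "(c, w) \<in> ?R" by (rule trancl_trans)
    qed
  qed (use step in blast)
  have "P \<subseteq> ?R" by auto
  then have "Q = ?R"
    using sym Q down_set_mono[of P ?R I] unfolding preorder_contraction_def
    by (intro preorder_eq_by_splitting[OF I preQ R RQ]) metis+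
  then show ?thesis unfolding level_closure_def E by simp
qed

text \<open>Going up along the generating pairs \<open>f\<close> never increases, so it is constant
  on every cycle of the closure; hence a pair with different values is never reversed, and
  \<open>f\<close> becomes strict.\<close>

lemma level_closure:
  assumes P: "preorder_on I P" and f: "f \<in> weak_maps I P l"
  shows "preorder_contraction I P (level_closure P f)" "f \<in> strict_maps I (level_closure P f) l"
    "(x, y) \<in> level_closure P f \<Longrightarrow> (y, x) \<in> level_closure P f \<longleftrightarrow> f x = f y"
proof -
  let ?S = "P \<union> {(y, x). (x, y) \<in> P \<and> f x = f y}" let ?Q = "?S\<^sup>+"
  have PQ: "P \<subseteq> ?Q" by auto
  have SI: "?S \<subseteq> I \<times> I" using P by (auto simp: preorder_on_def)
  have QI: "?Q \<subseteq> I \<times> I" by (rule trancl_subset_Sigma[OF SI])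
  have Q: "preorder_on I ?Q"
    using QI PQ P unfolding preorder_on_def refl_on_def by (auto simp: trans_trancl)
  have S: "f y \<le> f x \<and> (f x = f y \<longrightarrow> (y, x) \<in> ?Q)" if "(x, y) \<in> ?S" for x y
    using that weak_mapsD(3)[OF f] by (auto intro!: r_into_trancl)
  have m: "f y \<le> f x \<and> (f x = f y \<longrightarrow> (y, x) \<in> ?Q)" if "(x, y) \<in> ?Q" for x y
    using that
  proof (induction rule: trancl_induct)
    case (step y c)
    then have "f c \<le> f y" "f c = f y \<longrightarrow> (c, y) \<in> ?Q" using S[OF step.hyps(2)] by auto
    then show ?case using step.IH by (auto intro: trancl_trans)
  qed (rule S)
  have m2: "(y, x) \<in> ?Q \<longleftrightarrow> f x = f y" if "(x, y) \<in> ?Q" for x y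
    using m[OF that] m[of y x] by auto
  then show "(x, y) \<in> level_closure P f \<Longrightarrow> (y, x) \<in> level_closure P f \<longleftrightarrow> f x = f y"
    unfolding level_closure_def .
  show "f \<in> strict_maps I (level_closure P f) l"
    unfolding level_closure_def
  proof (rule strict_mapsI)
    fix x y assume xy: "(x, y) \<in> ?Q"
    show "f y \<le> f x" using m[OF xy] by simp
    show "f y < f x" if "(y, x) \<notin> ?Q" using m[OF xy] that by force
  qed (use weak_mapsD[OF f] in auto)
  \<comment> \<open>Only the reversed level pairs have to be checked, because \<open>X\<close> is
    already a \<open>P\<close>-down-set.\<close>
  have down: "down_set I ?Q X" if X: "down_set I P X" and c: "\<And>x y. (x, y) \<in> P \<Longrightarrow> f x = f y \<Longrightarrow> x \<in> X \<Longrightarrow> y \<in> X" for X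
  proof -
    have "y \<in> X \<longrightarrow> x \<in> X" if "(x, y) \<in> ?Q" for x y
      using that by (induction rule: trancl_induct) (use c down_setD[OF X] in auto)
    then show ?thesis using down_set_subset[OF X] by (simp add: down_set_def)
  qed
  \<comment> \<open>If a reversed pair led out of \<open>X\<close>, it would lead into
    \<open>Y\<close>; the original pair then puts \<open>x\<close> into \<open>X \<inter> Y\<close>,
    and this \<open>?Q\<close>-down-set brings \<open>y\<close> back into \<open>X\<close>.\<close>
  have "down_set I ?Q X"
    if d: "down_set I P X" "down_set I P Y" "down_set I ?Q (X \<inter> Y)" "down_set I ?Q (X \<union> Y)" for X Y
  proof (rule down[OF d(1)])
    fix x y assume xy: "(x, y) \<in> P" "f x = f y" "x \<in> X"
    then have yx: "(y, x) \<in> ?Q" by (auto intro: r_into_trancl)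
    show "y \<in> X"
    proof (rule ccontr)
      assume n: "y \<notin> X"
      then have "y \<in> Y" using down_setD[OF d(4) yx] xy(3) by blast
      then have "x \<in> X \<inter> Y" using down_setD[OF d(2) xy(1)] xy(3) by blast
      then show False using down_setD[OF d(3) yx] n by blast
    qed
  qed
  then show "preorder_contraction I P (level_closure P f)"
    unfolding level_closure_def preorder_contraction_def
    using Q PQ by (metis (no_types, lifting) Int_commute Un_commute)
qed

text \<open>In \<open>f = k (f div k) + f mod k\<close> the quotient determines the contraction \<open>Q\<close> as its level closure,
  and the remainder is strict inside the bubbles of \<open>Q\<close>.\<close>

lemma card_strict_maps_mult:
  assumes I: "finite I" and P: "preorder_on I P" and k: "k > 0"
  shows "card (strict_maps I P (k * l)) =
    (\<Sum>Q | preorder_contraction I P Q. card (strict_maps I (P \<inter> (Q \<inter> Q\<inverse>)) k) * card (strict_maps I Q l))"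
proof -
  let ?D = "{Q. preorder_contraction I P Q}"
  let ?S = "\<lambda>Q. strict_maps I (P \<inter> (Q \<inter> Q\<inverse>)) k \<times> strict_maps I Q l"
  let ?h = "\<lambda>f. \<lambda>x\<in>I. f x div k" and ?g = "\<lambda>f. \<lambda>x\<in>I. f x mod k"
  let ?T = "\<lambda>f. (level_closure P (?h f), ?g f, ?h f)"
  let ?U = "\<lambda>(Q, g, h). \<lambda>x\<in>I. h x * k + g x"
  have fin: "finite ?D"
    by (rule finite_subset[OF _ finite_preorders[OF I]]) (auto simp: preorder_contraction_def)
  have fP: "x \<in> I" "y \<in> I" if "(x, y) \<in> P" for x y using preorder_fieldD[OF P that] by auto
  \<comment> \<open>Digits in base \<open>k\<close>: by \<open>bound\<close> and \<open>lex\<close>,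
    the number \<open>h * k + g\<close> with \<open>g < k\<close> stays below \<open>k * l\<close>
    and is ordered first by \<open>h\<close>.\<close>
  have bound: "h * k + g < k * l" if "h < l" "g < k" for h g :: nat
  proof -
    have "h * k + g < Suc h * k" using that by simp
    also have "\<dots> \<le> l * k" using that by (intro mult_le_mono1) simp
    finally show ?thesis by (simp add: mult.commute)
  qed
  have lex: "h' * k + g' < h * k + g" if "h' < h" "g' < k" for h' h g g' :: nat
  proof -
    have "h' * k + g' < Suc h' * k" using that by simp
    also have "\<dots> \<le> h * k" using that by (intro mult_le_mono1) simp
    finally show ?thesis by simp
  qed
  have "bij_betw ?T (strict_maps I P (k * l)) (Sigma ?D ?S)"
  proof (rule bij_betw_byWitness[where f' = ?U])
    show "\<forall>f\<in>strict_maps I P (k * l). ?U (?T f) = f"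
      using strict_mapsD(2) by (fastforce simp: fun_eq_iff restrict_def)
    show "?T ` strict_maps I P (k * l) \<subseteq> Sigma ?D ?S"
    proof (rule image_subsetI)
      fix f assume f: "f \<in> strict_maps I P (k * l)"
      have h: "?h f \<in> weak_maps I P l"
      proof (rule weak_mapsI)
        fix x y
        show "?h f x < l" if "x \<in> I"
          using strict_mapsD(1)[OF f that] that by (simp add: less_mult_imp_div_less mult.commute)
        show "?h f y \<le> ?h f x" if "(x, y) \<in> P"
          using strict_mapsD(3)[OF f that] fP[OF that] by (simp add: div_le_mono)
      qed simp
      note lc = level_closure[OF P h]
      have "?g f \<in> strict_maps I (P \<inter> (level_closure P (?h f) \<inter> (level_closure P (?h f))\<inverse>)) k"
      proof (rule strict_mapsI)
        fix x y
        show "?g f x < k" if "x \<in> I" using that k by simp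
        assume xy: "(x, y) \<in> P \<inter> (level_closure P (?h f) \<inter> (level_closure P (?h f))\<inverse>)"
        \<comment> \<open>Inside a bubble of the level closure the quotients agree, so the
          remainders compare as the values of \<open>f\<close> do.\<close>
        then have eq: "f x div k = f y div k" using lc(3)[of x y] fP[of x y] by auto
        have "f x mod k = f x - k * (f x div k)" "f y mod k = f y - k * (f y div k)"
          by (simp_all only: minus_mult_div_eq_mod)
        note d = this(1)[unfolded eq] this(2)
        show "?g f y \<le> ?g f x"
          using strict_mapsD(3)[OF f, of x y] xy fP[of x y] d by auto
        show "?g f y < ?g f x" if "(y, x) \<notin> P \<inter> (level_closure P (?h f) \<inter> (level_closure P (?h f))\<inverse>)"
        proof -
          have "(y, x) \<notin> P" using xy that by blast
          then have "f y < f x" using strict_mapsD(4)[OF f, of x y] xy by blast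
          moreover have "k * (f y div k) \<le> f y" by simp
          ultimately have "f y - k * (f y div k) < f x - k * (f y div k)" by (rule diff_less_mono)
          then show ?thesis using d xy fP[of x y] by auto
        qed
      qed simp
      then show "?T f \<in> Sigma ?D ?S" using lc(1,2) by simp
    qed
    have main: "?U (Q, g, h) \<in> strict_maps I P (k * l) \<and> ?T (?U (Q, g, h)) = (Q, g, h)"
      if Q: "preorder_contraction I P Q" and g: "g \<in> strict_maps I (P \<inter> (Q \<inter> Q\<inverse>)) k" and h: "h \<in> strict_maps I Q l"
      for Q g h
    proof
      let ?f = "\<lambda>x\<in>I. h x * k + g x"
      have PQ: "P \<subseteq> Q" using Q by (simp add: preorder_contraction_def)
      have "?f \<in> strict_maps I P (k * l)"
      proof (rule strict_mapsI)
        fix x y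
        show "?f x < k * l" if "x \<in> I"
          using bound[OF strict_mapsD(1)[OF h that] strict_mapsD(1)[OF g that]] that by simp
        assume xy: "(x, y) \<in> P"
        then have xyQ: "(x, y) \<in> Q" using PQ by blast
        have gy: "g y < k" using strict_mapsD(1)[OF g] fP[OF xy] by blast
        \<comment> \<open>Either the leading digits decide, or \<open>x\<close> and \<open>y\<close>
          share a bubble of \<open>Q\<close> and the pair falls under the condition on
          \<open>g\<close>.\<close>
        have c: "h y < h x \<or> h y = h x \<and> (y, x) \<in> Q"
          using strict_mapsD(3,4)[OF h xyQ] strict_mapsD(3)[OF h, of y x] by fastforce
        show "?f y \<le> ?f x"
          using c lex[OF _ gy, of "h y" "h x" "g x"] strict_mapsD(3)[OF g, of x y] xy xyQ fP[OF xy] by auto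
        show "?f y < ?f x" if "(y, x) \<notin> P"
          using c lex[OF _ gy, of "h y" "h x" "g x"] strict_mapsD(4)[OF g, of x y] xy xyQ fP[OF xy] that by auto
      qed simp
      then show "?U (Q, g, h) \<in> strict_maps I P (k * l)" by simp
      have h': "?h ?f = h" using k strict_mapsD(1)[OF g] strict_mapsD(2)[OF h] by (auto simp: fun_eq_iff restrict_def)
      have g': "?g ?f = g" using strict_mapsD(1)[OF g] strict_mapsD(2)[OF g] by (auto simp: fun_eq_iff restrict_def)
      show "?T (?U (Q, g, h)) = (Q, g, h)"
        by (simp only: prod.case h' g' level_closure_unique[OF I P Q h])
    qed
    show "?U ` Sigma ?D ?S \<subseteq> strict_maps I P (k * l)"
      using main by auto
    show "\<forall>p\<in>Sigma ?D ?S. ?T (?U p) = p"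
    proof
      fix p assume p: "p \<in> Sigma ?D ?S"
      obtain Q g h where pe: "p = (Q, g, h)" by (cases p)
      show "?T (?U p) = p" unfolding pe using main[of Q g h] p unfolding pe by blast
    qed
  qed
  then have "card (strict_maps I P (k * l)) = card (Sigma ?D ?S)" by (rule bij_betw_same_card)
  also have "\<dots> = (\<Sum>Q\<in>?D. card (?S Q))"
    by (rule card_SigmaI[OF fin]) (use I in \<open>auto intro!: finite_strict_maps\<close>)
  finally show ?thesis by (simp add: card_cartesian_product)
qed

section \<open>Reciprocity between strict and weak maps\<close>

lemma card_split: "finite S \<Longrightarrow> card S = card {f \<in> S. Q f} + card {f \<in> S. \<not> Q f}"
  by (subst card_Un_disjoint[symmetric]) (auto intro: arg_cong[of _ _ card])

text \<open>The top bubble \<open>I - A\<close> takes the smallest value; the two summands count the maps with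
  positive and with zero value there.\<close>

lemma
  assumes I: "finite I" and P: "preorder_on I P" and mI: "m \<in> I" and m: "\<And>x. x \<in> I \<Longrightarrow> (x, m) \<in> P"
    and A: "A = {x \<in> I. (m, x) \<notin> P}"
  shows card_strict_maps_Suc_top:
      "card (strict_maps I P (Suc k)) = card (strict_maps I P k) + card (strict_maps A (P \<inter> A \<times> A) k)"
    and card_weak_maps_Suc_top:
      "card (weak_maps I P (Suc k)) = card (weak_maps I P k) + card (weak_maps A (P \<inter> A \<times> A) (Suc k))"
proof -
  have fP: "x \<in> I" "y \<in> I" if "(x, y) \<in> P" for x y using preorder_fieldD[OF P that] by auto
  have AI: "A \<subseteq> I" using A by auto
  have Adown: "x \<in> A" if "(x, y) \<in> P" "y \<in> A" for x y
    using that preorder_transD[OF P] fP unfolding A by blast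
  have top: "(x, y) \<in> P" if "x \<in> I" "y \<in> I - A" for x y
    using that preorder_transD[OF P m[OF that(1)]] unfolding A by blast
  \<comment> \<open>As \<open>m\<close> is a greatest element, \<open>f m\<close> is the minimum of
    \<open>f\<close>; if it is positive, all values can be shifted down by one.\<close>
  let ?up = "\<lambda>g. \<lambda>x\<in>I. Suc (g x)" and ?dn = "\<lambda>f. \<lambda>x\<in>I. f x - 1"
  have sm: "f m \<le> f x" if "f \<in> strict_maps I P n" "x \<in> I" for f x n
    using strict_mapsD(3)[OF that(1) m[OF that(2)]] .
  have wm: "f m \<le> f x" if "f \<in> weak_maps I P n" "x \<in> I" for f x n
    using weak_mapsD(3)[OF that(1) m[OF that(2)]] .
  have "bij_betw ?up (strict_maps I P k) {f \<in> strict_maps I P (Suc k). f m \<noteq> 0}"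
  proof (rule bij_betw_byWitness[where f' = ?dn])
    show "\<forall>f\<in>strict_maps I P k. ?dn (?up f) = f"
      using strict_mapsD(2) by (fastforce simp: fun_eq_iff restrict_def)
    show "\<forall>f\<in>{f \<in> strict_maps I P (Suc k). f m \<noteq> 0}. ?up (?dn f) = f"
      using strict_mapsD(2) sm by (fastforce simp: fun_eq_iff restrict_def)
    show "?up ` strict_maps I P k \<subseteq> {f \<in> strict_maps I P (Suc k). f m \<noteq> 0}"
    proof (intro image_subsetI CollectI conjI strict_mapsI)
      fix g x y assume g: "g \<in> strict_maps I P k"
      show "?up g m \<noteq> 0" using mI by simp
      show "?up g x < Suc k" if "x \<in> I" using strict_mapsD(1)[OF g that] that by simp
      show "?up g y \<le> ?up g x" if "(x, y) \<in> P" using strict_mapsD(3)[OF g that] fP[OF that] by simp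
      show "?up g y < ?up g x" if "(x, y) \<in> P" "(y, x) \<notin> P" using strict_mapsD(4)[OF g that] fP[OF that(1)] by simp
    qed simp
    show "?dn ` {f \<in> strict_maps I P (Suc k). f m \<noteq> 0} \<subseteq> strict_maps I P k"
    proof (intro image_subsetI strict_mapsI)
      fix f x y assume "f \<in> {f \<in> strict_maps I P (Suc k). f m \<noteq> 0}"
      then have f: "f \<in> strict_maps I P (Suc k)" and fm: "f m \<noteq> 0" by auto
      have pos: "f x \<noteq> 0" if "x \<in> I" for x using sm[OF f that] fm by simp
      show "?dn f x < k" if "x \<in> I" using strict_mapsD(1)[OF f that] pos[OF that] that by simp
      show "?dn f y \<le> ?dn f x" if "(x, y) \<in> P" using strict_mapsD(3)[OF f that] fP[OF that] by simp
      show "?dn f y < ?dn f x" if "(x, y) \<in> P" "(y, x) \<notin> P"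
        using strict_mapsD(4)[OF f that] fP[OF that(1)] pos[of y] by auto
    qed simp
  qed
  then have 1: "card {f \<in> strict_maps I P (Suc k). f m \<noteq> 0} = card (strict_maps I P k)"
    by (simp add: bij_betw_same_card)
  have "bij_betw ?up (weak_maps I P k) {f \<in> weak_maps I P (Suc k). f m \<noteq> 0}"
  proof (rule bij_betw_byWitness[where f' = ?dn])
    show "\<forall>f\<in>weak_maps I P k. ?dn (?up f) = f"
      using weak_mapsD(2) by (fastforce simp: fun_eq_iff restrict_def)
    show "\<forall>f\<in>{f \<in> weak_maps I P (Suc k). f m \<noteq> 0}. ?up (?dn f) = f"
      using weak_mapsD(2) wm by (fastforce simp: fun_eq_iff restrict_def)
    show "?up ` weak_maps I P k \<subseteq> {f \<in> weak_maps I P (Suc k). f m \<noteq> 0}"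
    proof (intro image_subsetI CollectI conjI weak_mapsI)
      fix g x y assume g: "g \<in> weak_maps I P k"
      show "?up g m \<noteq> 0" using mI by simp
      show "?up g x < Suc k" if "x \<in> I" using weak_mapsD(1)[OF g that] that by simp
      show "?up g y \<le> ?up g x" if "(x, y) \<in> P" using weak_mapsD(3)[OF g that] fP[OF that] by simp
    qed simp
    show "?dn ` {f \<in> weak_maps I P (Suc k). f m \<noteq> 0} \<subseteq> weak_maps I P k"
    proof (intro image_subsetI weak_mapsI)
      fix f x y assume "f \<in> {f \<in> weak_maps I P (Suc k). f m \<noteq> 0}"
      then have f: "f \<in> weak_maps I P (Suc k)" and fm: "f m \<noteq> 0" by auto
      have pos: "f x \<noteq> 0" if "x \<in> I" for x using wm[OF f that] fm by simp
      show "?dn f x < k" if "x \<in> I" using weak_mapsD(1)[OF f that] pos[OF that] that by simp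
      show "?dn f y \<le> ?dn f x" if "(x, y) \<in> P" using weak_mapsD(3)[OF f that] fP[OF that] by simp
    qed simp
  qed
  then have 2: "card {f \<in> weak_maps I P (Suc k). f m \<noteq> 0} = card (weak_maps I P k)"
    by (simp add: bij_betw_same_card)
  \<comment> \<open>With value 0 on the top bubble, strictness forces positive values on
    \<open>A\<close>, and shifting them down leaves \<open>k\<close> values. In the weak case below,
    \<open>A\<close> keeps all \<open>Suc k\<close> values; this is the difference between the two
    recursions.\<close>
  let ?us = "\<lambda>g. \<lambda>x\<in>I. if x \<in> A then Suc (g x) else 0" and ?ds = "\<lambda>f. \<lambda>x\<in>A. f x - 1"
  have nA: "f x = 0" if "f m = 0" "f x \<le> f m" for f :: "'a \<Rightarrow> nat" and x using that by simp
  have "bij_betw ?us (strict_maps A (P \<inter> A \<times> A) k) {f \<in> strict_maps I P (Suc k). \<not> f m \<noteq> 0}"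
  proof (rule bij_betw_byWitness[where f' = ?ds])
    have pos: "f x \<noteq> 0" if "f \<in> strict_maps I P (Suc k)" "x \<in> A" for f x
      using strict_mapsD(4)[OF that(1) m[of x]] that(2) unfolding A by auto
    have zero: "f x = 0" if "f \<in> strict_maps I P (Suc k)" "f m = 0" "x \<in> I" "x \<notin> A" for f x
      using strict_mapsD(3)[OF that(1) top[OF mI]] that by fastforce
    show "\<forall>f\<in>strict_maps A (P \<inter> A \<times> A) k. ?ds (?us f) = f"
      using strict_mapsD(2) AI by (fastforce simp: fun_eq_iff restrict_def)
    show "\<forall>f\<in>{f \<in> strict_maps I P (Suc k). \<not> f m \<noteq> 0}. ?us (?ds f) = f"
    proof
      fix f assume "f \<in> {f \<in> strict_maps I P (Suc k). \<not> f m \<noteq> 0}"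
      then have f: "f \<in> strict_maps I P (Suc k)" and fm: "f m = 0" by auto
      show "?us (?ds f) = f"
      proof
        fix x show "?us (?ds f) x = f x"
          using strict_mapsD(2)[OF f, of x] pos[OF f, of x] zero[OF f fm, of x] AI
          by (cases "x \<in> I"; cases "x \<in> A") auto
      qed
    qed
    show "?us ` strict_maps A (P \<inter> A \<times> A) k \<subseteq> {f \<in> strict_maps I P (Suc k). \<not> f m \<noteq> 0}"
    proof (intro image_subsetI CollectI conjI strict_mapsI)
      fix g x y assume g: "g \<in> strict_maps A (P \<inter> A \<times> A) k"
      show "\<not> ?us g m \<noteq> 0" using mI preorder_reflD[OF P mI] unfolding A by simp
      show "?us g x < Suc k" if "x \<in> I" using strict_mapsD(1)[OF g] that by simp
      show "?us g y \<le> ?us g x" if "(x, y) \<in> P"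
        using strict_mapsD(3)[OF g, of x y] fP[OF that] Adown[OF that] that by auto
      show "?us g y < ?us g x" if "(x, y) \<in> P" "(y, x) \<notin> P"
      proof (cases "y \<in> A")
        case True then show ?thesis
          using strict_mapsD(4)[OF g, of x y] fP[OF that(1)] Adown[OF that(1)] that by auto
      next
        case False
        have "x \<in> A" using top[of y x] fP[OF that(1)] that by blast
        then show ?thesis using False fP[OF that(1)] by simp
      qed
    qed simp
    show "?ds ` {f \<in> strict_maps I P (Suc k). \<not> f m \<noteq> 0} \<subseteq> strict_maps A (P \<inter> A \<times> A) k"
    proof (intro image_subsetI strict_mapsI)
      fix f x y assume "f \<in> {f \<in> strict_maps I P (Suc k). \<not> f m \<noteq> 0}"
      then have f: "f \<in> strict_maps I P (Suc k)" by auto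
      show "?ds f x < k" if "x \<in> A" using strict_mapsD(1)[OF f, of x] pos[OF f that] that AI by auto
      show "?ds f y \<le> ?ds f x" if "(x, y) \<in> P \<inter> A \<times> A" using strict_mapsD(3)[OF f, of x y] that by auto
      show "?ds f y < ?ds f x" if "(x, y) \<in> P \<inter> A \<times> A" "(y, x) \<notin> P \<inter> A \<times> A"
        using strict_mapsD(4)[OF f, of x y] that pos[OF f, of y] by auto
    qed simp
  qed
  then have 3: "card {f \<in> strict_maps I P (Suc k). \<not> f m \<noteq> 0} = card (strict_maps A (P \<inter> A \<times> A) k)"
    by (simp only: bij_betw_same_card)
  let ?uw = "\<lambda>g. \<lambda>x\<in>I. if x \<in> A then g x else 0" and ?dw = "\<lambda>f. restrict f A"
  have "bij_betw ?uw (weak_maps A (P \<inter> A \<times> A) (Suc k)) {f \<in> weak_maps I P (Suc k). \<not> f m \<noteq> 0}"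
  proof (rule bij_betw_byWitness[where f' = ?dw])
    have zero: "f x = 0" if "f \<in> weak_maps I P (Suc k)" "f m = 0" "x \<in> I" "x \<notin> A" for f x
      using weak_mapsD(3)[OF that(1) top[OF mI]] that by fastforce
    show "\<forall>f\<in>weak_maps A (P \<inter> A \<times> A) (Suc k). ?dw (?uw f) = f"
      using weak_mapsD(2) AI by (fastforce simp: fun_eq_iff restrict_def)
    show "\<forall>f\<in>{f \<in> weak_maps I P (Suc k). \<not> f m \<noteq> 0}. ?uw (?dw f) = f"
    proof
      fix f assume "f \<in> {f \<in> weak_maps I P (Suc k). \<not> f m \<noteq> 0}"
      then have f: "f \<in> weak_maps I P (Suc k)" and fm: "f m = 0" by auto
      show "?uw (?dw f) = f"
      proof
        fix x show "?uw (?dw f) x = f x"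
          using weak_mapsD(2)[OF f, of x] zero[OF f fm, of x] AI
          by (cases "x \<in> I"; cases "x \<in> A") auto
      qed
    qed
    show "?uw ` weak_maps A (P \<inter> A \<times> A) (Suc k) \<subseteq> {f \<in> weak_maps I P (Suc k). \<not> f m \<noteq> 0}"
    proof (intro image_subsetI CollectI conjI weak_mapsI)
      fix g x y assume g: "g \<in> weak_maps A (P \<inter> A \<times> A) (Suc k)"
      show "\<not> ?uw g m \<noteq> 0" using mI preorder_reflD[OF P mI] unfolding A by simp
      show "?uw g x < Suc k" if "x \<in> I" using weak_mapsD(1)[OF g] that by simp
      show "?uw g y \<le> ?uw g x" if "(x, y) \<in> P"
        using weak_mapsD(3)[OF g, of x y] fP[OF that] Adown[OF that] that by auto
    qed simp
    show "?dw ` {f \<in> weak_maps I P (Suc k). \<not> f m \<noteq> 0} \<subseteq> weak_maps A (P \<inter> A \<times> A) (Suc k)"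
    proof (intro image_subsetI weak_mapsI)
      fix f x y assume "f \<in> {f \<in> weak_maps I P (Suc k). \<not> f m \<noteq> 0}"
      then have f: "f \<in> weak_maps I P (Suc k)" by auto
      show "?dw f x < Suc k" if "x \<in> A" using weak_mapsD(1)[OF f, of x] that AI by auto
      show "?dw f y \<le> ?dw f x" if "(x, y) \<in> P \<inter> A \<times> A" using weak_mapsD(3)[OF f, of x y] that by auto
    qed simp
  qed
  then have 4: "card {f \<in> weak_maps I P (Suc k). \<not> f m \<noteq> 0} = card (weak_maps A (P \<inter> A \<times> A) (Suc k))"
    by (simp only: bij_betw_same_card)
  show "card (strict_maps I P (Suc k)) = card (strict_maps I P k) + card (strict_maps A (P \<inter> A \<times> A) k)"
    using card_split[OF finite_strict_maps[OF I], of P "Suc k" "\<lambda>f. f m \<noteq> 0"] 1 3 by simp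
  show "card (weak_maps I P (Suc k)) = card (weak_maps I P k) + card (weak_maps A (P \<inter> A \<times> A) (Suc k))"
    using card_split[OF finite_weak_maps[OF I], of P "Suc k" "\<lambda>f. f m \<noteq> 0"] 2 4 by simp
qed

lemma bubbles_top:
  assumes P: "preorder_on I P" and mI: "m \<in> I" and m: "\<And>x. x \<in> I \<Longrightarrow> (x, m) \<in> P"
    and A: "A = {x \<in> I. (m, x) \<notin> P}"
  shows "bubbles I P = insert (I - A) (bubbles A (P \<inter> A \<times> A))" "I - A \<notin> bubbles A (P \<inter> A \<times> A)"
proof -
  have fP: "x \<in> I" "y \<in> I" if "(x, y) \<in> P" for x y using preorder_fieldD[OF P that] by auto
  have M: "(P \<inter> P\<inverse>) `` {x} = I - A" if "x \<in> I - A" for x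
    using that m preorder_transD[OF P] fP unfolding A by blast
  have cA: "(P \<inter> P\<inverse>) `` {x} = (P \<inter> A \<times> A \<inter> (P \<inter> A \<times> A)\<inverse>) `` {x}" if "x \<in> A" for x
    using that preorder_transD[OF P] fP unfolding A by blast
  have IA: "I = (I - A) \<union> A" using A by auto
  have mA: "m \<in> I - A" using mI preorder_reflD[OF P mI] A by auto
  have "bubbles I P = (\<lambda>x. (P \<inter> P\<inverse>) `` {x}) ` I" by (auto simp: bubbles_def quotient_def)
  also have "\<dots> = (\<lambda>x. (P \<inter> P\<inverse>) `` {x}) ` (I - A) \<union> (\<lambda>x. (P \<inter> P\<inverse>) `` {x}) ` A"
    using IA by (metis image_Un)
  also have "(\<lambda>x. (P \<inter> P\<inverse>) `` {x}) ` (I - A) = {I - A}" using M mA by blast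
  also have "(\<lambda>x. (P \<inter> P\<inverse>) `` {x}) ` A = (\<lambda>x. (P \<inter> A \<times> A \<inter> (P \<inter> A \<times> A)\<inverse>) `` {x}) ` A"
    using cA by (rule image_cong[OF refl])
  also have "\<dots> = bubbles A (P \<inter> A \<times> A)" by (auto simp: bubbles_def quotient_def)
  finally show "bubbles I P = insert (I - A) (bubbles A (P \<inter> A \<times> A))" by simp
  show "I - A \<notin> bubbles A (P \<inter> A \<times> A)"
    using mA unfolding bubbles_def quotient_def by blast
qed

text \<open>A total preorder is a chain of bubbles: strict maps correspond to subsets of the values,
  weak maps to multisets, and the two recursions are Pascal's rule at positive and at negative upper
  index. This is the base case of the reciprocity.\<close>

lemma total_preorder_counts:
  assumes "finite I" "preorder_on I P" "\<forall>x\<in>I. \<forall>y\<in>I. (x, y) \<in> P \<or> (y, x) \<in> P"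
  shows "real (card (strict_maps I P k)) = real k gchoose card (bubbles I P) \<and>
    (-1) ^ card (bubbles I P) * real (card (weak_maps I P k)) = (- real k) gchoose card (bubbles I P)"
  using assms
proof (induction "card I" arbitrary: I P k rule: less_induct)
  case less
  note I = less.prems(1) and P = less.prems(2) and tot = less.prems(3)
  have fP: "x \<in> I" "y \<in> I" if "(x, y) \<in> P" for x y using preorder_fieldD[OF P that] by auto
  show ?case
  proof (cases "I = {}")
    case True
    then have "strict_maps I P k = {\<lambda>_. undefined}" "weak_maps I P k = {\<lambda>_. undefined}" "bubbles I P = {}"
      using P by (auto simp: strict_maps_def weak_maps_def preorder_on_def bubbles_def)
    then show ?thesis by simp
  next
    case False
    \<comment> \<open>In a total preorder an element with the largest principal down-set is a
      greatest element.\<close>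
    define c where "c = (\<lambda>x. card {y. (y, x) \<in> P})"
    have "Max (c ` I) \<in> c ` I" using False I by simp
    then obtain m where mI: "m \<in> I" and "c m = Max (c ` I)" by auto
    then have mm: "card {y. (y, x) \<in> P} \<le> card {y. (y, m) \<in> P}" if "x \<in> I" for x
      using Max_ge[of "c ` I" "c x"] I that by (simp add: c_def)
    have m: "(x, m) \<in> P" if "x \<in> I" for x
    proof (rule ccontr)
      assume n: "(x, m) \<notin> P"
      then have "(m, x) \<in> P" using tot that mI by blast
      then have "{y. (y, m) \<in> P} \<subset> {y. (y, x) \<in> P}"
        using n preorder_transD[OF P] preorder_reflD[OF P that] by blast
      moreover have "finite {y. (y, x) \<in> P}" by (rule finite_subset[OF _ I]) (use fP in auto)
      ultimately show False using mm[OF that] psubset_card_mono leD by blast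
    qed
    define A where "A = {x \<in> I. (m, x) \<notin> P}"
    let ?P = "P \<inter> A \<times> A"
    have AI: "A \<subseteq> I" by (auto simp: A_def)
    have "m \<notin> A" using preorder_reflD[OF P mI] by (simp add: A_def)
    then have "A \<subset> I" using AI mI by blast
    then have cA: "card A < card I" using I psubset_card_mono by blast
    have finA: "finite A" using finite_subset[OF AI I] .
    have IH: "real (card (strict_maps A ?P k)) = real k gchoose card (bubbles A ?P) \<and>
       (-1) ^ card (bubbles A ?P) * real (card (weak_maps A ?P k)) = (- real k) gchoose card (bubbles A ?P)" for k
      by (rule less.hyps[OF cA finA preorder_on_restrict[OF P AI]]) (use tot AI in auto)
    have b: "card (bubbles I P) = Suc (card (bubbles A ?P))"
      using bubbles_top[OF P mI m A_def] bubbles_finite[OF finA preorder_on_restrict[OF P AI]] by simp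
    have e: "strict_maps I P 0 = {}" "weak_maps I P 0 = {}"
      using mI by (auto dest: strict_mapsD(1) weak_mapsD(1))
    note rs = card_strict_maps_Suc_top[OF I P mI m A_def] and rw = card_weak_maps_Suc_top[OF I P mI m A_def]
    let ?b = "card (bubbles A ?P)"
    have "real (card (strict_maps I P k)) = real k gchoose Suc ?b"
    proof (induction k)
      case (Suc k)
      have "real (Suc k) gchoose Suc ?b = (real k + 1) gchoose Suc ?b" by (simp add: add.commute)
      then show ?case using Suc IH[of k] rs[of k] by (simp add: gbinomial_Suc_Suc)
    qed (simp add: e)
    moreover have "(-1) ^ Suc ?b * real (card (weak_maps I P k)) = (- real k) gchoose Suc ?b"
    proof (induction k)
      case (Suc k)
      \<comment> \<open>Pascal's rule at upper index \<open>- Suc k\<close> produces the count for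
        \<open>A\<close> at \<open>Suc k\<close>, the one that occurs in
        \<open>card_weak_maps_Suc_top\<close>.\<close>
      have "(- real k) gchoose Suc ?b = (- real (Suc k) + 1) gchoose Suc ?b" by simp
      also have "\<dots> = ((- real (Suc k)) gchoose ?b) + ((- real (Suc k)) gchoose Suc ?b)"
        by (rule gbinomial_Suc_Suc)
      finally show ?case using Suc IH[of "Suc k"] rw[of k] by (simp add: algebra_simps)
    qed (simp add: e)
    ultimately show ?thesis using b by simp
  qed
qed

text \<open>For a preorder \<open>P\<close> with \<open>i\<close> and \<open>j\<close> in its
  carrier, this is the preorder generated by \<open>P\<close> and \<open>(i, j)\<close>: a chain
  using the new pair several times shortens to one use.\<close>

definition add_relation :: "'a rel \<Rightarrow> 'a \<Rightarrow> 'a \<Rightarrow> 'a rel" where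
  "add_relation P i j = P \<union> {(x, y). (x, i) \<in> P \<and> (j, y) \<in> P}"

lemma gbinomial_poly: "\<exists>p. \<forall>x::real. poly p x = x gchoose b"
proof
  show "\<forall>x::real. poly (smult (1 / fact b) (\<Prod>i = 0..<b. [:- real i, 1:])) x = x gchoose b"
    by (simp add: gbinomial_prod_rev poly_prod)
qed

lemma preorder_add_relation:
  assumes P: "preorder_on I P" and ij: "i \<in> I" "j \<in> I"
  shows "preorder_on I (add_relation P i j)"
  unfolding preorder_on_def
proof (intro conjI transI)
  show "add_relation P i j \<subseteq> I \<times> I" using preorder_fieldD[OF P] by (auto simp: add_relation_def)
  show "refl_on I (add_relation P i j)" using preorder_reflD[OF P] by (auto simp: add_relation_def refl_on_def)
  fix x y w assume "(x, y) \<in> add_relation P i j" "(y, w) \<in> add_relation P i j"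
  then show "(x, w) \<in> add_relation P i j"
    using preorder_transD[OF P] unfolding add_relation_def by blast
qed

text \<open>As \<open>j\<close> is not below \<open>i\<close>, the new pair closes no cycle. So
  resolving a pair strictly keeps the number of bubbles, hence the sign.\<close>

lemma add_relation_bubbles:
  assumes P: "preorder_on I P" and inc: "(j, i) \<notin> P"
  shows "bubbles I (add_relation P i j) = bubbles I P"
proof -
  have "add_relation P i j \<inter> (add_relation P i j)\<inverse> = P \<inter> P\<inverse>"
    using preorder_transD[OF P] inc unfolding add_relation_def by blast
  then show ?thesis by (simp add: bubbles_def)
qed

definition merge_relation :: "'a rel \<Rightarrow> 'a \<Rightarrow> 'a \<Rightarrow> 'a rel" where
  "merge_relation P i j = add_relation P i j \<union> add_relation P j i"

lemma preorder_merge_relation: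
  assumes P: "preorder_on I P" and ij: "i \<in> I" "j \<in> I"
  shows "preorder_on I (merge_relation P i j)"
  unfolding preorder_on_def
proof (intro conjI transI)
  show "merge_relation P i j \<subseteq> I \<times> I"
    using preorder_fieldD[OF P] by (auto simp: merge_relation_def add_relation_def)
  show "refl_on I (merge_relation P i j)"
    using preorder_reflD[OF P] by (auto simp: merge_relation_def add_relation_def refl_on_def)
  fix x y w assume "(x, y) \<in> merge_relation P i j" "(y, w) \<in> merge_relation P i j"
  then show "(x, w) \<in> merge_relation P i j"
    using preorder_transD[OF P] unfolding merge_relation_def add_relation_def by blast
qed

text \<open>Incomparability means that nothing lies between \<open>i\<close> and \<open>j\<close>;
  so identifying them unites their two bubbles and absorbs no third one.\<close>

lemma card_merge_relation_bubbles:
  assumes I: "finite I" and P: "preorder_on I P" and ij: "i \<in> I" "j \<in> I" and inc: "(i, j) \<notin> P" "(j, i) \<notin> P"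
  shows "card (bubbles I P) = Suc (card (bubbles I (merge_relation P i j)))"
proof -
  let ?E = "P \<inter> P\<inverse>" and ?M = "merge_relation P i j" let ?F = "?M \<inter> ?M\<inverse>"
  let ?c = "\<lambda>x. ?E `` {x}" and ?J = "I - (?E `` {i} \<union> ?E `` {j})"
  have t: "(x, w) \<in> P" if "(x, y) \<in> P" "(y, w) \<in> P" for x y w using preorder_transD[OF P that] .
  have r: "(i, i) \<in> P" "(j, j) \<in> P" using preorder_reflD[OF P] ij by auto
  have F: "(x, y) \<in> ?F \<longleftrightarrow> (x, y) \<in> ?E \<or> (i, x) \<in> ?E \<and> (j, y) \<in> ?E \<or> (j, x) \<in> ?E \<and> (i, y) \<in> ?E" for x y
    using t r inc unfolding merge_relation_def add_relation_def by blast
  have c1: "?F `` {x} = ?c x" if "x \<in> ?J" for x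
    using that F preorder_fieldD[OF P] by blast
  have eE: "equiv I ?E" by (rule preorder_bubble_equiv[OF P])
  have c2: "?F `` {x} = ?c i \<union> ?c j" if "x \<in> ?c i \<union> ?c j" for x
    using that F t inc by blast
  have im: "bubbles I R = (\<lambda>x. (R \<inter> R\<inverse>) `` {x}) ` I" for R :: "'a rel" by (auto simp: bubbles_def quotient_def)
  have sub: "?c i \<union> ?c j \<subseteq> I" "i \<in> ?c i" "j \<in> ?c j" using preorder_fieldD[OF P] r by auto
  have IJ: "I = ?J \<union> (?c i \<union> ?c j)" using sub by blast
  have "bubbles I ?M = (\<lambda>x. ?F `` {x}) ` ?J \<union> (\<lambda>x. ?F `` {x}) ` (?c i \<union> ?c j)"
    unfolding im using IJ by (metis image_Un)
  also have "(\<lambda>x. ?F `` {x}) ` ?J = ?c ` ?J" using c1 by (rule image_cong[OF refl])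
  also have "(\<lambda>x. ?F `` {x}) ` (?c i \<union> ?c j) = (\<lambda>x. ?c i \<union> ?c j) ` (?c i \<union> ?c j)"
    using c2 by (rule image_cong[OF refl])
  also have "\<dots> = {?c i \<union> ?c j}" using sub by auto
  finally have bM: "bubbles I ?M = insert (?c i \<union> ?c j) (?c ` ?J)" by simp
  have cc: "?c x = ?c i" if "x \<in> ?c i" for x using that equiv_class_eq[OF eE, of i x] by auto
  have cc': "?c x = ?c j" if "x \<in> ?c j" for x using that equiv_class_eq[OF eE, of j x] by auto
  have "bubbles I P = ?c ` ?J \<union> ?c ` (?c i \<union> ?c j)"
    unfolding im using IJ by (metis image_Un)
  also have "?c ` (?c i \<union> ?c j) = {?c i, ?c j}" using cc cc' sub(2,3) by blast
  finally have bP: "bubbles I P = insert (?c i) (insert (?c j) (?c ` ?J))" by auto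
  have self: "x \<in> ?c x" if "x \<in> I" for x using preorder_reflD[OF P that] by auto
  have "?c i \<notin> ?c ` ?J" "?c j \<notin> ?c ` ?J" "?c i \<union> ?c j \<notin> ?c ` ?J" using self by blast+
  moreover have "?c i \<noteq> ?c j" using sub(2,3) inc by blast
  moreover have "finite (?c ` ?J)" using I by auto
  ultimately show ?thesis unfolding bP bM by simp
qed

lemma strict_maps_add_relation:
  assumes P: "preorder_on I P" and ij: "i \<in> I" "j \<in> I" and inc: "(j, i) \<notin> P"
  shows "strict_maps I (add_relation P i j) k = {f \<in> strict_maps I P k. f j < f i}"
proof (intro set_eqI iffI)
  have r: "(i, i) \<in> P" "(j, j) \<in> P" using preorder_reflD[OF P] ij by auto
  \<comment> \<open>An old pair becomes symmetric only if it was so before, so the strictness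
    required on old pairs is unchanged.\<close>
  have sym: "(x, y) \<in> P \<Longrightarrow> (y, x) \<in> add_relation P i j \<Longrightarrow> (y, x) \<in> P" for x y
    using preorder_transD[OF P] inc unfolding add_relation_def by blast
  fix f
  { assume f: "f \<in> strict_maps I (add_relation P i j) k"
    have "(i, j) \<in> add_relation P i j" "(j, i) \<notin> add_relation P i j"
      using r inc by (auto simp: add_relation_def)
    then have "f j < f i" using strict_mapsD(4)[OF f] by blast
    moreover have "f \<in> strict_maps I P k"
    proof (rule strict_mapsI)
      fix x y assume xy: "(x, y) \<in> P"
      then have xy': "(x, y) \<in> add_relation P i j" by (simp add: add_relation_def)
      show "f y \<le> f x" using strict_mapsD(3)[OF f xy'] .
      show "f y < f x" if "(y, x) \<notin> P" using strict_mapsD(4)[OF f xy'] sym[OF xy] that by blast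
    qed (use strict_mapsD[OF f] in auto)
    ultimately show "f \<in> {f \<in> strict_maps I P k. f j < f i}" by simp }
  { assume "f \<in> {f \<in> strict_maps I P k. f j < f i}"
    then have f: "f \<in> strict_maps I P k" and lt: "f j < f i" by auto
    have new: "f y < f x" if "(x, i) \<in> P" "(j, y) \<in> P" for x y
      using strict_mapsD(3)[OF f that(1)] strict_mapsD(3)[OF f that(2)] lt by simp
    show "f \<in> strict_maps I (add_relation P i j) k"
    proof (rule strict_mapsI)
      fix x y assume xy: "(x, y) \<in> add_relation P i j"
      show "f y \<le> f x" using xy new[of x y] strict_mapsD(3)[OF f] by (force simp: add_relation_def)
      show "f y < f x" if "(y, x) \<notin> add_relation P i j"
        using xy that new[of x y] strict_mapsD(4)[OF f, of x y] by (auto simp: add_relation_def)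
    qed (use strict_mapsD[OF f] in auto) }
qed

lemma strict_maps_merge_relation:
  assumes P: "preorder_on I P" and ij: "i \<in> I" "j \<in> I" and inc: "(i, j) \<notin> P" "(j, i) \<notin> P"
  shows "strict_maps I (merge_relation P i j) k = {f \<in> strict_maps I P k. f i = f j}"
proof (intro set_eqI iffI)
  have r: "(i, i) \<in> P" "(j, j) \<in> P" using preorder_reflD[OF P] ij by auto
  have sym: "(x, y) \<in> P \<Longrightarrow> (y, x) \<in> merge_relation P i j \<Longrightarrow> (y, x) \<in> P" for x y
    using preorder_transD[OF P] inc unfolding merge_relation_def add_relation_def by blast
  fix f
  { assume f: "f \<in> strict_maps I (merge_relation P i j) k"
    have "(i, j) \<in> merge_relation P i j" "(j, i) \<in> merge_relation P i j"
      using r by (auto simp: merge_relation_def add_relation_def)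
    then have "f i = f j" using strict_mapsD(3)[OF f] by (meson antisym)
    moreover have "f \<in> strict_maps I P k"
    proof (rule strict_mapsI)
      fix x y assume xy: "(x, y) \<in> P"
      then have xy': "(x, y) \<in> merge_relation P i j" by (simp add: merge_relation_def add_relation_def)
      show "f y \<le> f x" using strict_mapsD(3)[OF f xy'] .
      show "f y < f x" if "(y, x) \<notin> P" using strict_mapsD(4)[OF f xy'] sym[OF xy] that by blast
    qed (use strict_mapsD[OF f] in auto)
    ultimately show "f \<in> {f \<in> strict_maps I P k. f i = f j}" by simp }
  { assume "f \<in> {f \<in> strict_maps I P k. f i = f j}"
    then have f: "f \<in> strict_maps I P k" and eq: "f i = f j" by auto
    \<comment> \<open>A new comparability passes through \<open>i\<close> and \<open>j\<close>,
      whose values agree. If both outer steps are reversible, the pair is symmetric in the merged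
      preorder; otherwise one of them is strict.\<close>
    have new: "f y \<le> f x \<and> ((y, x) \<in> merge_relation P i j \<or> f y < f x)"
      if a: "(x, a) \<in> P" "(b, y) \<in> P" and ab: "a = i \<and> b = j \<or> a = j \<and> b = i" for x y a b
    proof -
      have le: "f a \<le> f x" "f y \<le> f b" "f a = f b"
        using strict_mapsD(3)[OF f a(1)] strict_mapsD(3)[OF f a(2)] ab eq by auto
      show ?thesis
      proof (cases "(a, x) \<in> P \<and> (y, b) \<in> P")
        case True
        then have "(y, x) \<in> merge_relation P i j" using ab by (auto simp: merge_relation_def add_relation_def)
        then show ?thesis using le by simp
      next
        case False
        then have "f a < f x \<or> f y < f b" using strict_mapsD(4)[OF f a(1)] strict_mapsD(4)[OF f a(2)] by blast
        then show ?thesis using le by auto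
      qed
    qed
    have old: "f y \<le> f x \<and> ((y, x) \<in> merge_relation P i j \<or> f y < f x)" if "(x, y) \<in> P" for x y
      using strict_mapsD(3,4)[OF f that] by (auto simp: merge_relation_def add_relation_def)
    have all: "f y \<le> f x \<and> ((y, x) \<in> merge_relation P i j \<or> f y < f x)" if "(x, y) \<in> merge_relation P i j" for x y
      using that new[of x i j y] new[of x j i y] old[of x y]
      unfolding merge_relation_def add_relation_def by blast
    show "f \<in> strict_maps I (merge_relation P i j) k"
      by (rule strict_mapsI) (use strict_mapsD(1,2)[OF f] all in auto) }
qed

lemma weak_maps_add_relation:
  assumes P: "preorder_on I P" and ij: "i \<in> I" "j \<in> I"
  shows "weak_maps I (add_relation P i j) k = {f \<in> weak_maps I P k. f j \<le> f i}"
proof (intro set_eqI iffI)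
  fix f
  { assume f: "f \<in> weak_maps I (add_relation P i j) k"
    have "(i, j) \<in> add_relation P i j"
      using preorder_reflD[OF P] ij by (auto simp: add_relation_def)
    then have "f j \<le> f i" by (rule weak_mapsD(3)[OF f])
    moreover have "f \<in> weak_maps I P k"
      by (rule weak_mapsI) (use weak_mapsD[OF f] in \<open>auto simp: add_relation_def\<close>)
    ultimately show "f \<in> {f \<in> weak_maps I P k. f j \<le> f i}" by simp }
  { assume "f \<in> {f \<in> weak_maps I P k. f j \<le> f i}"
    then have f: "f \<in> weak_maps I P k" and le: "f j \<le> f i" by auto
    have "f y \<le> f x" if "(x, y) \<in> add_relation P i j" for x y
      using that weak_mapsD(3)[OF f, of x y] weak_mapsD(3)[OF f, of x i] weak_mapsD(3)[OF f, of j y] le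
      by (auto simp: add_relation_def)
    then show "f \<in> weak_maps I (add_relation P i j) k"
      by (intro weak_mapsI) (use weak_mapsD[OF f] in auto) }
qed

lemma weak_maps_merge_relation:
  assumes P: "preorder_on I P" and ij: "i \<in> I" "j \<in> I"
  shows "weak_maps I (merge_relation P i j) k = {f \<in> weak_maps I P k. f i = f j}"
proof -
  have "weak_maps I (merge_relation P i j) k = weak_maps I (add_relation P i j) k \<inter> weak_maps I (add_relation P j i) k"
    unfolding weak_maps_def merge_relation_def by auto
  then show ?thesis unfolding weak_maps_add_relation[OF P ij] weak_maps_add_relation[OF P ij(2,1)]
    by (intro set_eqI iffI) (auto intro: order_antisym)
qed

text \<open>Induction on the number of incomparable pairs: a pair \<open>i\<close>, \<open>j\<close> is resolved into \<open>i < j\<close>,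
  \<open>j < i\<close> and \<open>i \<sim> j\<close>, and total preorders are counted by binomial coefficients.\<close>

lemma order_polynomial_reciprocity:
  assumes "finite I" "preorder_on I P"
  shows "\<exists>p. \<forall>k. poly p (real k) = real (card (strict_maps I P k)) \<and>
    poly p (- real k) = (-1) ^ card (bubbles I P) * real (card (weak_maps I P k))"
  using assms
proof (induction "card {(x, y). x \<in> I \<and> y \<in> I \<and> (x, y) \<notin> P \<and> (y, x) \<notin> P}" arbitrary: P rule: less_induct)
  case less
  note I = less.prems(1) and P = less.prems(2)
  show ?case
  proof (cases "\<forall>x\<in>I. \<forall>y\<in>I. (x, y) \<in> P \<or> (y, x) \<in> P")
    case True
    obtain p where "\<forall>x::real. poly p x = x gchoose card (bubbles I P)" using gbinomial_poly by blast
    then have "\<forall>k. poly p (real k) = real (card (strict_maps I P k)) \<and>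
      poly p (- real k) = (-1) ^ card (bubbles I P) * real (card (weak_maps I P k))"
      using total_preorder_counts[OF I P True] by simp
    then show ?thesis by blast
  next
    case False
    then obtain i j where ij: "i \<in> I" "j \<in> I" "(i, j) \<notin> P" "(j, i) \<notin> P" by blast
    let ?inc = "\<lambda>P. {(x, y). x \<in> I \<and> y \<in> I \<and> (x, y) \<notin> P \<and> (y, x) \<notin> P}"
    have lt: "card (?inc R) < card (?inc P)" if R: "P \<subseteq> R" "(i, j) \<in> R \<or> (j, i) \<in> R" for R
    proof (rule psubset_card_mono)
      show "finite (?inc P)" by (rule finite_subset[of _ "I \<times> I"]) (use I in auto)
      have "(i, j) \<in> ?inc P" "(i, j) \<notin> ?inc R" using ij R(2) by auto
      moreover have "?inc R \<subseteq> ?inc P" using R(1) by auto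
      ultimately show "?inc R \<subset> ?inc P" by blast
    qed
    have r: "(i, i) \<in> P" "(j, j) \<in> P" using preorder_reflD[OF P] ij by auto
    have n: "P \<subseteq> add_relation P i j" "(i, j) \<in> add_relation P i j" "P \<subseteq> add_relation P j i" "(j, i) \<in> add_relation P j i"
      "P \<subseteq> merge_relation P i j" "(i, j) \<in> merge_relation P i j"
      using r by (auto simp: merge_relation_def add_relation_def)
    let ?b = "card (bubbles I P)"
    obtain p1 where p1: "\<And>k. poly p1 (real k) = real (card (strict_maps I (add_relation P i j) k))"
      "\<And>k. poly p1 (- real k) = (-1) ^ ?b * real (card (weak_maps I (add_relation P i j) k))"
      using less.hyps[OF lt I preorder_add_relation[OF P ij(1,2)]] n
      unfolding add_relation_bubbles[OF P ij(4)] by blast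
    obtain p2 where p2: "\<And>k. poly p2 (real k) = real (card (strict_maps I (add_relation P j i) k))"
      "\<And>k. poly p2 (- real k) = (-1) ^ ?b * real (card (weak_maps I (add_relation P j i) k))"
      using less.hyps[OF lt I preorder_add_relation[OF P ij(2,1)]] n
      unfolding add_relation_bubbles[OF P ij(3)] by blast
    let ?b' = "card (bubbles I (merge_relation P i j))"
    obtain p3 where p3: "\<And>k. poly p3 (real k) = real (card (strict_maps I (merge_relation P i j) k))"
      "\<And>k. poly p3 (- real k) = (-1) ^ ?b' * real (card (weak_maps I (merge_relation P i j) k))"
      using less.hyps[OF lt I preorder_merge_relation[OF P ij(1,2)]] n by blast
    have b: "?b = Suc ?b'" by (rule card_merge_relation_bubbles[OF I P ij])
    have s: "card (strict_maps I P k) = card (strict_maps I (add_relation P i j) k) +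
        card (strict_maps I (add_relation P j i) k) + card (strict_maps I (merge_relation P i j) k)" for k
    proof -
      have "card (strict_maps I P k) = card {f \<in> strict_maps I P k. f j < f i} + card {f \<in> strict_maps I P k. \<not> f j < f i}"
        by (rule card_split[OF finite_strict_maps[OF I]])
      also have "card {f \<in> strict_maps I P k. \<not> f j < f i} = card {f \<in> {f \<in> strict_maps I P k. \<not> f j < f i}. f i < f j} +
         card {f \<in> {f \<in> strict_maps I P k. \<not> f j < f i}. \<not> f i < f j}"
        by (rule card_split) (use finite_strict_maps[OF I] in simp)
      also have "{f \<in> {f \<in> strict_maps I P k. \<not> f j < f i}. f i < f j} = {f \<in> strict_maps I P k. f i < f j}" by auto
      also have "{f \<in> {f \<in> strict_maps I P k. \<not> f j < f i}. \<not> f i < f j} = {f \<in> strict_maps I P k. f i = f j}" by auto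
      finally show ?thesis
        unfolding strict_maps_add_relation[OF P ij(1,2,4)] strict_maps_add_relation[OF P ij(2,1,3)]
          strict_maps_merge_relation[OF P ij] by simp
    qed
    \<comment> \<open>Weak maps with \<open>f i = f j\<close> satisfy both inequalities, so the
      merged term enters with a minus sign; this is compensated by the sign of the bubble lost in
      merging.\<close>
    have w: "card (weak_maps I P k) + card (weak_maps I (merge_relation P i j) k) =
        card (weak_maps I (add_relation P i j) k) + card (weak_maps I (add_relation P j i) k)" for k
    proof -
      let ?X = "{f \<in> weak_maps I P k. f j \<le> f i}" and ?Y = "{f \<in> weak_maps I P k. f i \<le> f j}"
      have "card ?X + card ?Y = card (?X \<union> ?Y) + card (?X \<inter> ?Y)"
        by (rule card_Un_Int) (use finite_weak_maps[OF I] in auto)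
      moreover have "?X \<union> ?Y = weak_maps I P k" "?X \<inter> ?Y = {f \<in> weak_maps I P k. f i = f j}" by auto
      ultimately show ?thesis
        unfolding weak_maps_add_relation[OF P ij(1,2)] weak_maps_add_relation[OF P ij(2,1)]
          weak_maps_merge_relation[OF P ij(1,2)] by simp
    qed
    have "poly (p1 + p2 + p3) (real k) = real (card (strict_maps I P k)) \<and>
       poly (p1 + p2 + p3) (- real k) = (-1) ^ ?b * real (card (weak_maps I P k))" for k
    proof -
      have wr: "real (card (weak_maps I P k)) = real (card (weak_maps I (add_relation P i j) k)) +
         real (card (weak_maps I (add_relation P j i) k)) - real (card (weak_maps I (merge_relation P i j) k))"
        using w[of k] by linarith
      show ?thesis unfolding poly_add p1 p2 p3 s b wr by (simp add: algebra_simps)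
    qed
    then show ?thesis by (intro exI[of _ "p1 + p2 + p3"] allI)
  qed
qed

section \<open>Order polynomials and isomorphism classes\<close>

text \<open>The general coefficient ring matters: \<open>tensor_eqI\<close> uses this both for
  polynomials over \<open>real\<close> and for polynomials over \<open>real poly\<close>.\<close>

lemma poly_eqI_nat:
  fixes p q :: "'a::{idom, ring_char_0} poly"
  assumes "\<And>k::nat. k > 0 \<Longrightarrow> poly p (of_nat k) = poly q (of_nat k)"
  shows "p = q"
proof (rule ccontr)
  assume "p \<noteq> q"
  then have "finite {x. poly (p - q) x = 0}" by (intro poly_roots_finite) simp
  moreover have "of_nat ` {k. k > 0} \<subseteq> {x. poly (p - q) x = 0}" using assms by auto
  ultimately have "finite ((of_nat :: nat \<Rightarrow> 'a) ` {k. k > 0})" by (rule rev_finite_subset)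
  then have "finite {k::nat. k > 0}" by (rule finite_imageD) (simp add: inj_on_def)
  then show False using infinite_Ioi[of "0::nat"] by (simp add: greaterThan_def)
qed

definition ord_poly :: "'a set \<Rightarrow> 'a rel \<Rightarrow> real poly" where
  "ord_poly I P = (SOME p. \<forall>k. poly p (real k) = real (card (strict_maps I P k)) \<and>
    poly p (- real k) = (-1) ^ card (bubbles I P) * real (card (weak_maps I P k)))"

lemma poly_ord_poly:
  assumes "finite I" "preorder_on I P"
  shows "poly (ord_poly I P) (real k) = real (card (strict_maps I P k))"
    "poly (ord_poly I P) (- real k) = (-1) ^ card (bubbles I P) * real (card (weak_maps I P k))"
  using someI_ex[OF order_polynomial_reciprocity[OF assms]] unfolding ord_poly_def by blast+

lemma ord_poly_image:
  assumes I: "finite I" and f: "inj_on f I" and P: "preorder_on I P"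
  shows "ord_poly (f ` I) (map_prod f f ` P) = ord_poly I P"
proof (rule poly_eqI_nat)
  have sub: "P \<subseteq> I \<times> I" using P by (simp add: preorder_on_def)
  fix k :: nat
  show "poly (ord_poly (f ` I) (map_prod f f ` P)) (of_nat k) = poly (ord_poly I P) (of_nat k)"
    using I P by (simp add: poly_ord_poly preorder_on_image[OF f sub] card_strict_maps_image[OF f sub])
qed

section \<open>Isomorphism classes and their representatives\<close>

lemma relabel_relabel: "relabel g (f ` I) (relabel f I z) = relabel (g \<circ> f) I z"
proof
  fix B
  show "relabel g (f ` I) (relabel f I z) B = relabel (g \<circ> f) I z B"
  proof (cases "B \<subseteq> g ` f ` I")
    case True
    have "{i \<in> I. f i \<in> {j \<in> f ` I. g j \<in> B}} = {i \<in> I. g (f i) \<in> B}" by auto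
    then show ?thesis using True by (simp add: relabel_def image_comp)
  qed (simp add: relabel_def image_comp)
qed

lemma relabel_cong:
  assumes "\<And>i. i \<in> I \<Longrightarrow> f i = g i"
  shows "relabel f I z = relabel g I z"
proof -
  have "f ` I = g ` I" "{i \<in> I. f i \<in> B} = {i \<in> I. g i \<in> B}" for B using assms by auto
  then show ?thesis by (simp add: relabel_def)
qed

lemma relabel_id: "z \<in> extensional (Pow I) \<Longrightarrow> (\<And>i. i \<in> I \<Longrightarrow> f i = i) \<Longrightarrow> relabel f I z = z"
proof -
  assume z: "z \<in> extensional (Pow I)" and f: "\<And>i. i \<in> I \<Longrightarrow> f i = i"
  have "relabel f I z = relabel (\<lambda>i. i) I z" by (rule relabel_cong) (rule f)
  also have "\<dots> = z"
  proof
    fix B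
    have "B \<subseteq> I \<Longrightarrow> {i \<in> I. i \<in> B} = B" by auto
    then show "relabel (\<lambda>i. i) I z B = z B" using z by (auto simp: relabel_def extensional_def)
  qed
  finally show ?thesis .
qed

lemma iso_class_relabel:
  assumes f: "inj_on f I"
  shows "iso_class (f ` I) (relabel f I z) = iso_class I z"
proof -
  have c: "card (f ` I) = card I" by (rule card_image[OF f])
  have 1: "bij_betw (g \<circ> f) I {1..card I}" if "bij_betw g (f ` I) {1..card I}" for g
    by (rule bij_betw_trans[OF bij_betw_imageI[OF f refl] that])
  have 2: "\<exists>g. bij_betw g (f ` I) {1..card I} \<and> relabel h I z = relabel (g \<circ> f) I z" if h: "bij_betw h I {1..card I}" for h
  proof (intro exI conjI)
    have "bij_betw (inv_into I f) (f ` I) I" using f by (intro bij_betw_inv_into bij_betw_imageI) auto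
    then show "bij_betw (h \<circ> inv_into I f) (f ` I) {1..card I}" using h by (rule bij_betw_trans)
    show "relabel h I z = relabel (h \<circ> inv_into I f \<circ> f) I z"
      by (rule relabel_cong) (use f in simp)
  qed
  show ?thesis
    unfolding iso_class_def c relabel_relabel using 1 2 by blast
qed

lemma ex_bij_numbering:
  assumes "finite I" obtains f where "bij_betw f I {1..card I}"
  using assms by (metis bij_betw_iff_card card_atLeastAtMost diff_Suc_1 finite_atLeastAtMost)

text \<open>Equal orbits share a numbered function; one numbering followed by the inverse of the
  other is the isomorphism.\<close>

lemma iso_class_eqD:
  assumes fin: "finite I" "finite J" and v: "v \<in> extensional (Pow J)" and eq: "iso_class I u = iso_class J v"
  obtains f where "bij_betw f I J" "v = relabel f I u"
proof -
  obtain g where g: "bij_betw g I {1..card I}" using ex_bij_numbering[OF fin(1)] .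
  have "(card I, relabel g I u) \<in> iso_class I u" unfolding iso_class_def using g by blast
  then have "(card I, relabel g I u) \<in> iso_class J v" unfolding eq .
  then obtain h where h: "bij_betw h J {1..card J}" "card I = card J" "relabel g I u = relabel h J v"
    unfolding iso_class_def by blast
  let ?h = "inv_into J h"
  have gI: "g ` I = {1..card J}" and hJ: "h ` J = {1..card J}" using g h by (auto simp: bij_betw_def)
  have "relabel (?h \<circ> g) I u = relabel ?h (g ` I) (relabel g I u)" by (simp add: relabel_relabel)
  also have "\<dots> = relabel ?h (h ` J) (relabel h J v)" using h gI hJ by simp
  also have "\<dots> = relabel (?h \<circ> h) J v" by (rule relabel_relabel)
  also have "\<dots> = v" by (rule relabel_id[OF v]) (use h(1) in \<open>auto simp: bij_betw_def\<close>)
  finally have "v = relabel (?h \<circ> g) I u" by simp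
  moreover have "bij_betw (?h \<circ> g) I J"
    using bij_betw_trans[OF g] bij_betw_inv_into[OF h(1)] h(2) by metis
  ultimately show ?thesis using that by blast
qed

lemma submodular_extensional: "submodular I z \<Longrightarrow> z \<in> extensional (Pow I)"
  by (simp add: submodular_def)


lemma iso_class_numbered:
  assumes I: "finite I"
  obtains f where "bij_betw f I {1..card I}" "iso_class I z = iso_class {1..card I} (relabel f I z)"
    "submodular I z \<Longrightarrow> submodular {1..card I} (relabel f I z)"
    "modular I z \<Longrightarrow> modular {1..card I} (relabel f I z)"
proof -
  obtain f where f: "bij_betw f I {1..card I}" using ex_bij_numbering[OF I] .
  then have "inj_on f I" "f ` I = {1..card I}" by (auto simp: bij_betw_def)
  then show ?thesis
    using that[OF f] iso_class_relabel[of f I z] modular_relabel[of f I z] submodular_relabel[of f I z] by auto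
qed

text \<open>The choice in \<open>mod_rep\<close> returns some relabelling of the original function,
  which is enough because order polynomials are invariant under relabelling.\<close>

lemma mod_rep_cls:
  assumes I: "finite I" and m: "modular I z"
  obtains f n where "mod_rep (mod_cls I z) = (n, relabel f I z)" "bij_betw f I {1..n}"
proof -
  obtain g where g: "iso_class I z = iso_class {1..card I} (relabel g I z)" "modular {1..card I} (relabel g I z)"
    using iso_class_numbered[OF I, of z] m by metis
  then have "mod_cls {1..card I} (relabel g I z) = mod_cls I z" by (simp add: mod_cls_def)
  then have ex: "\<exists>p. case p of (n::nat, u) \<Rightarrow> modular {1..n} u \<and> mod_cls {1..n} u = mod_cls I z"
    using g(2) by (intro exI[of _ "(card I, relabel g I z)"]) auto
  obtain n u where nu: "mod_rep (mod_cls I z) = (n, u)" by force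
  then have u: "modular {1..n} u" "mod_cls {1..n} u = mod_cls I z"
    using someI_ex[OF ex] unfolding mod_rep_def by auto
  have "iso_class {1..n} u = iso_class I z"
  proof (rule Abs_mod_class_inject[THEN iffD1])
    show "Abs_mod_class (iso_class {1..n} u) = Abs_mod_class (iso_class I z)"
      using u(2) by (simp add: mod_cls_def)
  qed (use u(1) g in blast)+
  then obtain f where "bij_betw f I {1..n}" "u = relabel f I z"
    using iso_class_eqD[OF I _ submodular_extensional[OF modular_submodular[OF u(1)]]] by (metis finite_atLeastAtMost)
  then show ?thesis using that nu by blast
qed

lemma sm_rep_cls:
  assumes I: "finite I" and m: "submodular I z"
  obtains f n where "sm_rep (sm_cls I z) = (n, relabel f I z)" "bij_betw f I {1..n}"
proof -
  obtain g where g: "iso_class I z = iso_class {1..card I} (relabel g I z)" "submodular {1..card I} (relabel g I z)"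
    using iso_class_numbered[OF I, of z] m by metis
  then have "sm_cls {1..card I} (relabel g I z) = sm_cls I z" by (simp add: sm_cls_def)
  then have ex: "\<exists>p. case p of (n::nat, u) \<Rightarrow> submodular {1..n} u \<and> sm_cls {1..n} u = sm_cls I z"
    using g(2) by (intro exI[of _ "(card I, relabel g I z)"]) auto
  obtain n u where nu: "sm_rep (sm_cls I z) = (n, u)" by force
  then have u: "submodular {1..n} u" "sm_cls {1..n} u = sm_cls I z"
    using someI_ex[OF ex] unfolding sm_rep_def by auto
  have "iso_class {1..n} u = iso_class I z"
  proof (rule Abs_sm_class_inject[THEN iffD1])
    show "Abs_sm_class (iso_class {1..n} u) = Abs_sm_class (iso_class I z)"
      using u(2) by (simp add: sm_cls_def)
  qed (use u(1) g in blast)+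
  then obtain f where "bij_betw f I {1..n}" "u = relabel f I z"
    using iso_class_eqD[OF I _ submodular_extensional[OF u(1)]] by (metis finite_atLeastAtMost)
  then show ?thesis using that nu by blast
qed

lemma mod_rep_modular: "mod_rep c = (n, z) \<Longrightarrow> modular {1..n} z"
proof -
  assume c: "mod_rep c = (n, z)"
  obtain y where "c = Abs_mod_class y" "y \<in> {iso_class {1..n} z | (n::nat) z. modular {1..n} z}"
    by (rule Abs_mod_class_cases)
  then obtain m :: nat and u where "modular {1..m} u" "c = Abs_mod_class (iso_class {1..m} u)" by blast
  then have "\<exists>p. case p of (n::nat, u) \<Rightarrow> modular {1..n} u \<and> mod_cls {1..n} u = c"
    by (auto simp: mod_cls_def)
  from someI_ex[OF this] show ?thesis using c unfolding mod_rep_def by auto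
qed

text \<open>The value that \<theta> will be shown to have on a basis element. It sees only which
  sets have finite value, not the finite values.\<close>

definition class_poly :: "mod_class \<Rightarrow> real poly" where
  "class_poly c = (case mod_rep c of (n, z) \<Rightarrow> ord_poly {1..n} (pre {1..n} z))"

lemma class_poly_cls:
  assumes I: "finite I" and m: "modular I z"
  shows "class_poly (mod_cls I z) = ord_poly I (pre I z)"
proof -
  obtain f n where f: "mod_rep (mod_cls I z) = (n, relabel f I z)" "bij_betw f I {1..n}"
    using mod_rep_cls[OF assms] .
  have inj: "inj_on f I" and im: "{1..n} = f ` I" using f(2) by (auto simp: bij_betw_def)
  have "class_poly (mod_cls I z) = ord_poly (f ` I) (pre (f ` I) (relabel f I z))"
    by (simp only: class_poly_def f(1) prod.case im)
  also have "\<dots> = ord_poly I (pre I z)"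
    using pre_submodular(1)[OF I modular_submodular[OF m]]
    by (simp add: pre_relabel[OF I inj modular_submodular[OF m]] ord_poly_image[OF I inj])
  finally show ?thesis .
qed

section \<open>The morphism to polynomials\<close>

lemma lookup_scaleR: "Poly_Mapping.lookup (r *\<^sub>R x) b = r *\<^sub>R Poly_Mapping.lookup x b"
proof -
  have "finite {b. r *\<^sub>R Poly_Mapping.lookup x b \<noteq> 0}"
    by (rule finite_subset[OF _ finite_keys[of x]]) (auto simp: in_keys_iff)
  then show ?thesis by (simp add: scaleR_poly_mapping_def Abs_poly_mapping_inverse)
qed

lemma linear_ext_superset:
  assumes "finite S" "Poly_Mapping.keys u \<subseteq> S"
  shows "linear_ext f u = (\<Sum>b\<in>S. Poly_Mapping.lookup u b *\<^sub>R f b)"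
  unfolding linear_ext_def
  by (rule sum.mono_neutral_left[OF assms]) (auto simp: in_keys_iff)

lemma linear_linear_ext:
  fixes f :: "'b \<Rightarrow> 'v::real_vector"
  shows "linear (linear_ext f)"
proof (rule linearI)
  fix u v :: "'b \<Rightarrow>\<^sub>0 real"
  let ?S = "Poly_Mapping.keys u \<union> Poly_Mapping.keys v"
  have "linear_ext f (u + v) = (\<Sum>b\<in>?S. Poly_Mapping.lookup (u + v) b *\<^sub>R f b)"
    by (rule linear_ext_superset) (use keys_add[of u v] in auto)
  also have "\<dots> = (\<Sum>b\<in>?S. Poly_Mapping.lookup u b *\<^sub>R f b) + (\<Sum>b\<in>?S. Poly_Mapping.lookup v b *\<^sub>R f b)"
    by (simp add: lookup_add scaleR_add_left sum.distrib)
  also have "\<dots> = linear_ext f u + linear_ext f v"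
    by (simp add: linear_ext_superset[of ?S])
  finally show "linear_ext f (u + v) = linear_ext f u + linear_ext f v" .
next
  fix r :: real and u :: "'b \<Rightarrow>\<^sub>0 real"
  have "linear_ext f (r *\<^sub>R u) = (\<Sum>b\<in>Poly_Mapping.keys u. Poly_Mapping.lookup (r *\<^sub>R u) b *\<^sub>R f b)"
    by (rule linear_ext_superset) (auto simp: in_keys_iff lookup_scaleR)
  then show "linear_ext f (r *\<^sub>R u) = r *\<^sub>R linear_ext f u"
    by (simp add: linear_ext_def lookup_scaleR scaleR_sum_right)
qed

lemma linear_ext_basis_vec [simp]: "linear_ext f (basis_vec b) = f b"
  by (simp add: linear_ext_def basis_vec_def)

lemma linear_ext_comp:
  assumes "linear g"
  shows "g (linear_ext h x) = linear_ext (\<lambda>b. g (h b)) x"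
  by (simp add: linear_ext_def linear_sum[OF assms] linear_scale[OF assms])

lemma linear_ext_sum: "linear_ext f (\<Sum>i\<in>S. u i) = (\<Sum>i\<in>S. linear_ext f (u i))"
  by (rule linear_sum[OF linear_linear_ext])

lemma linear_ext_0 [simp]: "linear_ext f 0 = 0"
  by (simp add: linear_ext_def)

section \<open>Evaluation of tensors of polynomials\<close>

text \<open>The outer variable carries the second tensor factor, so it is evaluated first, at
  \<open>b\<close>. Evaluations at pairs of positive integers separate tensors, which turns
  coproduct identities into identities between counts.\<close>

definition tensor_eval :: "real \<Rightarrow> real \<Rightarrow> real poly poly \<Rightarrow> real" where
  "tensor_eval a b w = poly (poly w [:b:]) a"

lemma tensor_eval_poly_tensor: "tensor_eval a b (poly_tensor p q) = poly p a * poly q b"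
proof -
  have "poly (map_poly (\<lambda>a. [:a:]) q) [:b:] = [:poly q b:]"
    by (induction q) (auto simp: map_poly_pCons)
  then show ?thesis by (simp add: tensor_eval_def poly_tensor_def)
qed

lemma tensor_eval_poly_subst: "tensor_eval a b (poly_subst t p) = poly p (tensor_eval a b t)"
  unfolding tensor_eval_def poly_subst_def
  by (induction p) (auto simp: map_poly_pCons)

lemma tensor_eval_poly_Delta: "tensor_eval a b (poly_Delta p) = poly p (a + b)"
proof -
  have "tensor_eval a b (poly_tensor 1 poly_X + poly_tensor poly_X 1) = a + b"
    using tensor_eval_poly_tensor[of a b 1 poly_X] tensor_eval_poly_tensor[of a b poly_X 1]
    by (simp add: tensor_eval_def poly_X_def)
  then show ?thesis by (simp add: poly_Delta_def tensor_eval_poly_subst)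
qed

lemma tensor_eval_poly_delta: "tensor_eval a b (poly_delta p) = poly p (a * b)"
  by (simp add: poly_delta_def tensor_eval_poly_subst tensor_eval_poly_tensor poly_X_def)

lemma tensor_eval_tensor_map:
  "tensor_eval a b (tensor_map f w) =
    linear_ext (\<lambda>(c, d). poly (f (basis_vec c)) a * poly (f (basis_vec d)) b) w"
proof -
  have "tensor_eval a b (tensor_map f w) = (\<Sum>p\<in>Poly_Mapping.keys w.
     tensor_eval a b (case p of (c, d) \<Rightarrow> smult [:Poly_Mapping.lookup w (c, d):] (poly_tensor (f (basis_vec c)) (f (basis_vec d)))))"
    unfolding tensor_map_def tensor_eval_def by (simp add: poly_sum)
  also have "\<dots> = (\<Sum>p\<in>Poly_Mapping.keys w. Poly_Mapping.lookup w p *\<^sub>R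
      (case p of (c, d) \<Rightarrow> poly (f (basis_vec c)) a * poly (f (basis_vec d)) b))"
  proof (rule sum.cong[OF refl])
    fix p :: "mod_class \<times> mod_class"
    obtain c d where p: "p = (c, d)" by force
    have "tensor_eval a b (smult [:r:] t) = r * tensor_eval a b t" for r t by (simp add: tensor_eval_def)
    then show "tensor_eval a b (case p of (c, d) \<Rightarrow> smult [:Poly_Mapping.lookup w (c, d):] (poly_tensor (f (basis_vec c)) (f (basis_vec d))))
      = Poly_Mapping.lookup w p *\<^sub>R (case p of (c, d) \<Rightarrow> poly (f (basis_vec c)) a * poly (f (basis_vec d)) b)"
      by (simp add: p tensor_eval_poly_tensor)
  qed
  finally show ?thesis by (simp add: linear_ext_def)
qed

text \<open>Two applications of the one-variable statement, in the outer and in the inner variable.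
  Working with positive arguments supplies the \<open>k > 0\<close> of
  \<open>card_strict_maps_mult\<close>.\<close>

lemma tensor_eqI:
  assumes "\<And>k l::nat. k > 0 \<Longrightarrow> l > 0 \<Longrightarrow> tensor_eval (real k) (real l) v = tensor_eval (real k) (real l) w"
  shows "v = w"
proof (rule poly_eqI_nat)
  fix l :: nat assume l: "l > 0"
  have "[:real l:] = of_nat l" by (simp add: of_nat_poly)
  moreover have "poly v [:real l:] = poly w [:real l:]"
    by (rule poly_eqI_nat) (use assms l in \<open>simp add: tensor_eval_def\<close>)
  ultimately show "poly v (of_nat l) = poly w (of_nat l)" by simp
qed

text \<open>The coproduct determines the value at \<open>k + 1\<close> from the values at \<open>k\<close> and at \<open>1\<close>, and the
  counits fix the values at \<open>0\<close> and at \<open>1\<close>.\<close>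

lemma double_bialgebra_morphism_unique:
  assumes f: "double_bialgebra_morphism f" and g: "double_bialgebra_morphism g"
  shows "f = g"
proof
  fix x
  have step: "poly (h x) (real (Suc k)) =
      linear_ext (\<lambda>(c, d). poly (h (basis_vec c)) (real k) * mod_eps_delta (basis_vec d)) (mod_Delta x)"
    if h: "double_bialgebra_morphism h" for h x k
  proof -
    have "poly (h x) (real (Suc k)) = tensor_eval (real k) 1 (poly_Delta (h x))"
      by (simp add: tensor_eval_poly_Delta add.commute)
    also have "\<dots> = tensor_eval (real k) 1 (tensor_map h (mod_Delta x))"
      using h by (simp add: double_bialgebra_morphism_def)
    also have "\<dots> = linear_ext (\<lambda>(c, d). poly (h (basis_vec c)) (real k) * poly (h (basis_vec d)) 1) (mod_Delta x)"
      by (rule tensor_eval_tensor_map)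
    finally show ?thesis
      using h by (simp add: double_bialgebra_morphism_def)
  qed
  have "poly (f x) (real k) = poly (g x) (real k)" for k x
  proof (induction k arbitrary: x)
    case 0
    then show ?case using f g by (simp add: double_bialgebra_morphism_def)
  next
    case (Suc k)
    then show ?case unfolding step[OF f] step[OF g] by simp
  qed
  then show "f x = g x" by (intro poly_eqI_nat) simp
qed

section \<open>The order polynomial as a morphism of double bialgebras\<close>

definition order_morphism :: "(mod_class \<Rightarrow>\<^sub>0 real) \<Rightarrow> real poly" where
  "order_morphism x = (\<Sum>b\<in>Poly_Mapping.keys x. smult (Poly_Mapping.lookup x b) (class_poly b))"

lemma poly_order_morphism: "poly (order_morphism x) k = linear_ext (\<lambda>b. poly (class_poly b) k) x"
  by (simp add: order_morphism_def linear_ext_def poly_sum)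

lemma order_morphism_basis_vec: "order_morphism (basis_vec b) = class_poly b"
  by (simp add: order_morphism_def basis_vec_def)

lemma class_poly_rep:
  assumes "mod_rep c = (n, z)"
  shows "preorder_on {1..n} (pre {1..n} z)" "class_poly c = ord_poly {1..n} (pre {1..n} z)" "modular {1..n} z"
  using assms mod_rep_modular[OF assms] pre_submodular(1)[OF _ modular_submodular, of "{1..n}" z]
  by (auto simp: class_poly_def)

text \<open>The preorder of a product is the disjoint union of the two preorders, and a strict map
  on it is a pair of strict maps.\<close>

lemma class_poly_mult: "class_poly (class_mult c d) = class_poly c * class_poly d"
proof -
  obtain m u where mu: "mod_rep c = (m, u)" by force
  obtain n v where nv: "mod_rep d = (n, v)" by force
  note c = class_poly_rep[OF mu] and d = class_poly_rep[OF nv]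
  let ?A = "Inl ` {1..m} :: (nat + nat) set" and ?B = "Inr ` {1..n} :: (nat + nat) set"
  let ?u = "relabel Inl {1..m} u" and ?v = "relabel Inr {1..n} v"
  let ?P = "map_prod Inl Inl ` pre {1..m} u" and ?Q = "map_prod Inr Inr ` pre {1..n} v"
  have iA: "inj_on Inl {1..m}" and iB: "inj_on Inr {1..n}" by auto
  have mA: "modular ?A ?u" "pre ?A ?u = ?P"
    by (rule modular_relabel[OF iA c(3)]) (rule pre_relabel[OF _ iA modular_submodular[OF c(3)]], simp)
  have mB: "modular ?B ?v" "pre ?B ?v = ?Q"
    by (rule modular_relabel[OF iB d(3)]) (rule pre_relabel[OF _ iB modular_submodular[OF d(3)]], simp)
  have disj: "?A \<inter> ?B = {}" by auto
  have fin: "finite ?A" "finite ?B" by auto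
  note M = fun_product_modular[OF fin disj mA(1) mB(1)]
  have preA: "preorder_on ?A ?P" and preB: "preorder_on ?B ?Q"
    using pre_submodular(1)[OF fin(1) modular_submodular[OF mA(1)]]
      pre_submodular(1)[OF fin(2) modular_submodular[OF mB(1)]] mA(2) mB(2) by auto
  have preAB: "preorder_on (?A \<union> ?B) (?P \<union> ?Q)"
    using pre_submodular(1)[OF _ modular_submodular[OF M(1)]] fin M(2) mA(2) mB(2) by auto
  have "class_poly (class_mult c d) = class_poly (mod_cls (?A \<union> ?B) (fun_product ?A ?B ?u ?v))"
    by (simp only: class_mult_def mu nv prod.case Plus_def)
  also have "\<dots> = ord_poly (?A \<union> ?B) (?P \<union> ?Q)"
    using class_poly_cls[OF _ M(1)] fin unfolding M(2) mA(2) mB(2) by blast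
  also have "\<dots> = ord_poly ?A ?P * ord_poly ?B ?Q"
  proof (rule poly_eqI_nat)
    fix k :: nat
    show "poly (ord_poly (?A \<union> ?B) (?P \<union> ?Q)) (of_nat k) = poly (ord_poly ?A ?P * ord_poly ?B ?Q) (of_nat k)"
      using poly_ord_poly(1)[OF _ preAB, of k] poly_ord_poly(1)[OF fin(1) preA, of k] poly_ord_poly(1)[OF fin(2) preB, of k]
        card_strict_maps_Un[OF preA preB disj, of k] fin by simp
  qed
  also have "ord_poly ?A ?P = class_poly c"
    unfolding c(2) by (rule ord_poly_image[OF _ iA c(1)]) simp
  also have "ord_poly ?B ?Q = class_poly d"
    unfolding d(2) by (rule ord_poly_image[OF _ iB d(1)]) simp
  finally show ?thesis .
qed

lemma order_morphism_mult: "order_morphism (mod_mult x y) = order_morphism x * order_morphism y"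
proof (rule poly_eqI_nat)
  fix k :: nat
  let ?p = "\<lambda>c. poly (class_poly c) (real k)"
  have "linear_ext ?p (linear_ext (\<lambda>d. basis_vec (class_mult c d)) y) = ?p c * linear_ext ?p y" for c
  proof -
    have "linear_ext ?p (linear_ext (\<lambda>d. basis_vec (class_mult c d)) y) = linear_ext (\<lambda>d. ?p c * ?p d) y"
      by (subst linear_ext_comp[OF linear_linear_ext]) (simp add: class_poly_mult)
    then show ?thesis by (simp add: linear_ext_def sum_distrib_left algebra_simps)
  qed
  then have "linear_ext ?p (mod_mult x y) = linear_ext (\<lambda>c. ?p c * linear_ext ?p y) x"
    unfolding mod_mult_def by (subst linear_ext_comp[OF linear_linear_ext]) simp
  also have "\<dots> = linear_ext ?p x * linear_ext ?p y"
    by (simp add: linear_ext_def[of _ x] sum_distrib_right mult.assoc)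
  finally show "poly (order_morphism (mod_mult x y)) (of_nat k) = poly (order_morphism x * order_morphism y) (of_nat k)"
    by (simp add: poly_order_morphism)
qed

lemma order_morphism_unit: "order_morphism mod_unit = 1"
proof (rule poly_eqI_nat)
  have m: "modular {} (\<lambda>A\<in>Pow ({} :: nat set). 0)" by (rule modular_empty)
  let ?P = "pre {} (\<lambda>A\<in>Pow ({} :: nat set). 0 :: ereal)"
  have P: "preorder_on {} ?P" by (rule pre_submodular(1)[OF _ modular_submodular[OF m]]) simp
  fix k :: nat
  have "card (strict_maps {} ?P k) = 1"
    using P by (simp add: strict_maps_def preorder_on_def)
  then show "poly (order_morphism mod_unit) (of_nat k) = poly 1 (of_nat k)"
    using poly_ord_poly(1)[OF _ P, of k] unfolding mod_unit_def order_morphism_basis_vec class_poly_cls[OF finite.emptyI m]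
    by simp
qed

text \<open>Evaluated at \<open>(k, l)\<close>, the right side sums over the sets of finite value,
  which are the down-sets, and becomes \<open>card_strict_maps_add\<close>.\<close>

lemma order_morphism_Delta: "poly_Delta (order_morphism x) = tensor_map order_morphism (mod_Delta x)"
proof (rule tensor_eqI)
  fix k l :: nat
  let ?T = "\<lambda>(c, d). poly (class_poly c) (real k) * poly (class_poly d) (real l)"
  let ?D = "\<lambda>c. case mod_rep c of (n, z) \<Rightarrow>
     \<Sum>S\<in>Pow {1..n}. if z S < \<infinity>
       then basis_vec (mod_cls S (restriction z S), mod_cls ({1..n} - S) (contraction {1..n} z S)) else 0"
  have key: "linear_ext ?T (?D c) = poly (class_poly c) (real (k + l))" for c
  proof -
    obtain n z where nz: "mod_rep c = (n, z)" by force
    note c = class_poly_rep[OF nz]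
    let ?I = "{1..n}" let ?P = "pre ?I z"
    have "linear_ext ?T (?D c) = (\<Sum>S\<in>Pow ?I. linear_ext ?T (if z S < \<infinity>
       then basis_vec (mod_cls S (restriction z S), mod_cls (?I - S) (contraction ?I z S)) else 0))"
      unfolding nz prod.case by (rule linear_ext_sum)
    also have "\<dots> = (\<Sum>S\<in>Pow ?I. if down_set ?I ?P S then
       real (card (strict_maps S (?P \<inter> S \<times> S) k) * card (strict_maps (?I - S) (?P \<inter> (?I - S) \<times> (?I - S)) l)) else 0)"
    proof (rule sum.cong[OF refl])
      fix S assume "S \<in> Pow ?I"
      then have S: "S \<subseteq> ?I" by simp
      have fs: "finite S" using S finite_subset by blast
      show "linear_ext ?T (if z S < \<infinity>
         then basis_vec (mod_cls S (restriction z S), mod_cls (?I - S) (contraction ?I z S)) else 0) =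
         (if down_set ?I ?P S then
       real (card (strict_maps S (?P \<inter> S \<times> S) k) * card (strict_maps (?I - S) (?P \<inter> (?I - S) \<times> (?I - S)) l)) else 0)"
      proof (cases "z S < \<infinity>")
        case True
        have d: "down_set ?I ?P S" using True modular_finite_iff[OF _ c(3) S] by simp
        note r = restriction_modular[OF finite_atLeastAtMost c(3) S True]
          and t = contraction_modular[OF finite_atLeastAtMost c(3) S True]
        have "linear_ext ?T (basis_vec (mod_cls S (restriction z S), mod_cls (?I - S) (contraction ?I z S))) =
          poly (class_poly (mod_cls S (restriction z S))) (real k) *
          poly (class_poly (mod_cls (?I - S) (contraction ?I z S))) (real l)" by simp
        also have "class_poly (mod_cls S (restriction z S)) = ord_poly S (?P \<inter> S \<times> S)"
          using class_poly_cls[OF fs r(1)] unfolding r(2) .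
        also have "class_poly (mod_cls (?I - S) (contraction ?I z S)) = ord_poly (?I - S) (?P \<inter> (?I - S) \<times> (?I - S))"
          using class_poly_cls[OF _ t(1)] unfolding t(2) by simp
        finally show ?thesis
          using True d poly_ord_poly(1)[OF fs preorder_on_restrict[OF c(1) S], of k]
            poly_ord_poly(1)[OF _ preorder_on_restrict[OF c(1), of "?I - S"], of l] by simp
      next
        case False
        then show ?thesis using modular_finite_iff[OF _ c(3) S] by simp
      qed
    qed
    also have "\<dots> = (\<Sum>S | down_set ?I ?P S.
       real (card (strict_maps S (?P \<inter> S \<times> S) k) * card (strict_maps (?I - S) (?P \<inter> (?I - S) \<times> (?I - S)) l)))"
      by (subst sum.inter_filter[symmetric]) (auto intro!: sum.cong dest: down_set_subset)
    also have "\<dots> = real (card (strict_maps ?I ?P (k + l)))"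
      unfolding card_strict_maps_add[OF finite_atLeastAtMost c(1)] by simp
    also have "\<dots> = poly (class_poly c) (real (k + l))"
      unfolding c(2) by (rule poly_ord_poly(1)[symmetric]) (use c(1) in auto)
    finally show ?thesis .
  qed
  have "tensor_eval (real k) (real l) (tensor_map order_morphism (mod_Delta x)) = linear_ext ?T (mod_Delta x)"
    by (simp only: tensor_eval_tensor_map order_morphism_basis_vec)
  also have "\<dots> = linear_ext (\<lambda>c. linear_ext ?T (?D c)) x"
    unfolding mod_Delta_def by (rule linear_ext_comp[OF linear_linear_ext])
  also have "\<dots> = poly (order_morphism x) (real (k + l))"
    unfolding key poly_order_morphism ..
  finally show "tensor_eval (real k) (real l) (poly_Delta (order_morphism x)) =
      tensor_eval (real k) (real l) (tensor_map order_morphism (mod_Delta x))"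
    by (simp add: tensor_eval_poly_Delta)
qed

text \<open>Evaluated at \<open>(k, l)\<close>, \<open>bubble_fun\<close> contributes the strict
  maps inside the bubbles of \<open>Q\<close> and \<open>preorder_fun\<close> those of
  \<open>Q\<close>; the sum over conforming \<open>Q\<close> is
  \<open>card_strict_maps_mult\<close>.\<close>

lemma order_morphism_delta: "poly_delta (order_morphism x) = tensor_map order_morphism (mod_delta x)"
proof (rule tensor_eqI)
  fix k l :: nat assume k: "k > 0"
  let ?T = "\<lambda>(c, d). poly (class_poly c) (real k) * poly (class_poly d) (real l)"
  let ?D = "\<lambda>c. case mod_rep c of (n, z) \<Rightarrow>
     \<Sum>Q\<in>Pre {1..n} z. basis_vec
       (mod_cls {1..n} (bubble_fun {1..n} z Q), mod_cls {1..n} (preorder_fun {1..n} z Q))"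
  have key: "linear_ext ?T (?D c) = poly (class_poly c) (real (k * l))" for c
  proof -
    obtain n z where nz: "mod_rep c = (n, z)" by force
    note c = class_poly_rep[OF nz]
    let ?I = "{1..n}" let ?P = "pre ?I z"
    have "linear_ext ?T (?D c) = (\<Sum>Q\<in>Pre ?I z. linear_ext ?T
       (basis_vec (mod_cls ?I (bubble_fun ?I z Q), mod_cls ?I (preorder_fun ?I z Q))))"
      unfolding nz prod.case by (rule linear_ext_sum)
    also have "\<dots> = (\<Sum>Q\<in>Pre ?I z. real (card (strict_maps ?I (?P \<inter> (Q \<inter> Q\<inverse>)) k) * card (strict_maps ?I Q l)))"
    proof (rule sum.cong[OF refl])
      fix Q assume Q: "Q \<in> Pre ?I z"
      note b = bubble_fun_modular[OF finite_atLeastAtMost c(3) Q]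
        and p = preorder_fun_modular[OF modular_submodular[OF c(3)] Q]
      have preb: "preorder_on ?I (?P \<inter> (Q \<inter> Q\<inverse>))"
        using pre_submodular(1)[OF finite_atLeastAtMost modular_submodular[OF b(1)]] unfolding b(2) .
      have prep: "preorder_on ?I Q"
        using Q Pre_iff[OF modular_submodular[OF c(3)]] by blast
      have "linear_ext ?T (basis_vec (mod_cls ?I (bubble_fun ?I z Q), mod_cls ?I (preorder_fun ?I z Q))) =
         poly (class_poly (mod_cls ?I (bubble_fun ?I z Q))) (real k) * poly (class_poly (mod_cls ?I (preorder_fun ?I z Q))) (real l)"
        by simp
      also have "class_poly (mod_cls ?I (bubble_fun ?I z Q)) = ord_poly ?I (?P \<inter> (Q \<inter> Q\<inverse>))"
        using class_poly_cls[OF finite_atLeastAtMost b(1)] unfolding b(2) .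
      also have "class_poly (mod_cls ?I (preorder_fun ?I z Q)) = ord_poly ?I Q"
        using class_poly_cls[OF finite_atLeastAtMost p(1)] unfolding p(2) .
      finally show "linear_ext ?T (basis_vec (mod_cls ?I (bubble_fun ?I z Q), mod_cls ?I (preorder_fun ?I z Q))) =
         real (card (strict_maps ?I (?P \<inter> (Q \<inter> Q\<inverse>)) k) * card (strict_maps ?I Q l))"
        using poly_ord_poly(1)[OF _ preb, of k] poly_ord_poly(1)[OF _ prep, of l] by simp
    qed
    also have "Pre ?I z = {Q. preorder_contraction ?I ?P Q}"
      using Pre_modular_iff[OF finite_atLeastAtMost c(3)] by blast
    also have "(\<Sum>Q | preorder_contraction ?I ?P Q.
        real (card (strict_maps ?I (?P \<inter> (Q \<inter> Q\<inverse>)) k) * card (strict_maps ?I Q l))) =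
        real (card (strict_maps ?I ?P (k * l)))"
      unfolding card_strict_maps_mult[OF finite_atLeastAtMost c(1) k] by simp
    also have "\<dots> = poly (class_poly c) (real (k * l))"
      unfolding c(2) by (rule poly_ord_poly(1)[symmetric]) (use c(1) in auto)
    finally show ?thesis .
  qed
  have "tensor_eval (real k) (real l) (tensor_map order_morphism (mod_delta x)) = linear_ext ?T (mod_delta x)"
    by (simp only: tensor_eval_tensor_map order_morphism_basis_vec)
  also have "\<dots> = linear_ext (\<lambda>c. linear_ext ?T (?D c)) x"
    unfolding mod_delta_def by (rule linear_ext_comp[OF linear_linear_ext])
  also have "\<dots> = poly (order_morphism x) (real (k * l))"
    unfolding key poly_order_morphism ..
  finally show "tensor_eval (real k) (real l) (poly_delta (order_morphism x)) =
      tensor_eval (real k) (real l) (tensor_map order_morphism (mod_delta x))"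
    by (simp add: tensor_eval_poly_delta)
qed

lemma order_morphism_counits:
  "poly (order_morphism x) 0 = mod_eps_Delta x" "poly (order_morphism x) 1 = mod_eps_delta x"
proof -
  have "poly (class_poly c) 0 = (case mod_rep c of (n, z) \<Rightarrow> if n = 0 then 1 else 0) \<and>
     poly (class_poly c) 1 = (case mod_rep c of (n, z) \<Rightarrow>
     if totally_disconnected {1..n} (pre {1..n} z) then 1 else 0)" for c
  proof -
    obtain n z where nz: "mod_rep c = (n, z)" by force
    note c = class_poly_rep[OF nz]
    have "equiv {1..n} (pre {1..n} z) \<longleftrightarrow> sym (pre {1..n} z)"
      using c(1) by (auto simp: equiv_def preorder_on_def)
    then show ?thesis
      using poly_ord_poly(1)[OF _ c(1), of 0] poly_ord_poly(1)[OF _ c(1), of 1] c(2)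
        card_strict_maps_0[OF c(1)] card_strict_maps_1[OF c(1)] nz
      by (simp add: totally_disconnected_def)
  qed
  then show "poly (order_morphism x) 0 = mod_eps_Delta x" "poly (order_morphism x) 1 = mod_eps_delta x"
    unfolding poly_order_morphism mod_eps_Delta_def mod_eps_delta_def by simp_all
qed

lemma order_morphism_linear: "Vector_Spaces.linear scaleR smult order_morphism"
  unfolding Vector_Spaces.linear_iff
proof (intro conjI allI)
  show "vector_space (scaleR :: real \<Rightarrow> (mod_class \<Rightarrow>\<^sub>0 real) \<Rightarrow> _)" by (rule real_vector.vector_space_axioms)
  show "vector_space (smult :: real \<Rightarrow> real poly \<Rightarrow> _)"
    by unfold_locales (auto simp: smult_add_left smult_add_right)
  show "order_morphism (x + y) = order_morphism x + order_morphism y" for x y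
    by (rule poly_eqI_nat) (simp add: poly_order_morphism linear_add[OF linear_linear_ext])
  show "order_morphism (c *\<^sub>R x) = smult c (order_morphism x)" for c x
    by (rule poly_eqI_nat) (simp add: poly_order_morphism linear_scale[OF linear_linear_ext])
qed

lemma theta_eq: "theta = order_morphism"
  unfolding theta_def
proof (rule the_equality)
  show "double_bialgebra_morphism order_morphism"
    unfolding double_bialgebra_morphism_def
    using order_morphism_linear order_morphism_unit order_morphism_mult order_morphism_Delta
      order_morphism_delta order_morphism_counits by blast
  then show "f = order_morphism" if "double_bialgebra_morphism f" for f
    using that by (rule double_bialgebra_morphism_unique[rotated])
qed

text \<open>The class forgets the ground set, so the sum first runs over a numbered copy and is then
  carried back along the numbering, which preserves minimality and order polynomials.\<close>

lemma poly_chi: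
  assumes I: "finite I" and z: "submodular I z"
  shows "poly (chi I z) k = (\<Sum>P\<in>minPre I z. poly (ord_poly I P) k)"
proof -
  obtain f n where f: "sm_rep (sm_cls I z) = (n, relabel f I z)" "bij_betw f I {1..n}"
    using sm_rep_cls[OF I z] .
  have inj: "inj_on f I" and im: "{1..n} = f ` I" using f(2) by (auto simp: bij_betw_def)
  let ?z = "relabel f I z" and ?J = "f ` I"
  note zJ = submodular_relabel[OF inj z]
  have "poly (chi I z) k = linear_ext (\<lambda>b. poly (class_poly b) k) (\<Sum>P\<in>minPre ?J ?z. basis_vec (mod_cls ?J (preorder_fun ?J ?z P)))"
    by (simp only: chi_def theta_eq poly_order_morphism phi_bar_def linear_ext_basis_vec f(1) prod.case im)
  also have "\<dots> = (\<Sum>P\<in>minPre ?J ?z. poly (class_poly (mod_cls ?J (preorder_fun ?J ?z P))) k)"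
    by (simp add: linear_ext_sum)
  also have "\<dots> = (\<Sum>P\<in>minPre ?J ?z. poly (ord_poly ?J P) k)"
  proof (rule sum.cong[OF refl])
    fix P assume "P \<in> minPre ?J ?z"
    then have P: "P \<in> Pre ?J ?z" by (simp add: minPre_def)
    note p = preorder_fun_modular[OF zJ P]
    show "poly (class_poly (mod_cls ?J (preorder_fun ?J ?z P))) k = poly (ord_poly ?J P) k"
      using class_poly_cls[OF _ p(1)] I unfolding p(2) by simp
  qed
  also have "\<dots> = (\<Sum>P\<in>minPre I z. poly (ord_poly ?J (map_prod f f ` P)) k)"
  proof -
    have "inj_on (map_prod f f) (I \<times> I)" using map_prod_inj_on[OF inj inj] .
    then have "inj_on ((`) (map_prod f f)) (Pow (I \<times> I))" by (rule inj_on_image_Pow)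
    moreover have "minPre I z \<subseteq> Pow (I \<times> I)"
      by (auto simp: minPre_def Pre_iff[OF z] preorder_on_def)
    ultimately have "inj_on ((`) (map_prod f f)) (minPre I z)" by (rule inj_on_subset)
    then show ?thesis unfolding minPre_relabel[OF inj z] by (simp add: sum.reindex)
  qed
  also have "\<dots> = (\<Sum>P\<in>minPre I z. poly (ord_poly I P) k)"
    by (rule sum.cong[OF refl]) (auto simp: minPre_def Pre_iff[OF z] ord_poly_image[OF I inj])
  finally show ?thesis .
qed

section \<open>Lattice points of order polytopes\<close>

text \<open>It will turn out to be the normal cone belonging to \<open>P\<close>; cut with the unit
  box it is the order polytope.\<close>

definition order_cone :: "'a::finite set \<Rightarrow> 'a rel \<Rightarrow> (real ^ 'a) set" where
  "order_cone I P = {y \<in> coord_space I. \<forall>(i, j)\<in>P. y $ j \<le> y $ i}"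

definition indic :: "'a::finite set \<Rightarrow> real ^ 'a" where
  "indic A = (\<chi> i. if i \<in> A then 1 else 0)"

lemma indic_nth [simp]: "indic A $ i = (if i \<in> A then 1 else 0)"
  by (simp add: indic_def)

lemma inner_indic: "indic A \<bullet> x = (\<Sum>i\<in>A. x $ i)"
proof -
  have "indic A \<bullet> x = (\<Sum>i\<in>UNIV. if i \<in> A then x $ i else 0)"
    unfolding inner_vec_def by (rule sum.cong) auto
  then show ?thesis by (simp add: sum.If_cases)
qed

lemma order_coneD:
  "y \<in> order_cone I P \<Longrightarrow> i \<notin> I \<Longrightarrow> y $ i = 0" "y \<in> order_cone I P \<Longrightarrow> (i, j) \<in> P \<Longrightarrow> y $ j \<le> y $ i"
  by (auto simp: order_cone_def coord_space_def)

lemma indic_order_cone: "down_set I P A \<Longrightarrow> indic A \<in> order_cone I P"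
  by (auto simp: order_cone_def coord_space_def dest: down_setD down_set_subset)

lemma subspace_coord_space: "subspace (coord_space I)"
  by (auto simp: subspace_def coord_space_def)

lemma convex_order_cone: "convex (order_cone I P)"
  by (rule convexI) (auto simp: order_cone_def coord_space_def intro!: add_mono mult_left_mono)

lemma convex_box_cube: "convex (box_cube I c)"
proof (rule convexI)
  fix x y :: "real ^ 'a" and u v :: real
  assume x: "x \<in> box_cube I c" and y: "y \<in> box_cube I c" and uv: "0 \<le> u" "0 \<le> v" "u + v = 1"
  have "u * x $ i + v * y $ i \<le> c" if "i \<in> I" for i
    using convex_bound_le[of "x $ i" c "y $ i" u v] x y uv that by (auto simp: box_cube_def)
  then show "u *\<^sub>R x + v *\<^sub>R y \<in> box_cube I c"
    using x y uv by (auto simp: box_cube_def coord_space_def)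
qed

lemma preorder_polytope_eq: "preorder_polytope I P = order_cone I P \<inter> box_cube I 1"
  by (auto simp: preorder_polytope_def order_cone_def box_cube_def)

text \<open>The shift \<open>s\<close> serves two counts: \<open>s = 0\<close> for closed dilates,
  whose coordinates start at 0, and \<open>s = 1\<close> for interiors, whose integer coordinates
  start at 1.\<close>

lemma card_lattice_points_eq:
  fixes I :: "'a::finite set" and s :: nat and S :: "('a \<Rightarrow> nat) set"
  assumes S: "S \<subseteq> extensional I" and L: "L \<subseteq> lattice I" "\<And>y i. y \<in> L \<Longrightarrow> i \<in> I \<Longrightarrow> real s \<le> y $ i"
    and iff: "\<And>g. g \<in> extensional I \<Longrightarrow> (\<chi> i. if i \<in> I then real (g i + s) else 0) \<in> L \<longleftrightarrow> g \<in> S"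
  shows "card L = card S"
proof -
  let ?v = "\<lambda>g. (\<chi> i. if i \<in> I then real (g i + s) else 0) :: real ^ 'a"
  have "inj_on ?v S"
  proof (rule inj_onI)
    fix g h assume "g \<in> S" "h \<in> S" and eq: "?v g = ?v h"
    then have ext: "g \<in> extensional I" "h \<in> extensional I" using S by auto
    show "g = h"
    proof (rule extensionalityI[OF ext])
      fix i assume "i \<in> I"
      moreover have "?v g $ i = ?v h $ i" using eq by simp
      ultimately show "g i = h i" by simp
    qed
  qed
  moreover have "?v ` S = L"
  proof
    show "?v ` S \<subseteq> L" using iff S by blast
    show "L \<subseteq> ?v ` S"
    proof
      fix y assume y: "y \<in> L"
      define g where "g = (\<lambda>i\<in>I. nat \<lfloor>y $ i\<rfloor> - s)"
      have "real (g i + s) = y $ i" if i: "i \<in> I" for i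
      proof -
        have "y $ i \<in> \<int>" using y L(1) i by (auto simp: lattice_def)
        then obtain n where n: "y $ i = of_int n" by (elim Ints_cases)
        then have "int s \<le> n" using L(2)[OF y i] by linarith
        then show ?thesis using i n by (simp add: g_def of_nat_diff)
      qed
      moreover have "y $ i = 0" if "i \<notin> I" for i using y L(1) that by (auto simp: lattice_def coord_space_def)
      ultimately have v: "?v g = y" by (auto simp: vec_eq_iff)
      then have "g \<in> S" using iff[of g] y by (simp add: g_def)
      then show "y \<in> ?v ` S" using v by blast
    qed
  qed
  ultimately show ?thesis using card_image by blast
qed

text \<open>Dilation stretches the box and leaves the cone invariant; the \<open>k + 1\<close>
  integers from 0 to \<open>k\<close> are the \<open>Suc k\<close> values of a weak map.\<close>

lemma card_lattice_points_dilate: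
  fixes I :: "'a::finite set"
  assumes P: "preorder_on I P" and k: "k > 0"
  shows "card ((\<lambda>x. real k *\<^sub>R x) ` preorder_polytope I P \<inter> lattice I) = card (weak_maps I P (Suc k))"
proof -
  have fP: "x \<in> I" "y \<in> I" if "(x, y) \<in> P" for x y using preorder_fieldD[OF P that] by auto
  have dil: "(\<lambda>x. real k *\<^sub>R x) ` preorder_polytope I P = order_cone I P \<inter> box_cube I (real k)"
  proof
    show "(\<lambda>x. real k *\<^sub>R x) ` preorder_polytope I P \<subseteq> order_cone I P \<inter> box_cube I (real k)"
      by (auto simp: preorder_polytope_eq order_cone_def box_cube_def coord_space_def mult_left_mono mult_left_le)
    show "order_cone I P \<inter> box_cube I (real k) \<subseteq> (\<lambda>x. real k *\<^sub>R x) ` preorder_polytope I P"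
    proof
      fix y assume y: "y \<in> order_cone I P \<inter> box_cube I (real k)"
      have "y = real k *\<^sub>R ((1 / real k) *\<^sub>R y)" using k by simp
      moreover have "(1 / real k) *\<^sub>R y \<in> preorder_polytope I P"
        using y k by (auto simp: preorder_polytope_eq order_cone_def box_cube_def coord_space_def divide_right_mono)
      ultimately show "y \<in> (\<lambda>x. real k *\<^sub>R x) ` preorder_polytope I P" by blast
    qed
  qed
  show ?thesis
    unfolding dil
  proof (rule card_lattice_points_eq[where s = 0])
    fix g :: "'a \<Rightarrow> nat" assume "g \<in> extensional I"
    then have "g \<in> weak_maps I P (Suc k) \<longleftrightarrow> (\<forall>i\<in>I. g i \<le> k) \<and> (\<forall>i j. (i, j) \<in> P \<longrightarrow> g j \<le> g i)"
      by (auto simp: weak_maps_def PiE_iff less_Suc_eq_le)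
    then show "(\<chi> i. if i \<in> I then real (g i + 0) else 0) \<in> order_cone I P \<inter> box_cube I (real k) \<inter> lattice I \<longleftrightarrow>
        g \<in> weak_maps I P (Suc k)"
      using fP by (auto simp: order_cone_def box_cube_def lattice_def coord_space_def)
  qed (auto simp: weak_maps_def PiE_iff box_cube_def)
qed

text \<open>Within the subspace \<open>?V\<close> of vectors constant on bubbles, the strict
  inequalities define an open set. Conversely they hold at every relative interior point, because
  they hold at the sample point \<open>p\<close>.\<close>

lemma rel_interior_order_cone_box:
  fixes I :: "'a::finite set"
  assumes P: "preorder_on I P" and c: "c > 0"
  shows "rel_interior (order_cone I P \<inter> box_cube I c) =
    {y \<in> order_cone I P. (\<forall>i\<in>I. 0 < y $ i \<and> y $ i < c) \<and> (\<forall>i j. (i, j) \<in> P \<longrightarrow> (j, i) \<notin> P \<longrightarrow> y $ j < y $ i)}"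
    (is "rel_interior ?S = ?R")
proof -
  have fP: "x \<in> I" "y \<in> I" if "(x, y) \<in> P" for x y using preorder_fieldD[OF P that] by auto
  let ?V = "coord_space I \<inter> (\<Inter>p\<in>P \<inter> P\<inverse>. {y :: real ^ 'a. y $ fst p = y $ snd p})"
  let ?T = "(\<Inter>i\<in>I. {y :: real ^ 'a. 0 < y $ i} \<inter> {y. y $ i < c}) \<inter> (\<Inter>(i, j)\<in>P - P\<inverse>. {y. y $ j < y $ i})"
  have Topen: "open ?T"
    by (intro open_Int open_INT) (auto simp: split_beta intro!: open_Int open_Collect_less continuous_intros)
  have "?S \<subseteq> ?V" by (auto simp: order_cone_def intro!: antisym)
  moreover have "subspace {y :: real ^ 'a. y $ a = y $ b}" for a b by (simp add: subspace_def)
  then have "subspace ?V"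
    by (intro subspace_inter subspace_coord_space subspace_Inter) auto
  ultimately have aff: "affine hull ?S \<subseteq> ?V" by (intro hull_minimal) (auto intro: subspace_imp_affine)
  have TV: "?T \<inter> ?V \<subseteq> ?S"
  proof
    fix y assume y: "y \<in> ?T \<inter> ?V"
    have "y $ j \<le> y $ i" if ij: "(i, j) \<in> P" for i j
    proof (cases "(j, i) \<in> P")
      case True
      then have "y $ fst (i, j) = y $ snd (i, j)" using y ij by blast
      then show ?thesis by simp
    next
      case False
      then have "(i, j) \<in> P - P\<inverse>" using ij by blast
      then have "y $ j < y $ i" using y by blast
      then show ?thesis by simp
    qed
    then show "y \<in> ?S" using y by (auto simp: order_cone_def box_cube_def intro: less_imp_le)
  qed
  show ?thesis
  proof
    show "?R \<subseteq> rel_interior ?S"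
    proof
      fix y assume y: "y \<in> ?R"
      then have yT: "y \<in> ?T" by auto
      have yS: "y \<in> ?S" using y by (auto simp: order_cone_def box_cube_def intro: less_imp_le)
      have TS: "?T \<inter> affine hull ?S \<subseteq> ?S"
        using Int_mono[OF order_refl aff] TV by (rule order_trans)
      show "y \<in> rel_interior ?S"
        unfolding mem_rel_interior by (intro exI[of _ ?T] conjI IntI Topen yT yS TS)
    qed
    show "rel_interior ?S \<subseteq> ?R"
    proof
      fix x assume x: "x \<in> rel_interior ?S"
      \<comment> \<open>The sample point: the size \<open>d i\<close> of the principal down-set is
        constant on bubbles and strictly increasing between them, and \<open>n = card I + 1\<close>
        keeps \<open>p\<close> off both walls of the box.\<close>
      define n where "n = real (card I) + 1"
      define d where "d = (\<lambda>i. real (card {j. (j, i) \<in> P}))"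
      define p :: "real ^ 'a" where "p = (\<chi> i. if i \<in> I then c * (n - d i) / n else 0)"
      have n: "n > 0" by (simp add: n_def)
      have d: "0 < d i" "d i < n" if "i \<in> I" for i
      proof -
        have "{j. (j, i) \<in> P} \<noteq> {}" using preorder_reflD[OF P that] by auto
        then show "0 < d i" by (simp add: d_def card_gt_0_iff)
        have "card {j. (j, i) \<in> P} \<le> card I" by (rule card_mono) (use fP in auto)
        then show "d i < n" by (simp add: d_def n_def)
      qed
      have dlt: "d i < d j" if "(i, j) \<in> P" "(j, i) \<notin> P" for i j
      proof -
        have "{l. (l, i) \<in> P} \<subset> {l. (l, j) \<in> P}"
          using that preorder_transD[OF P] preorder_reflD[OF P] fP[OF that(1)] by blast
        then show ?thesis unfolding d_def by (simp add: psubset_card_mono)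
      qed
      have deq: "d i = d j" if "(i, j) \<in> P" "(j, i) \<in> P" for i j
      proof -
        have "{l. (l, i) \<in> P} = {l. (l, j) \<in> P}"
          using that preorder_transD[OF P] by blast
        then show ?thesis unfolding d_def by simp
      qed
      have pi: "0 < p $ i" "p $ i < c" if "i \<in> I" for i
        using that d[OF that] n c by (auto simp: p_def field_simps)
      have plt: "p $ j < p $ i" if "(i, j) \<in> P" "(j, i) \<notin> P" for i j
        using dlt[OF that] fP[OF that(1)] n c by (simp add: p_def divide_strict_right_mono)
      have "p $ i = p $ j" if "(i, j) \<in> P" "(j, i) \<in> P" for i j
        using deq[OF that] fP[OF that(1)] by (simp add: p_def)
      then have eqp: "p $ fst q = p $ snd q" if "q \<in> P \<inter> P\<inverse>" for q
        using that by (cases q) auto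
      have "p \<in> coord_space I" by (simp add: coord_space_def p_def)
      then have pV: "p \<in> ?V" using eqp by (intro IntI INT_I CollectI)
      have "p \<in> (\<Inter>i\<in>I. {y. 0 < y $ i} \<inter> {y. y $ i < c})" using pi by (intro INT_I IntI CollectI)
      moreover have "p \<in> (\<Inter>(i, j)\<in>P - P\<inverse>. {y. y $ j < y $ i})"
      proof (rule INT_I)
        fix q assume "q \<in> P - P\<inverse>"
        then show "p \<in> (case q of (i, j) \<Rightarrow> {y. y $ j < y $ i})" using plt by (cases q) simp
      qed
      ultimately have pT: "p \<in> ?T" by (rule IntI)
      have pS: "p \<in> ?S" by (rule subsetD[OF TV IntI[OF pT pV]])
      have cv: "convex ?S" by (intro convex_Int convex_order_cone convex_box_cube)
      have ne: "?S \<noteq> {}" using pS by (metis empty_iff)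
      \<comment> \<open>The segment from \<open>p\<close> to \<open>x\<close> can be prolonged
        beyond \<open>x\<close>; so \<open>x\<close> is a proper mixture of \<open>p\<close> and a
        point \<open>w\<close> of the set and inherits the strictness of \<open>p\<close>.\<close>
      obtain e where e: "e > 1" "(1 - e) *\<^sub>R p + e *\<^sub>R x \<in> ?S"
        using bspec[OF iffD1[OF convex_rel_interior_iff[OF cv ne] x] pS] by auto
      define w where "w = (1 - e) *\<^sub>R p + e *\<^sub>R x"
      have w: "e * x $ i = w $ i + (e - 1) * p $ i" for i by (simp add: w_def algebra_simps)
      have wS: "w \<in> ?S" using e by (simp add: w_def)
      have xS: "x \<in> ?S" by (rule subsetD[OF rel_interior_subset x])
      have "0 < x $ i \<and> x $ i < c" if "i \<in> I" for i
      proof -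
        have wi: "0 \<le> w $ i" "w $ i \<le> c" using wS that by (auto simp: box_cube_def)
        have "0 < (e - 1) * p $ i" using e pi[OF that] by simp
        then have "0 < e * x $ i" using w[of i] wi by linarith
        moreover have "(e - 1) * p $ i < (e - 1) * c" using e pi[OF that] by simp
        then have "e * x $ i < e * c" using w[of i] wi by (simp add: algebra_simps)
        ultimately show ?thesis using e by (simp add: zero_less_mult_iff)
      qed
      moreover have "x $ j < x $ i" if "(i, j) \<in> P" "(j, i) \<notin> P" for i j
      proof -
        have "w $ j \<le> w $ i" using wS that by (auto simp: order_cone_def)
        moreover have "(e - 1) * p $ j < (e - 1) * p $ i" using e plt[OF that] by simp
        ultimately have "e * x $ j < e * x $ i" using w[of i] w[of j] by linarith
        then show ?thesis using e by simp
      qed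
      ultimately show "x \<in> ?R" using xS by blast
    qed
  qed
qed

text \<open>Integers strictly between 0 and \<open>k + 1\<close> are \<open>1, ..., k\<close>;
  subtracting 1 gives the \<open>k\<close> values of a strict map.\<close>

lemma card_interior_lattice_points:
  fixes I :: "'a::finite set"
  assumes P: "preorder_on I P"
  shows "card (rel_interior (order_cone I P \<inter> box_cube I (real k + 1)) \<inter> lattice I) = card (strict_maps I P k)"
proof -
  have fP: "x \<in> I" "y \<in> I" if "(x, y) \<in> P" for x y using preorder_fieldD[OF P that] by auto
  have L: "rel_interior (order_cone I P \<inter> box_cube I (real k + 1)) =
      {y \<in> order_cone I P. (\<forall>i\<in>I. 0 < y $ i \<and> y $ i < real k + 1) \<and>
      (\<forall>i j. (i, j) \<in> P \<longrightarrow> (j, i) \<notin> P \<longrightarrow> y $ j < y $ i)}"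
    by (rule rel_interior_order_cone_box[OF P]) simp
  show ?thesis
    unfolding L
  proof (rule card_lattice_points_eq[where s = 1])
    fix g :: "'a \<Rightarrow> nat" assume "g \<in> extensional I"
    then have "g \<in> strict_maps I P k \<longleftrightarrow> (\<forall>i\<in>I. g i < k) \<and> (\<forall>i j. (i, j) \<in> P \<longrightarrow> g j \<le> g i) \<and>
        (\<forall>i j. (i, j) \<in> P \<longrightarrow> (j, i) \<notin> P \<longrightarrow> g j < g i)"
      by (auto simp: strict_maps_def PiE_iff)
    then show "(\<chi> i. if i \<in> I then real (g i + 1) else 0) \<in> {y \<in> order_cone I P.
        (\<forall>i\<in>I. 0 < y $ i \<and> y $ i < real k + 1) \<and>
        (\<forall>i j. (i, j) \<in> P \<longrightarrow> (j, i) \<notin> P \<longrightarrow> y $ j < y $ i)} \<inter> lattice I \<longleftrightarrow> g \<in> strict_maps I P k"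
      using fP by (auto simp: order_cone_def lattice_def coord_space_def)
  next
    fix y :: "real ^ 'a" and i
    assume y: "y \<in> {y \<in> order_cone I P. (\<forall>i\<in>I. 0 < y $ i \<and> y $ i < real k + 1) \<and>
        (\<forall>i j. (i, j) \<in> P \<longrightarrow> (j, i) \<notin> P \<longrightarrow> y $ j < y $ i)} \<inter> lattice I" and i: "i \<in> I"
    then have "y $ i \<in> \<int>" "0 < y $ i" by (auto simp: lattice_def)
    then obtain n where "y $ i = of_int n" "0 < n" by (metis Ints_cases of_int_0_less_iff)
    then show "real 1 \<le> y $ i" by simp
  qed (auto simp: strict_maps_def PiE_iff)
qed

section \<open>Dimension and Ehrhart polynomial of the order polytope\<close>

text \<open>The orthogonal indicators of the bubbles span the vectors constant on bubbles, and each
  is a difference of indicators of down-sets, which are points of the polytope. As 0 is one of its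
  points, affine and linear dimension agree.\<close>

lemma aff_dim_preorder_polytope:
  fixes I :: "'a::finite set"
  assumes P: "preorder_on I P"
  shows "aff_dim (preorder_polytope I P) = int (card (bubbles I P))"
proof -
  let ?S = "preorder_polytope I P" and ?B = "indic ` bubbles I P"
  have eq: "equiv I (P \<inter> P\<inverse>)" by (rule preorder_bubble_equiv[OF P])
  have ne: "C \<noteq> {}" "C \<subseteq> I" if "C \<in> bubbles I P" for C
    using that in_quotient_imp_non_empty[OF eq] in_quotient_imp_subset[OF eq] by (auto simp: bubbles_def)
  have disj: "C = D \<or> C \<inter> D = {}" if "C \<in> bubbles I P" "D \<in> bubbles I P" for C D
    using that quotient_disj[OF eq] by (auto simp: bubbles_def)
  have ind: "indic A \<in> ?S" if "down_set I P A" for A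
    using indic_order_cone[OF that] by (auto simp: preorder_polytope_eq box_cube_def order_cone_def)
  have inj: "inj_on (indic :: 'a set \<Rightarrow> real ^ 'a) X" for X
    by (rule inj_onI) (auto simp: vec_eq_iff split: if_splits)
  have indep: "independent ?B"
  proof (rule pairwise_orthogonal_independent)
    show "pairwise orthogonal ?B"
    proof (clarsimp simp: pairwise_def)
      fix C D assume CD: "C \<in> bubbles I P" "D \<in> bubbles I P" and n: "indic C \<noteq> (indic D :: real ^ 'a)"
      have "C \<inter> D = {}" using disj[OF CD] n by blast
      then show "orthogonal (indic C) (indic D :: real ^ 'a)"
        unfolding orthogonal_def inner_indic by (intro sum.neutral) auto
    qed
    show "0 \<notin> ?B"
    proof
      assume "0 \<in> ?B"
      then obtain C where C: "C \<in> bubbles I P" "indic C = (0 :: real ^ 'a)" by (metis imageE)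
      obtain i where "i \<in> C" using ne(1)[OF C(1)] by blast
      then have "indic C $ i = (1::real)" by simp
      then show False unfolding C(2) by simp
    qed
  qed
  have SB: "?S \<subseteq> span ?B"
  proof
    fix y assume "y \<in> ?S"
    then have y: "y \<in> order_cone I P" by (simp add: preorder_polytope_eq)
    have "y = (\<Sum>C\<in>bubbles I P. y $ (SOME i. i \<in> C) *\<^sub>R indic C)"
    proof (rule vec_eq_iff[THEN iffD2], rule allI)
      fix i
      show "y $ i = (\<Sum>C\<in>bubbles I P. y $ (SOME i. i \<in> C) *\<^sub>R indic C) $ i"
      proof (cases "i \<in> I")
        case True
        let ?C = "(P \<inter> P\<inverse>) `` {i}"
        have C: "?C \<in> bubbles I P" using True by (auto simp: bubbles_def intro: quotientI)
        have iC: "i \<in> ?C" using equiv_class_self[OF eq True] .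
        have "(SOME j. j \<in> ?C) \<in> ?C" using iC by (rule someI)
        then have "(i, SOME j. j \<in> ?C) \<in> P" "(SOME j. j \<in> ?C, i) \<in> P" by simp_all
        then have "y $ (SOME j. j \<in> ?C) = y $ i" by (intro antisym order_coneD(2)[OF y])
        moreover have "i \<in> D \<longleftrightarrow> D = ?C" if "D \<in> bubbles I P" for D
          using disj[OF that C] iC by blast
        then have "(\<Sum>C\<in>bubbles I P. y $ (SOME i. i \<in> C) *\<^sub>R indic C) $ i =
            (\<Sum>D\<in>bubbles I P. if D = ?C then y $ (SOME j. j \<in> D) else 0)"
          unfolding sum_component by (intro sum.cong) auto
        ultimately show ?thesis using C bubbles_finite[OF _ P] by simp
      next
        case False
        have "(\<Sum>C\<in>bubbles I P. y $ (SOME i. i \<in> C) *\<^sub>R indic C) $ i = 0"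
          unfolding sum_component using ne(2) False by (intro sum.neutral) auto
        then show ?thesis using order_coneD(1)[OF y False] by simp
      qed
    qed
    also have "\<dots> \<in> span ?B" by (intro span_sum span_scale span_base imageI)
    finally show "y \<in> span ?B" .
  qed
  have BS: "?B \<subseteq> span ?S"
  proof (rule image_subsetI)
    fix C assume "C \<in> bubbles I P"
    then obtain X Y where XY: "down_set I P X" "down_set I P Y" "X \<subseteq> Y" "C = Y - X"
      using bubble_interval[OF P] by metis
    have "indic C = indic Y - (indic X :: real ^ 'a)" using XY(3,4) by (auto simp: vec_eq_iff)
    then show "indic C \<in> span ?S" using ind XY by (metis span_base span_diff)
  qed
  have "0 \<in> ?S" using ind[of "{}"] by (simp add: indic_def vec_eq_iff zero_vec_def)
  then have "aff_dim ?S = int (dim ?S)" by (intro aff_dim_zero hull_inc)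
  also have "dim ?S = dim (span ?B)"
    using SB BS by (metis dim_span span_eq)
  also have "\<dots> = card ?B" using dim_eq_card_independent[OF indep] by (simp only: dim_span)
  also have "\<dots> = card (bubbles I P)" by (rule card_image[OF inj])
  finally show ?thesis .
qed

text \<open>The dilate by \<open>k\<close> counts weak maps with \<open>k + 1\<close> values, so by
  reciprocity the Ehrhart polynomial is the order polynomial at \<open>- k - 1\<close>, up to sign.
  This substitution is an involution, so \<open>Ehr\<^sup>*\<close> undoes it, and the signs cancel
  because the dimension is the number of bubbles.\<close>

lemma ehrhart_star_preorder_polytope:
  fixes I :: "'a::finite set"
  assumes P: "preorder_on I P"
  shows "ehrhart_star I (preorder_polytope I P) k = poly (ord_poly I P) k"
proof -
  let ?S = "preorder_polytope I P" and ?b = "card (bubbles I P)"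
  let ?e = "smult ((-1) ^ ?b) (pcompose (ord_poly I P) [:-1, -1:])"
  have e: "poly ?e x = (-1) ^ ?b * poly (ord_poly I P) (- x - 1)" for x
    by (simp add: poly_pcompose minus_diff_commute[of x 1])
  have eh: "ehrhart I ?S = ?e"
    unfolding ehrhart_def
  proof (rule the_equality)
    show *: "\<forall>k\<ge>1. poly ?e (real k) = real (card ((\<lambda>x. real k *\<^sub>R x) ` ?S \<inter> lattice I))"
    proof (intro allI impI)
      fix k :: nat assume "k \<ge> 1"
      then have k: "k > 0" by simp
      have h: "- real k - 1 = - real (Suc k)" by simp
      have "poly ?e (real k) = ((-1) ^ ?b * (-1) ^ ?b) * real (card (weak_maps I P (Suc k)))"
        unfolding e h poly_ord_poly(2)[OF finite P] by (simp only: mult.assoc)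
      then show "poly ?e (real k) = real (card ((\<lambda>x. real k *\<^sub>R x) ` ?S \<inter> lattice I))"
        unfolding card_lattice_points_dilate[OF P k] by (simp flip: power_mult_distrib)
    qed
    show "p = ?e" if "\<forall>k\<ge>1. poly p (real k) = real (card ((\<lambda>x. real k *\<^sub>R x) ` ?S \<inter> lattice I))" for p
      by (rule poly_eqI_nat) (use that * in auto)
  qed
  have "poly ?e (- k - 1) = (-1) ^ ?b * poly (ord_poly I P) k" unfolding e by simp
  then show ?thesis
    unfolding ehrhart_star_def aff_dim_preorder_polytope[OF P] eh nat_int
    by (simp only: mult.assoc[symmetric] power_mult_distrib[symmetric]) simp
qed

section \<open>The normal fan\<close>

definition tight_set :: "'a::finite set \<Rightarrow> ('a set \<Rightarrow> ereal) \<Rightarrow> (real ^ 'a) set \<Rightarrow> 'a set \<Rightarrow> bool" where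
  "tight_set I z F A \<longleftrightarrow> A \<subseteq> I \<and> (\<forall>x\<in>F. ereal (\<Sum>i\<in>A. x $ i) = z A)"

definition max_face :: "(real ^ 'a) set \<Rightarrow> real ^ 'a \<Rightarrow> (real ^ 'a::finite) set" where
  "max_face Q y = {x \<in> Q. \<forall>x'\<in>Q. y \<bullet> x' \<le> y \<bullet> x}"

lemma gen_permD:
  assumes "x \<in> gen_perm I z"
  shows "x \<in> coord_space I" "ereal (\<Sum>i\<in>I. x $ i) = z I"
    "A \<subseteq> I \<Longrightarrow> z A < \<infinity> \<Longrightarrow> ereal (\<Sum>i\<in>A. x $ i) \<le> z A"
  using assms by (auto simp: gen_perm_def)

lemma gen_perm_le:
  assumes "submodular I z" "x \<in> gen_perm I z" "A \<subseteq> I"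
  shows "ereal (\<Sum>i\<in>A. x $ i) \<le> z A"
  using gen_permD(3)[OF assms(2,3)] by (cases "z A < \<infinity>") auto

lemma tight_set_finite: "tight_set I z F A \<Longrightarrow> F \<noteq> {} \<Longrightarrow> z A < \<infinity>"
  unfolding tight_set_def by (metis ex_in_conv less_ereal.simps(4) PInfty_neq_ereal(1) ereal_less_PInfty ereal_infty_less(1))

lemma sum_Un_Int_eq:
  fixes f :: "'a::finite \<Rightarrow> real"
  shows "sum f (A \<union> B) + sum f (A \<inter> B) = sum f A + sum f B"
  by (rule sum.union_inter) auto

text \<open>Uncrossing: coordinate sums are modular and \<open>z\<close> is submodular, so tightness
  at \<open>A\<close> and \<open>B\<close> leaves no slack at their union and intersection.\<close>

lemma tight_set_Un_Int:
  assumes z: "submodular I z" and F: "F \<subseteq> gen_perm I z"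
    and A: "tight_set I z F A" and B: "tight_set I z F B"
  shows "tight_set I z F (A \<union> B)" "tight_set I z F (A \<inter> B)"
proof -
  have s: "A \<subseteq> I" "B \<subseteq> I" "A \<union> B \<subseteq> I" "A \<inter> B \<subseteq> I" using A B by (auto simp: tight_set_def)
  have "ereal (\<Sum>i\<in>A \<union> B. x $ i) = z (A \<union> B) \<and> ereal (\<Sum>i\<in>A \<inter> B. x $ i) = z (A \<inter> B)" if x: "x \<in> F" for x
  proof -
    have xP: "x \<in> gen_perm I z" using F x by blast
    have "z A = ereal (\<Sum>i\<in>A. x $ i)" "z B = ereal (\<Sum>i\<in>B. x $ i)"
      using A B x by (auto simp: tight_set_def)
    then have "z (A \<union> B) + z (A \<inter> B) \<le> ereal ((\<Sum>i\<in>A \<union> B. x $ i) + (\<Sum>i\<in>A \<inter> B. x $ i))"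
      using submodularD[OF z s(1,2)] unfolding sum_Un_Int_eq by simp
    then show ?thesis
      using gen_perm_le[OF z xP s(3)] gen_perm_le[OF z xP s(4)]
      by (cases "z (A \<union> B)"; cases "z (A \<inter> B)") auto
  qed
  then show "tight_set I z F (A \<union> B)" "tight_set I z F (A \<inter> B)" using s by (auto simp: tight_set_def)
qed

definition tight_preorder :: "'a::finite set \<Rightarrow> ('a set \<Rightarrow> ereal) \<Rightarrow> (real ^ 'a) set \<Rightarrow> 'a rel" where
  "tight_preorder I z F = (SOME P. preorder_on I P \<and> (\<forall>A. down_set I P A \<longleftrightarrow> tight_set I z F A))"

lemma tight_preorder:
  assumes z: "submodular I z" and F: "F \<subseteq> gen_perm I z"
  shows "preorder_on I (tight_preorder I z F)" "down_set I (tight_preorder I z F) A \<longleftrightarrow> tight_set I z F A"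
proof -
  obtain P where "preorder_on I P" "\<And>A. down_set I P A \<longleftrightarrow> tight_set I z F A"
  proof (rule preorder_of_lattice[of I "tight_set I z F"])
    show "tight_set I z F {}" using z by (simp add: tight_set_def submodular_def)
    show "tight_set I z F I" using F gen_permD(2) by (fastforce simp: tight_set_def)
    show "A \<subseteq> I" if "tight_set I z F A" for A using that by (simp add: tight_set_def)
    show "tight_set I z F (A \<union> B)" "tight_set I z F (A \<inter> B)" if "tight_set I z F A" "tight_set I z F B" for A B
      by (rule tight_set_Un_Int[OF z F that])+
  qed auto
  then have "\<exists>P. preorder_on I P \<and> (\<forall>A. down_set I P A \<longleftrightarrow> tight_set I z F A)" by blast
  from someI_ex[OF this]
  show "preorder_on I (tight_preorder I z F)" "down_set I (tight_preorder I z F) A \<longleftrightarrow> tight_set I z F A"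
    unfolding tight_preorder_def by blast+
qed

lemma preorder_mem_iff:
  "preorder_on I P \<Longrightarrow> (x, y) \<in> P \<longleftrightarrow> x \<in> I \<and> y \<in> I \<and> (\<forall>A. down_set I P A \<longrightarrow> y \<in> A \<longrightarrow> x \<in> A)"
  using down_set_principal[of I P y] preorder_reflD[of I P y] preorder_fieldD[of I P x y]
  by (auto dest: down_setD)

text \<open>Coordinate sums are modular at each point of \<open>F\<close>. So the equality for
  \<open>z\<close> on \<open>X\<close> and \<open>Y\<close> forces both defining inequalities of
  \<Pi>(z) to be equalities, and four tight sets give back the equality.\<close>

lemma tight_preorder_Pre:
  assumes z: "submodular I z" and F: "F \<subseteq> gen_perm I z" "F \<noteq> {}"
  shows "tight_preorder I z F \<in> Pre I z"
proof -
  note T = tight_preorder[OF z F(1)]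
  have "tight_set I z F X \<and> tight_set I z F Y \<longleftrightarrow> z X + z Y = z (X \<inter> Y) + z (X \<union> Y)"
    if XY: "X \<subseteq> I" "Y \<subseteq> I" "tight_set I z F (X \<inter> Y)" "tight_set I z F (X \<union> Y)" for X Y
  proof
    assume t: "tight_set I z F X \<and> tight_set I z F Y"
    obtain x where x: "x \<in> F" using F by blast
    have "z X = ereal (\<Sum>i\<in>X. x $ i)" "z Y = ereal (\<Sum>i\<in>Y. x $ i)"
      "z (X \<inter> Y) = ereal (\<Sum>i\<in>X \<inter> Y. x $ i)" "z (X \<union> Y) = ereal (\<Sum>i\<in>X \<union> Y. x $ i)"
      using t XY x by (auto simp: tight_set_def)
    then show "z X + z Y = z (X \<inter> Y) + z (X \<union> Y)"
      using sum_Un_Int_eq[of "\<lambda>i. x $ i" X Y] by simp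
  next
    assume e: "z X + z Y = z (X \<inter> Y) + z (X \<union> Y)"
    have "ereal (\<Sum>i\<in>X. x $ i) = z X \<and> ereal (\<Sum>i\<in>Y. x $ i) = z Y" if x: "x \<in> F" for x
    proof -
      have xP: "x \<in> gen_perm I z" using F x by blast
      have "z (X \<inter> Y) = ereal (\<Sum>i\<in>X \<inter> Y. x $ i)" "z (X \<union> Y) = ereal (\<Sum>i\<in>X \<union> Y. x $ i)"
        using XY x by (auto simp: tight_set_def)
      then have "z X + z Y = ereal ((\<Sum>i\<in>X. x $ i) + (\<Sum>i\<in>Y. x $ i))"
        using e sum_Un_Int_eq[of "\<lambda>i. x $ i" X Y] by simp
      then show ?thesis
        using gen_perm_le[OF z xP XY(1)] gen_perm_le[OF z xP XY(2)]
        by (cases "z X"; cases "z Y") auto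
    qed
    then show "tight_set I z F X \<and> tight_set I z F Y" using XY by (auto simp: tight_set_def)
  qed
  then show ?thesis
    unfolding Pre_iff[OF z] T(2) using T(1) tight_set_finite[OF _ F(2)] by blast
qed

lemma convex_gen_perm: "convex (gen_perm I z)"
proof (rule convexI)
  fix x y :: "real ^ 'a" and u v :: real
  assume x: "x \<in> gen_perm I z" and y: "y \<in> gen_perm I z" and uv: "0 \<le> u" "0 \<le> v" "u + v = 1"
  have s: "(\<Sum>i\<in>A. (u *\<^sub>R x + v *\<^sub>R y) $ i) = u * (\<Sum>i\<in>A. x $ i) + v * (\<Sum>i\<in>A. y $ i)" for A
    by (simp add: sum.distrib sum_distrib_left)
  have le: "ereal (u * a + v * b) \<le> c" if "ereal a \<le> c" "ereal b \<le> c" for a b c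
    using that uv convex_bound_le[of a _ b u v] by (cases c) auto
  have "(\<Sum>i\<in>I. x $ i) = (\<Sum>i\<in>I. y $ i)" using gen_permD(2)[OF x] gen_permD(2)[OF y] by (metis ereal.inject)
  then have "u * (\<Sum>i\<in>I. x $ i) + v * (\<Sum>i\<in>I. y $ i) = (\<Sum>i\<in>I. x $ i)"
    using uv(3) by (simp flip: distrib_right)
  then have eq: "ereal (\<Sum>i\<in>I. (u *\<^sub>R x + v *\<^sub>R y) $ i) = z I" unfolding s using gen_permD(2)[OF x] by simp
  have "u *\<^sub>R x + v *\<^sub>R y \<in> coord_space I"
    using gen_permD(1)[OF x] gen_permD(1)[OF y] by (simp add: coord_space_def)
  then show "u *\<^sub>R x + v *\<^sub>R y \<in> gen_perm I z"
    unfolding gen_perm_def mem_Collect_eq s using eq[unfolded s] le gen_permD(3)[OF x] gen_permD(3)[OF y] by blast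
qed

section \<open>Faces of the generalized permutahedron and their generic points\<close>

lemma max_face_face_of:
  assumes "convex Q"
  shows "max_face Q y face_of Q"
proof (cases "max_face Q y = {}")
  case False
  then obtain x0 where x0: "x0 \<in> Q" "\<And>x. x \<in> Q \<Longrightarrow> y \<bullet> x \<le> y \<bullet> x0" by (auto simp: max_face_def)
  have "max_face Q y = Q \<inter> {x. y \<bullet> x = y \<bullet> x0}"
  proof
    show "max_face Q y \<subseteq> Q \<inter> {x. y \<bullet> x = y \<bullet> x0}"
      using x0 by (auto simp: max_face_def intro!: antisym)
    show "Q \<inter> {x. y \<bullet> x = y \<bullet> x0} \<subseteq> max_face Q y"
      using x0(2) by (auto simp: max_face_def)
  qed
  then show ?thesis using face_of_Int_supporting_hyperplane_le[OF assms x0(2)] by simp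
qed simp

lemma polyhedron_gen_perm:
  assumes z: "submodular I z"
  shows "polyhedron (gen_perm I z)"
proof -
  let ?r = "\<lambda>A. real_of_ereal (z A)"
  have r: "z A = ereal (?r A)" if "A \<subseteq> I" "z A < \<infinity>" for A
    using submodular_finite[OF z that] by (metis real_of_ereal.simps(1))
  have rI: "z I = ereal (?r I)" by (rule r) (use z in \<open>auto simp: submodular_def\<close>)
  let ?H = "(\<Inter>i\<in>-I. {x :: real ^ 'a. axis i 1 \<bullet> x = 0}) \<inter> {x. indic I \<bullet> x = ?r I} \<inter>
    (\<Inter>A\<in>{A. A \<subseteq> I \<and> z A < \<infinity>}. {x. indic A \<bullet> x \<le> ?r A})"
  have "polyhedron ?H"
    by (intro polyhedron_Int polyhedron_Inter finite_imageI)
      (auto intro: polyhedron_hyperplane polyhedron_halfspace_le)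
  also have "?H = gen_perm I z"
  proof (rule set_eqI)
    fix x :: "real ^ 'a"
    have "x \<in> ?H \<longleftrightarrow> (\<forall>i. i \<notin> I \<longrightarrow> x $ i = 0) \<and> (\<Sum>i\<in>I. x $ i) = ?r I \<and>
        (\<forall>A\<subseteq>I. z A < \<infinity> \<longrightarrow> (\<Sum>i\<in>A. x $ i) \<le> ?r A)"
      by (auto simp: inner_indic inner_axis' )
    also have "(\<Sum>i\<in>I. x $ i) = ?r I \<longleftrightarrow> ereal (\<Sum>i\<in>I. x $ i) = z I" by (subst rI) simp
    also have "(\<forall>A\<subseteq>I. z A < \<infinity> \<longrightarrow> (\<Sum>i\<in>A. x $ i) \<le> ?r A) \<longleftrightarrow> (\<forall>A\<subseteq>I. z A < \<infinity> \<longrightarrow> ereal (\<Sum>i\<in>A. x $ i) \<le> z A)"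
      using r by (metis ereal_less_eq(3))
    finally show "x \<in> ?H \<longleftrightarrow> x \<in> gen_perm I z" by (simp add: gen_perm_def coord_space_def)
  qed
  finally show ?thesis .
qed

text \<open>Faces of a polyhedron are exposed, so each is cut out by a functional; dropping its
  coefficients outside \<open>I\<close> does not change its values on \<Pi>(z).\<close>

lemma face_of_gen_perm:
  assumes z: "submodular I z" and F: "F face_of gen_perm I z" "F \<noteq> {}"
  obtains y where "y \<in> coord_space I" "F = max_face (gen_perm I z) y"
proof -
  have "F exposed_face_of gen_perm I z"
    using exposed_face_of_polyhedron[OF polyhedron_gen_perm[OF z]] F(1) by blast
  then obtain a b where ab: "gen_perm I z \<subseteq> {x. a \<bullet> x \<le> b}" "F = gen_perm I z \<inter> {x. a \<bullet> x = b}"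
    unfolding exposed_face_of_def by blast
  define y :: "real ^ 'a" where "y = (\<chi> i. if i \<in> I then a $ i else 0)"
  have yx: "y \<bullet> x = a \<bullet> x" if "x \<in> gen_perm I z" for x
    unfolding inner_vec_def by (rule sum.cong) (use gen_permD(1)[OF that] in \<open>auto simp: y_def coord_space_def\<close>)
  obtain x0 where x0: "x0 \<in> F" using F(2) by blast
  have "F = max_face (gen_perm I z) y"
  proof
    show "F \<subseteq> max_face (gen_perm I z) y" using ab yx by (auto simp: max_face_def)
    show "max_face (gen_perm I z) y \<subseteq> F"
    proof
      fix x assume "x \<in> max_face (gen_perm I z) y"
      then have x: "x \<in> gen_perm I z" "y \<bullet> x0 \<le> y \<bullet> x" using x0 ab by (auto simp: max_face_def)
      then have "b \<le> a \<bullet> x" using x0 ab yx by auto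
      then show "x \<in> F" using x ab by (auto intro: antisym)
    qed
  qed
  moreover have "y \<in> coord_space I" by (simp add: y_def coord_space_def)
  ultimately show ?thesis using that by blast
qed

text \<open>A relative interior point works: prolonging the segment from \<open>y\<close> in
  \<open>F\<close> through \<open>x\<close> would violate an inequality that is tight at
  \<open>x\<close> and slack at \<open>y\<close>.\<close>

lemma ex_generic_point:
  assumes z: "submodular I z" and F: "F \<subseteq> gen_perm I z" "F \<noteq> {}" "convex F"
  obtains x where "x \<in> F" "\<And>A. A \<subseteq> I \<Longrightarrow> ereal (\<Sum>i\<in>A. x $ i) = z A \<Longrightarrow> tight_set I z F A"
proof -
  obtain x where x: "x \<in> rel_interior F" using F(2,3) rel_interior_eq_empty by blast
  have xF: "x \<in> F" using x rel_interior_subset by blast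
  have "tight_set I z F A" if A: "A \<subseteq> I" "ereal (\<Sum>i\<in>A. x $ i) = z A" for A
    unfolding tight_set_def
  proof (intro conjI ballI A(1))
    fix y assume y: "y \<in> F"
    obtain e where e: "e > 1" "(1 - e) *\<^sub>R y + e *\<^sub>R x \<in> F"
      using x y convex_rel_interior_iff[OF F(3,2)] by blast
    have "ereal (\<Sum>i\<in>A. ((1 - e) *\<^sub>R y + e *\<^sub>R x) $ i) \<le> z A" using gen_perm_le[OF z _ A(1)] e(2) F(1) by blast
    then have "(1 - e) * (\<Sum>i\<in>A. y $ i) + e * (\<Sum>i\<in>A. x $ i) \<le> (\<Sum>i\<in>A. x $ i)"
      unfolding A(2)[symmetric] by (simp add: sum.distrib sum_distrib_left)
    then have "(e - 1) * (\<Sum>i\<in>A. x $ i) \<le> (e - 1) * (\<Sum>i\<in>A. y $ i)" by (simp add: algebra_simps)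
    then have "(\<Sum>i\<in>A. x $ i) \<le> (\<Sum>i\<in>A. y $ i)" using e(1) by simp
    moreover have "ereal (\<Sum>i\<in>A. y $ i) \<le> ereal (\<Sum>i\<in>A. x $ i)"
      unfolding A(2) using gen_perm_le[OF z _ A(1)] y F(1) by blast
    ultimately show "ereal (\<Sum>i\<in>A. y $ i) = z A" unfolding A(2)[symmetric] by simp
  qed
  then show ?thesis using that xF by blast
qed

lemma sum_move_mass:
  fixes x :: "real ^ 'a::finite"
  shows "(\<Sum>l\<in>A. (x + e *\<^sub>R (axis j 1 - axis i 1)) $ l) =
    (\<Sum>l\<in>A. x $ l) + e * ((if j \<in> A then 1 else 0) - (if i \<in> A then 1 else 0))"
proof -
  have "(\<Sum>l\<in>A. (axis m (1::real) :: real ^ 'a) $ l) = (if m \<in> A then 1 else 0)" for m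
    by (simp add: axis_def)
  then show ?thesis by (simp add: sum.distrib sum_subtractf algebra_simps flip: sum_distrib_left)
qed

text \<open>If \<open>i \<le> j\<close> in the tight preorder of \<open>F\<close>, then mass may be moved from \<open>i\<close> to \<open>j\<close>
  at a generic point of \<open>F\<close>, since no tight set contains \<open>j\<close> without \<open>i\<close>.\<close>

lemma ex_perturbation:
  assumes z: "submodular I z" and F: "F \<subseteq> gen_perm I z" "F \<noteq> {}" "convex F"
    and ij: "(i, j) \<in> tight_preorder I z F"
  obtains x e where "x \<in> F" "e > 0" "x + e *\<^sub>R (axis j 1 - axis i 1) \<in> gen_perm I z"
proof -
  note T = tight_preorder[OF z F(1)]
  have I: "i \<in> I" "j \<in> I" using preorder_fieldD[OF T(1) ij] by auto
  obtain x where x: "x \<in> F" and gen: "\<And>A. A \<subseteq> I \<Longrightarrow> ereal (\<Sum>i\<in>A. x $ i) = z A \<Longrightarrow> tight_set I z F A"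
    using ex_generic_point[OF z F] by metis
  have xP: "x \<in> gen_perm I z" using x F by blast
  let ?S = "{A. A \<subseteq> I \<and> z A < \<infinity> \<and> j \<in> A \<and> i \<notin> A}"
  let ?s = "\<lambda>A. real_of_ereal (z A) - (\<Sum>i\<in>A. x $ i)"
  \<comment> \<open>The least slack among the sets that gain mass, positive by genericity; the 1
    covers the case that there is no such set.\<close>
  define e where "e = Min (insert 1 (?s ` ?S))"
  have s: "?s A > 0 \<and> z A = ereal (real_of_ereal (z A))" if A: "A \<in> ?S" for A
  proof -
    obtain r where r: "z A = ereal r" using submodular_finite[OF z, of A] A by auto
    have "ereal (\<Sum>i\<in>A. x $ i) \<noteq> z A"
      using gen[of A] A ij down_setD[of I "tight_preorder I z F" A i j] T(2) by auto
    then show ?thesis using gen_perm_le[OF z xP, of A] A r by auto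
  qed
  have e: "e > 0" unfolding e_def using s by (subst Min_gr_iff) auto
  have es: "e \<le> ?s A" if "A \<in> ?S" for A unfolding e_def by (rule Min_le) (use that in auto)
  let ?x = "x + e *\<^sub>R (axis j 1 - axis i 1)"
  note sum = sum_move_mass[of x e j i]
  have "?x \<in> gen_perm I z"
    unfolding gen_perm_def
  proof (intro CollectI conjI allI impI)
    show "?x \<in> coord_space I" using gen_permD(1)[OF xP] I by (auto simp: coord_space_def axis_def)
    show "ereal (\<Sum>l\<in>I. ?x $ l) = z I" unfolding sum using gen_permD(2)[OF xP] I by simp
    fix A assume A: "A \<subseteq> I" "z A < \<infinity>"
    show "ereal (\<Sum>l\<in>A. ?x $ l) \<le> z A"
    proof (cases "A \<in> ?S")
      case True
      then have "(\<Sum>l\<in>A. ?x $ l) \<le> real_of_ereal (z A)" unfolding sum using es[OF True] by auto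
      then show ?thesis using s[OF True] by (metis ereal_less_eq(3))
    next
      case False
      then have "(\<Sum>l\<in>A. ?x $ l) \<le> (\<Sum>l\<in>A. x $ l)" unfolding sum using A e by auto
      then show ?thesis using gen_permD(3)[OF xP A] by (meson ereal_less_eq(3) order_trans)
    qed
  qed
  then show ?thesis using that x e by blast
qed

section \<open>Normal cones are order cones\<close>

text \<open>Moving mass from \<open>i\<close> to \<open>j\<close> as in
  \<open>ex_perturbation\<close> stays in \<Pi>(z), so it cannot raise \<open>y\<close> above its
  maximum.\<close>

lemma max_face_order_cone:
  assumes z: "submodular I z" and y: "y \<in> coord_space I" and F: "F = max_face (gen_perm I z) y" "F \<noteq> {}"
  shows "y \<in> order_cone I (tight_preorder I z F)"
proof -
  have FP: "F \<subseteq> gen_perm I z" using F by (auto simp: max_face_def)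
  have cF: "convex F" using max_face_face_of[OF convex_gen_perm] F face_of_imp_convex by blast
  have "y $ j \<le> y $ i" if ij: "(i, j) \<in> tight_preorder I z F" for i j
  proof -
    obtain x e where x: "x \<in> F" "e > 0" "x + e *\<^sub>R (axis j 1 - axis i 1) \<in> gen_perm I z"
      using ex_perturbation[OF z FP F(2) cF ij] .
    then have "y \<bullet> (x + e *\<^sub>R (axis j 1 - axis i 1)) \<le> y \<bullet> x" using F by (auto simp: max_face_def)
    then have "e * (y $ j - y $ i) \<le> 0" by (simp add: inner_add_right inner_diff_right inner_axis)
    then show ?thesis using x(2) by (simp add: mult_le_0_iff)
  qed
  then show ?thesis using y by (auto simp: order_cone_def)
qed

text \<open>An element of the cone of \<open>P\<close> is a combination of indicators of down-sets, with non-negative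
  coefficients except at \<open>I\<close>; peeling off one level at a time avoids naming the coefficients.\<close>

lemma order_cone_inner_le:
  assumes P: "preorder_on I P" and y: "y \<in> order_cone I P"
    and le: "\<And>A. down_set I P A \<Longrightarrow> (\<Sum>i\<in>A. x' $ i) \<le> (\<Sum>i\<in>A. x $ i)"
    and eq: "(\<Sum>i\<in>I. x' $ i) = (\<Sum>i\<in>I. x $ i)"
  shows "y \<bullet> x' \<le> y \<bullet> x"
proof -
  have pos: "w \<bullet> x' \<le> w \<bullet> x" if "w \<in> order_cone I P" "\<forall>i. 0 \<le> w $ i" for w
    using that
  proof (induction "card {i. 0 < w $ i}" arbitrary: w rule: less_induct)
    case less
    note w = less.prems(1) and w0 = less.prems(2)
    let ?A = "{i. 0 < w $ i}"
    have AI: "?A \<subseteq> I" using order_coneD(1)[OF w] by fastforce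
    have A: "down_set I P ?A"
      unfolding down_set_def using AI order_coneD(2)[OF w] by (auto intro: less_le_trans)
    show ?case
    proof (cases "?A = {}")
      case True
      then have "w $ i = 0" for i using w0 by (metis (mono_tags) empty_Collect_eq order_le_less)
      then have "w = 0" by (simp add: vec_eq_iff)
      then show ?thesis by simp
    next
      case False
      \<comment> \<open>The support is a down-set; subtracting its smallest value times its
        indicator stays in the cone and makes the support strictly smaller.\<close>
      define t where "t = Min ((\<lambda>i. w $ i) ` ?A)"
      have "t \<in> (\<lambda>i. w $ i) ` ?A" unfolding t_def by (rule Min_in) (use False in auto)
      then obtain m where m: "m \<in> ?A" "w $ m = t" by auto
      have t0: "t > 0" using m by simp
      have tle: "t \<le> w $ i" if "i \<in> ?A" for i unfolding t_def by (rule Min_le) (use that in auto)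
      define v where "v = w - t *\<^sub>R indic ?A"
      have v: "v $ i = (if i \<in> ?A then w $ i - t else 0)" for i
        using w0[rule_format, of i] by (auto simp: v_def)
      have v0: "\<forall>i. 0 \<le> v $ i" using tle by (simp add: v)
      have vc: "v \<in> order_cone I P"
        unfolding order_cone_def coord_space_def
      proof (intro CollectI conjI allI impI ballI, simp_all only: case_prod_beta)
        show "v $ i = 0" if "i \<notin> I" for i using that AI by (auto simp: v)
        fix p assume p: "p \<in> P"
        then have "(fst p, snd p) \<in> P" by simp
        then have "w $ snd p \<le> w $ fst p" "snd p \<in> ?A \<Longrightarrow> fst p \<in> ?A"
          using order_coneD(2)[OF w] down_setD[OF A] by blast+
        then show "v $ snd p \<le> v $ fst p" using v0[rule_format, of "fst p"] by (auto simp: v)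
      qed
      have "{i. 0 < v $ i} \<subset> ?A"
      proof
        show "{i. 0 < v $ i} \<subseteq> ?A" by (auto simp: v split: if_splits)
        have "m \<notin> {i. 0 < v $ i}" using m by (simp add: v)
        then show "{i. 0 < v $ i} \<noteq> ?A" using m by blast
      qed
      then have "card {i. 0 < v $ i} < card ?A" by (intro psubset_card_mono) auto
      then have "v \<bullet> x' \<le> v \<bullet> x" using less.hyps vc v0 by blast
      moreover have "t * (\<Sum>i\<in>?A. x' $ i) \<le> t * (\<Sum>i\<in>?A. x $ i)" using le[OF A] t0 by simp
      moreover have "w \<bullet> u = v \<bullet> u + t * (\<Sum>i\<in>?A. u $ i)" for u
        by (simp add: v_def inner_diff_left inner_indic)
      ultimately show ?thesis by (metis add_mono)
    qed
  qed
  \<comment> \<open>Shifting by a multiple of the indicator of \<open>I\<close> makes all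
    coordinates non-negative and affects both sides equally, as the totals agree; the 0 gives the
    minimum a value for empty \<open>I\<close>.\<close>
  define t where "t = Min (insert 0 ((\<lambda>i. y $ i) ` I))"
  define w where "w = y - t *\<^sub>R indic I"
  have tle: "t \<le> y $ i" if "i \<in> I" for i unfolding t_def by (rule Min_le) (use that in auto)
  have "w \<in> order_cone I P"
    using y preorder_fieldD[OF P] by (auto simp: order_cone_def coord_space_def w_def)
  moreover have "\<forall>i. 0 \<le> w $ i" using tle order_coneD(1)[OF y] by (auto simp: w_def)
  ultimately have "w \<bullet> x' \<le> w \<bullet> x" by (rule pos)
  moreover have "y \<bullet> u = w \<bullet> u + t * (\<Sum>i\<in>I. u $ i)" for u
    by (simp add: w_def inner_diff_left inner_indic)
  ultimately show ?thesis using eq by simp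
qed

lemma closed_order_cone: "closed (order_cone I P)"
proof -
  have "order_cone I P = (\<Inter>i\<in>-I. {y. y $ i = 0}) \<inter> (\<Inter>p\<in>P. {y. y $ snd p \<le> y $ fst p})"
    by (simp add: order_cone_def coord_space_def case_prod_beta set_eq_iff) blast
  also have "closed \<dots>"
    by (intro closed_Int closed_INT ballI closed_Collect_eq closed_Collect_le continuous_intros)
  finally show ?thesis .
qed

text \<open>A vector \<open>y\<close> of the order cone may be maximal on more than
  \<open>F\<close>, but adding a positive multiple of \<open>y0\<close> singles out exactly
  \<open>F\<close>; small multiples place \<open>y\<close> in the closure.\<close>

lemma normal_cone_max_face:
  assumes z: "submodular I z" and y0: "y0 \<in> coord_space I" and F: "F = max_face (gen_perm I z) y0" "F \<noteq> {}"
  shows "normal_cone I (gen_perm I z) F = order_cone I (tight_preorder I z F)"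
proof
  let ?Q = "gen_perm I z" and ?P = "tight_preorder I z F"
  have FQ: "F \<subseteq> ?Q" using F by (auto simp: max_face_def)
  note T = tight_preorder[OF z FQ]
  have nc: "normal_cone I ?Q F = closure {y \<in> coord_space I. max_face ?Q y = F}"
    by (simp add: normal_cone_def max_face_def)
  show "normal_cone I ?Q F \<subseteq> order_cone I ?P"
    unfolding nc
    by (rule closure_minimal[OF _ closed_order_cone]) (use max_face_order_cone[OF z _ _ F(2)] in blast)
  show "order_cone I ?P \<subseteq> normal_cone I ?Q F"
  proof
    fix y assume y: "y \<in> order_cone I ?P"
    have max: "y \<bullet> x' \<le> y \<bullet> x" if x: "x \<in> F" and x': "x' \<in> ?Q" for x x'
    proof (rule order_cone_inner_le[OF T(1) y])
      fix A assume "down_set I ?P A"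
      then have A: "A \<subseteq> I" "ereal (\<Sum>i\<in>A. x $ i) = z A" using T(2) x by (auto simp: tight_set_def)
      have "ereal (\<Sum>i\<in>A. x' $ i) \<le> ereal (\<Sum>i\<in>A. x $ i)"
        unfolding A(2) by (rule gen_perm_le[OF z x' A(1)])
      then show "(\<Sum>i\<in>A. x' $ i) \<le> (\<Sum>i\<in>A. x $ i)" by simp
    next
      have "ereal (\<Sum>i\<in>I. x' $ i) = ereal (\<Sum>i\<in>I. x $ i)"
        using gen_permD(2)[OF x'] gen_permD(2)[of x I z] x FQ by auto
      then show "(\<Sum>i\<in>I. x' $ i) = (\<Sum>i\<in>I. x $ i)" by simp
    qed
    obtain x0 where x0: "x0 \<in> F" using F(2) by blast
    have eqF: "max_face ?Q (y + e *\<^sub>R y0) = F" if e: "e > 0" for e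
    proof
      show "F \<subseteq> max_face ?Q (y + e *\<^sub>R y0)"
      proof
        fix x assume x: "x \<in> F"
        have "(y + e *\<^sub>R y0) \<bullet> x' \<le> (y + e *\<^sub>R y0) \<bullet> x" if x': "x' \<in> ?Q" for x'
          using max[OF x x'] x x' F(1) e by (auto simp: inner_add_left max_face_def intro!: add_mono mult_left_mono)
        then show "x \<in> max_face ?Q (y + e *\<^sub>R y0)" using x FQ by (auto simp: max_face_def)
      qed
      show "max_face ?Q (y + e *\<^sub>R y0) \<subseteq> F"
      proof
        fix x assume x: "x \<in> max_face ?Q (y + e *\<^sub>R y0)"
        then have xQ: "x \<in> ?Q" by (simp add: max_face_def)
        have "(y + e *\<^sub>R y0) \<bullet> x0 \<le> (y + e *\<^sub>R y0) \<bullet> x" using x x0 FQ by (auto simp: max_face_def)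
        moreover have "y \<bullet> x \<le> y \<bullet> x0" by (rule max[OF x0 xQ])
        ultimately have "e * (y0 \<bullet> x0) \<le> e * (y0 \<bullet> x)" by (simp add: inner_add_left)
        then have "y0 \<bullet> x0 \<le> y0 \<bullet> x" using e by simp
        then show "x \<in> F" using xQ x0 unfolding F(1) max_face_def by (auto intro: order_trans)
      qed
    qed
    show "y \<in> normal_cone I ?Q F"
      unfolding nc closure_approachable
    proof (intro allI impI)
      fix d :: real assume d: "d > 0"
      define e where "e = d / (norm y0 + 1)"
      have n: "norm y0 + 1 > 0" by (smt (verit) norm_ge_zero)
      have e: "e > 0" using d n by (simp add: e_def)
      have "dist (y + e *\<^sub>R y0) y = e * norm y0" using e by (simp add: dist_norm)
      also have "\<dots> < e * (norm y0 + 1)" using e by simp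
      also have "\<dots> = d" using n by (simp add: e_def)
      finally have "dist (y + e *\<^sub>R y0) y < d" .
      moreover have "y + e *\<^sub>R y0 \<in> coord_space I"
        using y y0 by (auto simp: order_cone_def coord_space_def)
      ultimately show "\<exists>v\<in>{y \<in> coord_space I. max_face ?Q y = F}. dist v y < d"
        using eqF[OF e] by blast
    qed
  qed
qed

text \<open>Indicators of principal down-sets of \<open>P\<close> are test vectors: they lie in the
  cone of \<open>P\<close> and detect each pair missing from \<open>P\<close>.\<close>

lemma order_cone_subset_iff:
  assumes P: "preorder_on I P" and Q: "preorder_on I Q"
  shows "order_cone I P \<subseteq> order_cone I Q \<longleftrightarrow> Q \<subseteq> P"
proof
  assume sub: "order_cone I P \<subseteq> order_cone I Q"
  show "Q \<subseteq> P"
  proof clarify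
    fix i j assume ij: "(i, j) \<in> Q"
    have "indic {l. (l, j) \<in> P} \<in> order_cone I Q"
      using sub indic_order_cone[OF down_set_principal[OF P]] by blast
    from order_coneD(2)[OF this ij] show "(i, j) \<in> P"
      using preorder_reflD[OF P] preorder_fieldD[OF Q ij] by (simp split: if_splits)
  qed
qed (auto simp: order_cone_def)

text \<open>If no set between \<open>A\<close> and \<open>B\<close> has finite value, the mass \<open>z(B) - z(A)\<close> may be put on a single
  element of \<open>B - A\<close>.\<close>

lemma feasible_extension:
  fixes x :: "'a::finite \<Rightarrow> real"
  assumes z: "submodular I z"
  shows "A \<subseteq> B \<Longrightarrow> B \<subseteq> I \<Longrightarrow> z A < \<infinity> \<Longrightarrow> z B < \<infinity> \<Longrightarrow> (\<And>S. S \<subseteq> A \<Longrightarrow> ereal (sum x S) \<le> z S) \<Longrightarrow>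
    ereal (sum x A) = z A \<Longrightarrow>
    \<exists>x'. (\<forall>i\<in>A. x' i = x i) \<and> (\<forall>S\<subseteq>B. ereal (sum x' S) \<le> z S) \<and> ereal (sum x' B) = z B"
proof (induction "card (B - A)" arbitrary: A B x rule: less_induct)
  case less
  note AB = less.prems(1) and BI = less.prems(2) and zA = less.prems(3) and zB = less.prems(4)
    and feas = less.prems(5) and tight = less.prems(6)
  \<comment> \<open>Either a set of finite value in between splits the problem into two smaller
    ones, or only \<open>A\<close> and \<open>B\<close> are left.\<close>
  consider "A = B" | M where "A \<subset> M" "M \<subset> B" "z M < \<infinity>" |
    "A \<noteq> B" "\<And>M. A \<subseteq> M \<Longrightarrow> M \<subseteq> B \<Longrightarrow> z M < \<infinity> \<Longrightarrow> M = A \<or> M = B" by blast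
  then show ?case
  proof cases
    case 1
    then show ?thesis using feas tight by blast
  next
    case (2 M)
    have AM: "A \<subseteq> M" "M \<subseteq> I" "M \<subseteq> B" using 2 BI by auto
    have cs: "card (M - A) < card (B - A)" "card (B - M) < card (B - A)"
      using 2 by (auto intro!: psubset_card_mono)
    obtain x1 where x1: "\<forall>i\<in>A. x1 i = x i" "\<forall>S\<subseteq>M. ereal (sum x1 S) \<le> z S" "ereal (sum x1 M) = z M"
      using less.hyps[OF cs(1) AM(1,2) zA 2(3) feas tight] by blast
    obtain x2 where x2: "\<forall>i\<in>M. x2 i = x1 i" "\<forall>S\<subseteq>B. ereal (sum x2 S) \<le> z S" "ereal (sum x2 B) = z B"
      using less.hyps[OF cs(2) AM(3) BI 2(3) zB, of x1] x1(2,3) by blast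
    have "\<forall>i\<in>A. x2 i = x i" using x1(1) x2(1) 2(1) by auto
    then show ?thesis using x2 by blast
  next
    case 3
    then obtain b where b: "b \<in> B" "b \<notin> A" using AB by blast
    obtain ra where ra: "z A = ereal ra" using submodular_finite[OF z _ zA] AB BI by auto
    obtain rb where rb: "z B = ereal rb" using submodular_finite[OF z BI zB] .
    define x' where "x' = (\<lambda>i. if i \<in> A then x i else if i = b then rb - ra else 0)"
    have sx: "sum x' S = sum x (S \<inter> A) + (if b \<in> S then rb - ra else 0)" for S
    proof -
      have "sum x' S = sum x' (S \<inter> A) + sum x' (S - A)"
        by (metis Int_Diff_Un Int_Diff_disjoint finite sum.union_disjoint)
      also have "sum x' (S \<inter> A) = sum x (S \<inter> A)" by (rule sum.cong) (auto simp: x'_def)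
      also have "sum x' (S - A) = (\<Sum>i\<in>S - A. if i = b then rb - ra else 0)"
        by (rule sum.cong) (auto simp: x'_def)
      also have "\<dots> = (if b \<in> S then rb - ra else 0)" using b by simp
      finally show ?thesis .
    qed
    have "ereal (sum x' S) \<le> z S" if S: "S \<subseteq> B" for S
    proof (cases "z S < \<infinity>")
      case True
      have SI: "S \<subseteq> I" "A \<subseteq> I" using S AB BI by auto
      have f: "z (S \<union> A) < \<infinity>" using submodular_finite_Un(1)[OF z SI True zA] .
      have "ereal (sum x (S \<inter> A)) \<le> z (S \<inter> A)" by (rule feas) simp
      \<comment> \<open>If \<open>S \<union> A = B\<close>, this bounds the sum
        \<open>x(S \<inter> A) + z(B) - z(A)\<close> of \<open>x'\<close> over \<open>S\<close>; if
        \<open>S\<close> lies in \<open>A\<close>, the sum is the old one.\<close>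
      moreover have sub: "z (S \<union> A) + z (S \<inter> A) \<le> z S + z A" by (rule submodularD[OF z SI])
      consider "S \<union> A = A" | "S \<union> A = B" using 3(2)[of "S \<union> A"] f S AB by blast
      then show ?thesis
      proof cases
        case 1
        then have "S \<subseteq> A" by blast
        then have "S \<inter> A = S" "b \<notin> S" using b by auto
        then show ?thesis using sx[of S] feas[OF \<open>S \<subseteq> A\<close>] by simp
      next
        case 2
        then have "b \<in> S" using b by blast
        then have "sum x' S = sum x (S \<inter> A) + rb - ra" using sx[of S] by simp
        then show ?thesis
          using \<open>ereal (sum x (S \<inter> A)) \<le> z (S \<inter> A)\<close> sub unfolding 2 ra rb
          by (cases "z S"; cases "z (S \<inter> A)") auto
      qed
    qed auto
    moreover have "ereal (sum x' B) = z B"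
      using sx[of B] b tight AB unfolding ra rb by (simp add: Int_absorb1)
    moreover have "\<forall>i\<in>A. x' i = x i" by (simp add: x'_def)
    ultimately show ?thesis by blast
  qed
qed

section \<open>Realizing conforming preorders by faces\<close>

text \<open>A greedy construction along a maximal chain of down-sets: each step extends from a
  maximal proper down-set \<open>A\<close> to \<open>B\<close> by \<open>feasible_extension\<close>.
  Down-sets off the chain become tight because \<open>z\<close> is additive on down-sets.\<close>

lemma ex_feasible_tight:
  fixes I :: "'a::finite set"
  assumes z: "submodular I z" and P: "P \<in> Pre I z"
  shows "down_set I P B \<Longrightarrow>
    \<exists>x::'a \<Rightarrow> real. (\<forall>S\<subseteq>B. ereal (sum x S) \<le> z S) \<and> (\<forall>S\<subseteq>B. down_set I P S \<longrightarrow> ereal (sum x S) = z S)"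
proof (induction "card B" arbitrary: B rule: less_induct)
  case less
  note B = less.prems
  have fin: "\<And>A. down_set I P A \<Longrightarrow> z A < \<infinity>" using P by (auto simp: Pre_iff[OF z])
  have mod: "z X + z Y = z (X \<inter> Y) + z (X \<union> Y)" if "down_set I P X" "down_set I P Y" for X Y
    using P that down_set_Int[OF that] down_set_Un[OF that] down_set_subset[OF that(1)] down_set_subset[OF that(2)]
    unfolding Pre_iff[OF z] by blast
  show ?case
  proof (cases "B = {}")
    case True
    have "z {} = 0" using z by (simp add: submodular_def)
    then show ?thesis using True by auto
  next
    case False
    let ?D = "{A. down_set I P A \<and> A \<subset> B}"
    have "{} \<in> ?D" using False by auto
    then have "?D \<noteq> {}" by (metis empty_iff)
    with finite obtain A where A: "A \<in> ?D" and "\<forall>M\<in>?D. A \<subseteq> M \<longrightarrow> A = M"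
      by (rule finite_has_maximal[elim_format]) (erule bexE)
    then have Amax: "M = A" if "M \<in> ?D" "A \<subseteq> M" for M using that by (metis (no_types, lifting))
    have dA: "down_set I P A" and AB: "A \<subset> B" using A by auto
    have "card A < card B" using AB by (intro psubset_card_mono) auto
    then obtain x :: "'a \<Rightarrow> real" where x: "\<forall>S\<subseteq>A. ereal (sum x S) \<le> z S"
      "\<forall>S\<subseteq>A. down_set I P S \<longrightarrow> ereal (sum x S) = z S"
      using less.hyps dA by blast
    have "A \<subseteq> B" using AB by blast
    then obtain x' where x': "\<forall>i\<in>A. x' i = x i" "\<forall>S\<subseteq>B. ereal (sum x' S) \<le> z S" "ereal (sum x' B) = z B"
      using feasible_extension[OF z _ down_set_subset[OF B] fin[OF dA] fin[OF B], of x] x dA by auto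
    have agree: "sum x' S = sum x S" if "S \<subseteq> A" for S
      by (rule sum.cong) (use x'(1) that in auto)
    have "ereal (sum x' S) = z S" if S: "S \<subseteq> B" "down_set I P S" for S
    proof (cases "S \<subseteq> A")
      case True
      then show ?thesis using agree x(2) S by simp
    next
      case False
      \<comment> \<open>By maximality of \<open>A\<close>. As \<open>A\<close>, \<open>B\<close> and
        \<open>S \<inter> A\<close> are tight, additivity of \<open>z\<close> then determines the
        sum over \<open>S\<close>.\<close>
      have SA: "S \<union> A = B"
      proof (rule ccontr)
        assume "S \<union> A \<noteq> B"
        then have "S \<union> A \<in> ?D" using S AB down_set_Un[OF S(2) dA] by blast
        then show False using Amax[of "S \<union> A"] False by blast
      qed
      have e: "z S + z A = z (S \<inter> A) + z B" using mod[OF S(2) dA] SA by simp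
      have t: "z (S \<inter> A) = ereal (sum x' (S \<inter> A))" "z A = ereal (sum x' A)" "z B = ereal (sum x' B)"
        using agree[of "S \<inter> A"] agree[of A] x(2) dA down_set_Int[OF S(2) dA] x'(3) by auto
      obtain s where s: "z S = ereal s"
        using submodular_finite[OF z down_set_subset[OF S(2)] fin[OF S(2)]] .
      have "s + sum x' A = sum x' (S \<inter> A) + sum x' B" using e unfolding t s by simp
      moreover have "sum x' (S \<union> A) + sum x' (S \<inter> A) = sum x' S + sum x' A" by (rule sum_Un_Int_eq)
      ultimately show ?thesis unfolding s SA by simp
    qed
    then show ?thesis using x'(2) by blast
  qed
qed

definition tight_face :: "'a::finite set \<Rightarrow> ('a set \<Rightarrow> ereal) \<Rightarrow> 'a rel \<Rightarrow> (real ^ 'a) set" where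
  "tight_face I z P = {x \<in> gen_perm I z. \<forall>A. down_set I P A \<longrightarrow> ereal (\<Sum>i\<in>A. x $ i) = z A}"

lemma tight_face_nonempty:
  assumes z: "submodular I z" and P: "P \<in> Pre I z"
  shows "tight_face I z P \<noteq> {}"
proof -
  have dI: "down_set I P I" using P by (auto simp: Pre_iff[OF z] intro: down_set_carrier)
  obtain x :: "'a \<Rightarrow> real" where x: "\<forall>S\<subseteq>I. ereal (sum x S) \<le> z S" "\<forall>S\<subseteq>I. down_set I P S \<longrightarrow> ereal (sum x S) = z S"
    using ex_feasible_tight[OF z P dI] by blast
  define v :: "real ^ 'a" where "v = (\<chi> i. if i \<in> I then x i else 0)"
  have s: "(\<Sum>i\<in>A. v $ i) = sum x A" if "A \<subseteq> I" for A
    by (rule sum.cong) (use that in \<open>auto simp: v_def\<close>)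
  have "v \<in> gen_perm I z"
    unfolding gen_perm_def using x dI s by (auto simp: coord_space_def v_def)
  moreover have "ereal (\<Sum>i\<in>A. v $ i) = z A" if "down_set I P A" for A
    using x(2) s[OF down_set_subset[OF that]] that down_set_subset[OF that] by simp
  ultimately show ?thesis by (auto simp: tight_face_def)
qed

text \<open>The sum of the indicators of all down-sets is the functional: its summands reach their
  bounds simultaneously because \<open>tight_face\<close> is non-empty, so a maximizer must be tight
  for each of them.\<close>

lemma tight_face_max_face:
  assumes z: "submodular I z" and P: "P \<in> Pre I z"
  obtains y where "y \<in> coord_space I" "tight_face I z P = max_face (gen_perm I z) y"
proof -
  let ?D = "{A. down_set I P A}" and ?Q = "gen_perm I z"
  define y :: "real ^ 'a" where "y = (\<Sum>A\<in>?D. indic A)"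
  have yc: "y \<in> coord_space I"
    unfolding y_def by (rule subspace_sum[OF subspace_coord_space]) (auto simp: coord_space_def dest: down_set_subset)
  have yx: "y \<bullet> x = (\<Sum>A\<in>?D. \<Sum>i\<in>A. x $ i)" for x by (simp add: y_def inner_sum_left inner_indic)
  have le: "(\<Sum>i\<in>A. x' $ i) \<le> (\<Sum>i\<in>A. x $ i)" if "x' \<in> ?Q" "x \<in> tight_face I z P" "A \<in> ?D" for x x' A
  proof -
    have "ereal (\<Sum>i\<in>A. x' $ i) \<le> ereal (\<Sum>i\<in>A. x $ i)"
      using gen_perm_le[OF z that(1), of A] that(2,3) by (auto simp: tight_face_def dest: down_set_subset)
    then show ?thesis by simp
  qed
  obtain x0 where x0: "x0 \<in> tight_face I z P" using tight_face_nonempty[OF z P] by blast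
  have "tight_face I z P = max_face ?Q y"
  proof
    show "tight_face I z P \<subseteq> max_face ?Q y"
    proof
      fix x assume x: "x \<in> tight_face I z P"
      then have "y \<bullet> x' \<le> y \<bullet> x" if "x' \<in> ?Q" for x'
        unfolding yx by (intro sum_mono le[OF that x])
      then show "x \<in> max_face ?Q y" using x by (auto simp: max_face_def tight_face_def)
    qed
    show "max_face ?Q y \<subseteq> tight_face I z P"
    proof
      fix x assume "x \<in> max_face ?Q y"
      then have xQ: "x \<in> ?Q" and m: "y \<bullet> x0 \<le> y \<bullet> x" using x0 by (auto simp: max_face_def tight_face_def)
      have "y \<bullet> x \<le> y \<bullet> x0" unfolding yx by (intro sum_mono le[OF xQ x0])
      then have "(\<Sum>A\<in>?D. (\<Sum>i\<in>A. x0 $ i) - (\<Sum>i\<in>A. x $ i)) = 0"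
        using m unfolding yx by (simp add: sum_subtractf)
      then have "\<forall>A\<in>?D. (\<Sum>i\<in>A. x0 $ i) - (\<Sum>i\<in>A. x $ i) = 0"
        using le[OF xQ x0] by (subst (asm) sum_nonneg_eq_0_iff) auto
      then have "ereal (\<Sum>i\<in>A. x $ i) = z A" if "down_set I P A" for A
        using x0 that by (auto simp: tight_face_def)
      then show "x \<in> tight_face I z P" using xQ by (simp add: tight_face_def)
    qed
  qed
  then show ?thesis using that yc by blast
qed

text \<open>Further sets might be tight on the face, so a priori its preorder is only contained in
  \<open>P\<close>. Both preorders conform to \<open>z\<close>, and the splitting argument excludes
  a proper inclusion.\<close>

lemma tight_preorder_tight_face:
  assumes z: "submodular I z" and P: "P \<in> Pre I z"
  shows "tight_preorder I z (tight_face I z P) = P"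
proof -
  let ?F = "tight_face I z P" let ?R = "tight_preorder I z ?F"
  have pre: "preorder_on I P" using P by (simp add: Pre_iff[OF z])
  have FQ: "?F \<subseteq> gen_perm I z" by (auto simp: tight_face_def)
  note ne = tight_face_nonempty[OF z P] and T = tight_preorder[OF z FQ]
  have RPre: "?R \<in> Pre I z" by (rule tight_preorder_Pre[OF z FQ ne])
  have cF: "convex ?F"
    using tight_face_max_face[OF z P] max_face_face_of[OF convex_gen_perm] face_of_imp_convex by metis
  have down: "down_set I ?R A" if "down_set I P A" for A
    unfolding T(2) tight_set_def using that by (auto simp: tight_face_def dest: down_set_subset)
  have RP: "?R \<subseteq> P" using preorder_subset_iff[OF T(1) pre] down by blast
  have "P = ?R"
  proof (rule preorder_eq_by_splitting[OF finite pre T(1) RP])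
    \<comment> \<open>Moving mass from \<open>w\<close> to \<open>c\<close> does not affect
      \<open>P\<close>-down-sets, which contain both or neither, so the new point is again in the
      face; hence a set tight on the face that contains \<open>w\<close> contains
      \<open>c\<close>.\<close>
    fix w c assume wc: "(w, c) \<in> ?R" and cw: "(c, w) \<in> P"
    have wcP: "(w, c) \<in> P" using RP wc by blast
    obtain x e where x: "x \<in> ?F" "e > 0" "x + e *\<^sub>R (axis c 1 - axis w 1) \<in> gen_perm I z"
      using ex_perturbation[OF z FQ ne cF wc] .
    let ?x = "x + e *\<^sub>R (axis c 1 - axis w 1)"
    note sum = sum_move_mass[of x e c w]
    have "ereal (\<Sum>l\<in>A. ?x $ l) = z A" if A: "down_set I P A" for A
    proof -
      have "c \<in> A \<longleftrightarrow> w \<in> A" using down_setD[OF A] wcP cw by blast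
      then show ?thesis unfolding sum using x(1) A by (simp add: tight_face_def)
    qed
    then have xF: "?x \<in> ?F" using x(3) by (simp add: tight_face_def)
    have "c \<in> A" if A: "down_set I ?R A" and w: "w \<in> A" for A
    proof -
      have "ereal (\<Sum>l\<in>A. ?x $ l) = ereal (\<Sum>l\<in>A. x $ l)"
        using A xF x(1) unfolding T(2) tight_set_def by auto
      then have "e * ((if c \<in> A then 1 else 0) - (if w \<in> A then 1 else 0)) = 0" unfolding sum by simp
      then show ?thesis using w x(2) by (auto split: if_splits)
    qed
    then show "(c, w) \<in> ?R"
      using preorder_mem_iff[OF T(1), of c w] preorder_fieldD[OF T(1) wc] by blast
  next
    \<comment> \<open>Conformity of the tight preorder yields the equality for \<open>z\<close>, and
      conformity of \<open>P\<close> converts it back into down-sets.\<close>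
    fix X Y assume XY: "X \<subseteq> I" "Y \<subseteq> I" "down_set I P (X \<inter> Y)" "down_set I P (X \<union> Y)"
      and d: "down_set I ?R X" "down_set I ?R Y"
    have "z X + z Y = z (X \<inter> Y) + z (X \<union> Y)"
      using RPre XY(1,2) d down_set_Int[OF d] down_set_Un[OF d] unfolding Pre_iff[OF z] by blast
    then show "down_set I P X" using P XY unfolding Pre_iff[OF z] by blast
  qed
  then show ?thesis by simp
qed

lemma normal_fan_gen_perm:
  assumes z: "submodular I z"
  shows "normal_fan I (gen_perm I z) = order_cone I ` Pre I z"
proof
  let ?Q = "gen_perm I z"
  show "normal_fan I ?Q \<subseteq> order_cone I ` Pre I z"
  proof
    fix K assume "K \<in> normal_fan I ?Q"
    then obtain F where F: "F face_of ?Q" "F \<noteq> {}" "K = normal_cone I ?Q F" by (auto simp: normal_fan_def)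
    obtain y where y: "y \<in> coord_space I" "F = max_face ?Q y" using face_of_gen_perm[OF z F(1,2)] .
    have "K = order_cone I (tight_preorder I z F)"
      unfolding F(3) by (rule normal_cone_max_face[OF z y F(2)])
    then show "K \<in> order_cone I ` Pre I z"
      using tight_preorder_Pre[OF z face_of_imp_subset[OF F(1)] F(2)] by blast
  qed
  show "order_cone I ` Pre I z \<subseteq> normal_fan I ?Q"
  proof (rule image_subsetI)
    fix P assume P: "P \<in> Pre I z"
    let ?F = "tight_face I z P"
    obtain y where y: "y \<in> coord_space I" "?F = max_face ?Q y" using tight_face_max_face[OF z P] .
    have "normal_cone I ?Q ?F = order_cone I P"
      using normal_cone_max_face[OF z y tight_face_nonempty[OF z P]] tight_preorder_tight_face[OF z P] by simp
    moreover have "?F face_of ?Q" unfolding y(2) by (rule max_face_face_of[OF convex_gen_perm])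
    ultimately show "order_cone I P \<in> normal_fan I ?Q"
      unfolding normal_fan_def using tight_face_nonempty[OF z P] by blast
  qed
qed

text \<open>Inclusion of cones reverses inclusion of preorders. Injectivity gives one term per
  preorder when the sum over cones is reindexed.\<close>

lemma maximal_cones_gen_perm:
  assumes z: "submodular I z"
  shows "maximal_cones I (gen_perm I z) = order_cone I ` minPre I z" "inj_on (order_cone I) (Pre I z)"
proof -
  have le: "order_cone I P \<subseteq> order_cone I Q \<longleftrightarrow> Q \<subseteq> P" if "P \<in> Pre I z" "Q \<in> Pre I z" for P Q
    using order_cone_subset_iff that by (auto simp: Pre_iff[OF z])
  then have eq: "order_cone I P = order_cone I Q \<longleftrightarrow> P = Q" if "P \<in> Pre I z" "Q \<in> Pre I z" for P Q
    using that by blast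
  show "maximal_cones I (gen_perm I z) = order_cone I ` minPre I z"
    unfolding maximal_cones_def normal_fan_gen_perm[OF z] minPre_def using le eq by auto
  show "inj_on (order_cone I) (Pre I z)" using eq by (auto intro: inj_onI)
qed

theorem theorem13p4:
  fixes I :: "'a::finite set" and z :: "'a set \<Rightarrow> ereal"
  assumes "submodular I z"
  shows "(\<forall>k::real. poly (chi I z) k =
            (\<Sum>P\<in>minPre I z. ehrhart_star I (preorder_polytope I P) k)) \<and>
         (\<forall>k::nat. poly (chi I z) (real k) =
            (\<Sum>K\<in>maximal_cones I (gen_perm I z).
               real (card (rel_interior (K \<inter> box_cube I (real k + 1)) \<inter> lattice I))))"
proof (intro conjI allI)
  have pre: "preorder_on I P" if "P \<in> minPre I z" for P
    using that by (simp add: minPre_def Pre_iff[OF assms])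
  show "poly (chi I z) k = (\<Sum>P\<in>minPre I z. ehrhart_star I (preorder_polytope I P) k)" for k
    unfolding poly_chi[OF finite assms] by (rule sum.cong) (simp_all add: ehrhart_star_preorder_polytope pre)
  have "minPre I z \<subseteq> Pre I z" by (auto simp: minPre_def)
  then have inj: "inj_on (order_cone I) (minPre I z)"
    using maximal_cones_gen_perm(2)[OF assms] by (rule inj_on_subset[rotated])
  show "poly (chi I z) (real k) = (\<Sum>K\<in>maximal_cones I (gen_perm I z).
      real (card (rel_interior (K \<inter> box_cube I (real k + 1)) \<inter> lattice I)))" for k
    unfolding poly_chi[OF finite assms] maximal_cones_gen_perm(1)[OF assms] sum.reindex[OF inj] o_def
    by (rule sum.cong) (simp_all add: card_interior_lattice_points poly_ord_poly(1) pre)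
qed

end
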